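(* Let $p\le q$ be positive integers with $\gcd(p,q)=1$. Then for all sufficiently large integers $n$ (depending on $p,q$), $$M_h(p,q,n)\;\ge\;\frac{n^2-1}{d},\qquad d=\gcd(n-1,\,p+q).$$
   Context: Consider planar systems $$\dot x=px+P(x,y),\qquad \dot y=-qy+Q(x,y),$$ where $P,Q$ are real or complex polynomials without constant and linear terms, and $p\le q$ are positive integers with $\gcd(p,q)=1$ (a $p:-q$ resonant saddle at the origin). There is a formal change of coordinates $X=x+\text{h.o.t.}$, $Y=y+\text{h.o.t.}$ (h.o.t. = higher-order terms) bringing the system to the formal normal form $$\dot X=pX\Bigl(1+\sum_{k\ge1}\pi_{1,k}(X^qY^p)^k\Bigr),\qquad \dot Y=-qY\Bigl(1+\sum_{k\ge1}\pi_{2,k}(X^qY^p)^k\Bigr).$$ The quantity $\pi_k=\pi_{1,k}-\pi_{2,k}$ is the $k$-th saddle value, also denoted $L_k$. The saddle order of the system is the minimal $k$ with $L_k\ne0$ (it does not depend on the choice of the change of coordinates). The system is integrable (the origin is a generalized center) if and only if all $L_k$ vanish, in which case the saddle order is not defined. $M_h(p,q,n)$ denotes the maximal possible saddle order among the (non-integrable) systems of the form $\dot x=px+P(x,y)$, $\dot y=-qy+Q(x,y)$ in which $P$ and $Q$ are homogeneous polynomials of degree $n$. This maximum is finite by Hilbert's Basis Theorem. The base field may be $\mathbb R$ or $\mathbb C$; the result is asserted in both cases. *)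

theory Defs
  imports "HOL-Computational_Algebra.Computational_Algebra" "HOL-Library.Extended_Nat"
    Complex_Main
begin

text \<open>
  Formal power series in \<open>x, y\<close> are elements of \<open>'a fps fps\<close>, and polynomials in \<open>x, y\<close> are elements
  of \<open>'a poly poly\<close>. The outer variable is \<open>x\<close>, the inner variable is \<open>y\<close>: the coefficient of
  \<open>x\<^sup>i y\<^sup>j\<close> is \<open>F $ i $ j\<close> and \<open>coeff (coeff P i) j\<close>, respectively.
\<close>

definition var_x :: "'a::field_char_0 fps fps" where
  "var_x = fps_X"

definition var_y :: "'a::field_char_0 fps fps" where
  "var_y = fps_const fps_X"

definition fps2_of_poly2 :: "'a::field_char_0 poly poly \<Rightarrow> 'a fps fps" where
  "fps2_of_poly2 P = fps_of_poly (map_poly fps_of_poly P)"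

definition deriv_x :: "'a::field_char_0 fps fps \<Rightarrow> 'a fps fps" where
  "deriv_x F = fps_deriv F"

definition deriv_y :: "'a::field_char_0 fps fps \<Rightarrow> 'a fps fps" where
  "deriv_y F = Abs_fps (\<lambda>i. fps_deriv (F $ i))"

definition no_low_terms :: "'a::field_char_0 fps fps \<Rightarrow> bool" where
  "no_low_terms F \<longleftrightarrow> (\<forall>i j. i + j < 2 \<longrightarrow> F $ i $ j = 0)"

definition homogeneous2 :: "nat \<Rightarrow> 'a::field_char_0 poly poly \<Rightarrow> bool" where
  "homogeneous2 n P \<longleftrightarrow> (\<forall>i j. coeff (coeff P i) j \<noteq> 0 \<longrightarrow> i + j = n)"

text \<open>
  The series \<open>\<Sum>k\<ge>1. c k * U ^ k\<close>, for \<open>U\<close> without constant term. Then \<open>U ^ k\<close> has no terms of total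
  degree below \<open>k\<close>, so only \<open>k \<le> i + j\<close> contribute to the coefficient of \<open>x\<^sup>i y\<^sup>j\<close>.
  (\<open>fps_compose\<close> does not apply: it would require \<open>U $ 0 = 0\<close>, i.e. divisibility of \<open>U\<close> by \<open>x\<close>.)
\<close>
definition power_sum :: "(nat \<Rightarrow> 'a) \<Rightarrow> 'a::field_char_0 fps fps \<Rightarrow> 'a fps fps" where
  "power_sum c U = Abs_fps (\<lambda>i. Abs_fps (\<lambda>j. \<Sum>k=1..i + j. c k * (U ^ k) $ i $ j))"

text \<open>Time derivative of \<open>F(x, y)\<close> along the system \<open>x' = p x + P(x, y)\<close>, \<open>y' = - q y + Q(x, y)\<close>.\<close>
definition time_deriv ::
  "nat \<Rightarrow> nat \<Rightarrow> 'a::field_char_0 poly poly \<Rightarrow> 'a poly poly \<Rightarrow> 'a fps fps \<Rightarrow> 'a fps fps" where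
  "time_deriv p q P Q F =
     deriv_x F * (of_nat p * var_x + fps2_of_poly2 P) +
     deriv_y F * (- of_nat q * var_y + fps2_of_poly2 Q)"

text \<open>
  The formal change of coordinates \<open>X = x + h.o.t.\<close>, \<open>Y = y + h.o.t.\<close> brings the system to the
  resonant normal form with coefficients \<open>\<pi>1 k\<close>, \<open>\<pi>2 k\<close>, \<open>k \<ge> 1\<close> (the values at \<open>0\<close> are irrelevant).
\<close>
definition normal_form_change ::
  "nat \<Rightarrow> nat \<Rightarrow> 'a::field_char_0 poly poly \<Rightarrow> 'a poly poly \<Rightarrow> 'a fps fps \<Rightarrow> 'a fps fps \<Rightarrow>
    (nat \<Rightarrow> 'a) \<Rightarrow> (nat \<Rightarrow> 'a) \<Rightarrow> bool" where
  "normal_form_change p q P Q X Y \<pi>1 \<pi>2 \<longleftrightarrow>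
     no_low_terms (X - var_x) \<and> no_low_terms (Y - var_y) \<and>
     time_deriv p q P Q X = of_nat p * X * (1 + power_sum \<pi>1 (X ^ q * Y ^ p)) \<and>
     time_deriv p q P Q Y = - of_nat q * Y * (1 + power_sum \<pi>2 (X ^ q * Y ^ p))"

text \<open>
  The saddle values \<open>\<pi>1 k - \<pi>2 k\<close> may depend on the chosen change of coordinates, but the least
  index of a nonzero one does not; hence the existential quantifier. An integrable system has no
  saddle order.
\<close>
definition has_saddle_order ::
  "nat \<Rightarrow> nat \<Rightarrow> 'a::field_char_0 poly poly \<Rightarrow> 'a poly poly \<Rightarrow> nat \<Rightarrow> bool" where
  "has_saddle_order p q P Q m \<longleftrightarrow>
     (\<exists>X Y \<pi>1 \<pi>2. normal_form_change p q P Q X Y \<pi>1 \<pi>2 \<and>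
        1 \<le> m \<and> \<pi>1 m - \<pi>2 m \<noteq> 0 \<and> (\<forall>k. 1 \<le> k \<and> k < m \<longrightarrow> \<pi>1 k - \<pi>2 k = 0))"

text \<open>
  The type argument is the base field. The supremum is taken in \<open>enat\<close>, so that no finiteness result
  is built into the definition; a natural number \<open>N > 0\<close> is below it iff some system has saddle order
  at least \<open>N\<close>. As usual, \<open>0\<close> counts as homogeneous of every degree.
\<close>
definition M_h :: "'a::field_char_0 itself \<Rightarrow> nat \<Rightarrow> nat \<Rightarrow> nat \<Rightarrow> enat" where
  "M_h K p q n = Sup {enat m | m. \<exists>P Q :: 'a poly poly.
     homogeneous2 n P \<and> homogeneous2 n Q \<and>
     no_low_terms (fps2_of_poly2 P) \<and> no_low_terms (fps2_of_poly2 Q) \<and>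
     has_saddle_order p q P Q m}"

end

(*
  The saddle order can be read off from an approximate first integral H = x^q y^p + ...: if the
  derivative of H along the system is c (x^q y^p)^(N+1) + higher terms with c nonzero, then the saddle
  order is N.

  The starting point is the integrable system x' = x (p + f), y' = y (-q + f), f homogeneous of degree
  s = n - 1. It is linearized by X = x (1 - alpha)^(-1/s), Y = y (1 - alpha)^(-1/s), where alpha is
  homogeneous of degree s and determines f; we take alpha = x^(s-r) (x + y)^r. For homogeneity reasons
  only the resonant monomials (x^q y^p)^(J (n-1)/d + 1) can obstruct the existence of a first integral.
  To first order in a perturbation by a monomial of degree n, the obstruction with index J is a
  multiple, nonzero if the monomial is not resonant, of the binomial coefficient
  C(r (m - 1), P J - b), with m = J (p+q)/d, P = p (n-1)/d and b = -1, ..., n. If r is prime to P, the rows J = 1, ..., n+1 of this matrix are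
  linearly independent. So the first n + 1 obstructions can be prescribed to first order, and by a
  contraction argument the first n of them can be made exactly 0 with the next one nonzero.
*)
theory Submission
  imports Defs "HOL-Number_Theory.Cong"
begin

section \<open>Bivariate power series and vector fields\<close>

text \<open>Saddle values depend on the normalizing coordinates and are awkward to perturb. The
  unknowns are therefore the perturbation \<open>\<theta>\<close> together with a correction
  \<open>G\<close> of the truncated first integral \<open>H0\<close>. The linear part,
  \<open>V G\<close> plus the sum of \<open>\<theta> i\<close> times \<open>\<Delta> i H0\<close>,
  is onto up to the relevant degree once the obstructions are; the only other term,
  \<open>\<theta> i\<close> times \<open>\<Delta> i G\<close>, is quadratic. A right inverse leaves
  a finite quadratic system with identity linear part, solvable for small right-hand sides over any
  complete normed field, so the real and complex cases coincide. The obstructions come from an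
  integrating factor: coefficient extraction at a resonant monomial, after multiplication by a
  suitable power of 1 - \<alpha>, annihilates the image of \<open>V\<close>. The rank comes from
  rescaling row J by factorials: the n + 2 columns become polynomials in J of degree n + 1, products
  of linear factors. All vanish at J = 0, and they span every polynomial of degree at most n + 1
  that does; such polynomials take arbitrary values at J = 1, ..., n + 1. Hence n + 1 obstructions,
  and the order (n + 1) (n - 1) / d.\<close>

abbreviation scalar :: "'a \<Rightarrow> 'a::field_char_0 fps fps" where
  "scalar c \<equiv> fps_const (fps_const c)"

definition vector_field ::
  "'a::field_char_0 fps fps \<Rightarrow> 'a fps fps \<Rightarrow> 'a fps fps \<Rightarrow> 'a fps fps" where
  "vector_field A B F = deriv_x F * A + deriv_y F * B"

definition vanishes_below :: "nat \<Rightarrow> 'a::field_char_0 fps fps \<Rightarrow> bool" where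
  "vanishes_below D F \<longleftrightarrow> (\<forall>i j. i + j < D \<longrightarrow> F $ i $ j = 0)"

text \<open>Congruence modulo 0 is equality, so \<open>degree_class 0 a\<close> is homogeneity of
  degree \<open>a\<close>. For positive \<open>N\<close> the class is preserved by homogeneous
  fields of degree \<open>N + 1\<close>.\<close>

definition degree_class :: "nat \<Rightarrow> nat \<Rightarrow> 'a::field_char_0 fps fps \<Rightarrow> bool" where
  "degree_class N a F \<longleftrightarrow> (\<forall>i j. F $ i $ j \<noteq> 0 \<longrightarrow> [i + j = a] (mod N))"

lemma fps2_eqI: "(\<And>i j. F $ i $ j = G $ i $ j) \<Longrightarrow> F = (G :: 'a::field_char_0 fps fps)"
  by (simp add: fps_eq_iff)

lemma fps2_mult_nth:
  "(F * G) $ i $ j = (\<Sum>a=0..i. \<Sum>b=0..j. F $ a $ b * G $ (i - a) $ (j - b))"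
  for F G :: "'a::field_char_0 fps fps"
  by (simp add: fps_mult_nth fps_sum_nth)

lemma scalar_mult_nth [simp]: "(scalar c * F) $ i $ j = c * F $ i $ j"
  by simp

lemma scalar_add: "scalar (a + b) = scalar a + scalar b"
  and scalar_diff: "scalar (a - b) = scalar a - scalar b"
  and scalar_mult: "scalar (a * b) = scalar a * scalar b"
  by (simp_all flip: fps_const_add fps_const_sub fps_const_mult)

lemma scalar_sum: "scalar (\<Sum>i\<in>I. c i) = (\<Sum>i\<in>I. scalar (c i))"
  by (induction I rule: infinite_finite_induct) (simp_all flip: fps_const_add)

lemma scalar_of_nat: "scalar (of_nat k) = of_nat k"
  by (simp add: fps_const_nonzero_eq_nonzero flip: fps_of_nat)

lemma of_nat_mult_nth [simp]: "(of_nat k * F) $ i $ j = of_nat k * F $ i $ j"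
  for F :: "'a::field_char_0 fps fps"
  unfolding scalar_of_nat[symmetric] by simp

lemma deriv_x_nth [simp]: "deriv_x F $ i $ j = of_nat (Suc i) * F $ Suc i $ j"
  unfolding deriv_x_def fps_deriv_nth
  by (metis Suc_eq_plus1 fps_mult_left_const_nth fps_of_nat)

lemma deriv_y_nth [simp]: "deriv_y F $ i $ j = of_nat (Suc j) * F $ i $ Suc j"
  unfolding deriv_y_def by simp

lemma deriv_x_mult: "deriv_x (F * G) = deriv_x F * G + F * deriv_x G"
  unfolding deriv_x_def by (simp add: add.commute)

lemma deriv_y_mult: "deriv_y (F * G) = deriv_y F * G + F * deriv_y G"
proof (rule fps_ext)
  fix i
  have "fps_deriv (\<Sum>a=0..i. F $ a * G $ (i - a)) =
      (\<Sum>a=0..i. fps_deriv (F $ a) * G $ (i - a)) + (\<Sum>a=0..i. F $ a * fps_deriv (G $ (i - a)))"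
    by (simp add: fps_deriv_sum sum.distrib add.commute)
  then show "deriv_y (F * G) $ i = (deriv_y F * G + F * deriv_y G) $ i"
    by (simp add: deriv_y_def fps_mult_nth)
qed

lemma deriv_x_add: "deriv_x (F + G) = deriv_x F + deriv_x G"
  and deriv_y_add: "deriv_y (F + G) = deriv_y F + deriv_y G"
  by (rule fps2_eqI, simp add: algebra_simps)+

lemma vector_field_add: "vector_field A B (F + G) = vector_field A B F + vector_field A B G"
  by (simp add: vector_field_def deriv_x_add deriv_y_add algebra_simps)

lemma vector_field_mult:
  "vector_field A B (F * G) = vector_field A B F * G + F * vector_field A B G"
  unfolding vector_field_def deriv_x_mult deriv_y_mult by (simp add: algebra_simps)

lemma vector_field_scalar [simp]: "vector_field A B (scalar c) = 0"
proof -
  have "deriv_x (scalar c) = 0" "deriv_y (scalar c) = 0"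
    by (rule fps2_eqI, simp)+
  then show ?thesis by (simp add: vector_field_def)
qed

lemma vector_field_0 [simp]: "vector_field A B 0 = 0"
  using vector_field_scalar[of A B 0] by simp

lemma vector_field_1 [simp]: "vector_field A B 1 = 0"
  using vector_field_scalar[of A B 1] by simp

lemma vector_field_scalar_mult: "vector_field A B (scalar c * F) = scalar c * vector_field A B F"
  by (simp add: vector_field_mult del: fps_const_mult)

lemma vector_field_diff: "vector_field A B (F - G) = vector_field A B F - vector_field A B G"
  using vector_field_add[of A B F "scalar (-1) * G"] vector_field_scalar_mult[of A B "-1" G]
  by (simp flip: fps_const_neg)

lemma vector_field_sum: "vector_field A B (\<Sum>i\<in>I. F i) = (\<Sum>i\<in>I. vector_field A B (F i))"
  by (induction I rule: infinite_finite_induct) (simp_all add: vector_field_add)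

lemma vector_field_power:
  "vector_field A B (F ^ k) = of_nat k * F ^ (k - 1) * vector_field A B F"
proof (induction k)
  case (Suc k)
  then show ?case by (cases k) (simp_all add: vector_field_mult algebra_simps)
qed simp

lemma vector_field_add_fields:
  "vector_field (A + A') (B + B') F = vector_field A B F + vector_field A' B' F"
  unfolding vector_field_def by (simp add: algebra_simps)

lemma vector_field_mult_fields: "vector_field (C * A) (C * B) F = C * vector_field A B F"
  unfolding vector_field_def by (simp add: algebra_simps)

lemma vector_field_sum_fields:
  "vector_field (\<Sum>i\<in>I. A i) (\<Sum>i\<in>I. B i) F = (\<Sum>i\<in>I. vector_field (A i) (B i) F)"
  unfolding vector_field_def by (simp add: sum_distrib_left sum.distrib)

lemma var_x_mult_nth: "(var_x * F) $ i $ j = (if i = 0 then 0 else F $ (i - 1) $ j)"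
  by (simp add: var_x_def)

lemma var_y_mult_nth: "(var_y * F) $ i $ j = (if j = 0 then 0 else F $ i $ (j - 1))"
  by (simp add: var_y_def)

lemma monomial_mult_nth:
  "(var_x ^ a * var_y ^ b * F) $ i $ j = (if a \<le> i \<and> b \<le> j then F $ (i - a) $ (j - b) else 0)"
proof (induction a arbitrary: i)
  case 0
  show ?case
  proof (induction b arbitrary: j)
    case (Suc b)
    then show ?case by (cases j) (simp_all add: mult.assoc var_y_mult_nth del: fps_mult_nth_0)
  qed simp
next
  case (Suc a)
  then show ?case by (cases i) (simp_all add: mult.assoc var_x_mult_nth del: fps_mult_nth_0)
qed

lemma monomial_nth:
  "(var_x ^ a * var_y ^ b :: 'a::field_char_0 fps fps) $ i $ j = (if i = a \<and> j = b then 1 else 0)"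
  using monomial_mult_nth[of a b "1 :: 'a fps fps" i j] by auto

lemma vector_field_diagonal_nth:
  "vector_field (scalar s * var_x) (scalar t * var_y) F $ i $ j =
     (s * of_nat i + t * of_nat j) * F $ i $ j"
proof -
  have "vector_field (scalar s * var_x) (scalar t * var_y) F =
      scalar s * (var_x * deriv_x F) + scalar t * (var_y * deriv_y F)"
    by (simp add: vector_field_def algebra_simps)
  then show ?thesis
    by (cases i; cases j) (simp_all add: var_x_mult_nth var_y_mult_nth distrib_left distrib_right mult.assoc
        mult.left_commute del: fps_mult_nth_0)
qed

section \<open>Order of vanishing and degree classes under algebra and vector fields\<close>

lemma vanishes_below_mono: "vanishes_below D F \<Longrightarrow> D' \<le> D \<Longrightarrow> vanishes_below D' F"
  unfolding vanishes_below_def by auto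

lemma vanishes_below_0 [simp]: "vanishes_below D 0" "vanishes_below 0 F"
  unfolding vanishes_below_def by auto

lemma vanishes_below_add: "vanishes_below D F \<Longrightarrow> vanishes_below D G \<Longrightarrow> vanishes_below D (F + G)"
  unfolding vanishes_below_def by auto

lemma vanishes_below_diff: "vanishes_below D F \<Longrightarrow> vanishes_below D G \<Longrightarrow> vanishes_below D (F - G)"
  unfolding vanishes_below_def by auto

lemma vanishes_below_uminus: "vanishes_below D F \<Longrightarrow> vanishes_below D (- F)"
  unfolding vanishes_below_def by auto

lemma vanishes_below_sum:
  "(\<And>i. i \<in> I \<Longrightarrow> vanishes_below D (F i)) \<Longrightarrow> vanishes_below D (\<Sum>i\<in>I. F i)"
  by (induction I rule: infinite_finite_induct) (auto intro: vanishes_below_add)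

lemma vanishes_below_mult:
  assumes "vanishes_below D F" "vanishes_below D' G"
  shows "vanishes_below (D + D') (F * G)"
  unfolding vanishes_below_def
proof (intro allI impI)
  fix i j assume ij: "i + j < D + D'"
  have "F $ a $ b * G $ (i - a) $ (j - b) = 0" if "a \<in> {0..i}" "b \<in> {0..j}" for a b
  proof (cases "a + b < D")
    case False
    then have "i - a + (j - b) < D'" using that ij by auto
    then show ?thesis using assms(2) by (simp add: vanishes_below_def)
  qed (use assms(1) in \<open>simp add: vanishes_below_def\<close>)
  then show "(F * G) $ i $ j = 0"
    unfolding fps2_mult_nth by (intro sum.neutral ballI) blast
qed

lemma vanishes_below_mult_left: "vanishes_below D G \<Longrightarrow> vanishes_below D (F * G)"
  using vanishes_below_mult[of 0 F D G] by simp

lemma vanishes_below_mult_right: "vanishes_below D F \<Longrightarrow> vanishes_below D (F * G)"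
  using vanishes_below_mult[of D F 0 G] by simp

lemma vanishes_below_power: "vanishes_below D F \<Longrightarrow> vanishes_below (k * D) (F ^ k)"
  by (induction k) (auto intro: vanishes_below_mult)

lemma vanishes_below_monomial: "vanishes_below (a + b) (var_x ^ a * var_y ^ b)"
  unfolding vanishes_below_def by (simp add: monomial_nth)

lemma vanishes_below_var_x: "vanishes_below 1 var_x"
  and vanishes_below_var_y: "vanishes_below 1 var_y"
  using vanishes_below_monomial[of 1 0] vanishes_below_monomial[of 0 1] by simp_all

lemma vanishes_below_vector_field:
  assumes "vanishes_below (Suc k) A" "vanishes_below (Suc k) B" "vanishes_below D F"
  shows "vanishes_below (D + k) (vector_field A B F)"
proof (cases D)
  case 0
  have "vanishes_below (Suc k) (vector_field A B F)"
    unfolding vector_field_def using assms by (intro vanishes_below_add vanishes_below_mult_left)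
  then show ?thesis using 0 by (auto intro: vanishes_below_mono)
next
  case (Suc D')
  have "vanishes_below D' (deriv_x F)" "vanishes_below D' (deriv_y F)"
    using assms(3) Suc by (auto simp: vanishes_below_def)
  then have "vanishes_below (D' + Suc k) (vector_field A B F)"
    unfolding vector_field_def using assms by (intro vanishes_below_add vanishes_below_mult)
  then show ?thesis using Suc by simp
qed

lemma degree_class_cong: "degree_class N a F \<Longrightarrow> [a = b] (mod N) \<Longrightarrow> degree_class N b F"
  unfolding degree_class_def cong_def by simp

lemma degree_class_0: "degree_class N a 0"
  by (simp add: degree_class_def)

lemma degree_class_add: "degree_class N a F \<Longrightarrow> degree_class N a G \<Longrightarrow> degree_class N a (F + G)"
  unfolding degree_class_def by (metis add.right_neutral fps_add_nth)

lemma degree_class_scalar_mult: "degree_class N a F \<Longrightarrow> degree_class N a (scalar c * F)"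
  unfolding degree_class_def by auto

lemma degree_class_diff: "degree_class N a F \<Longrightarrow> degree_class N a G \<Longrightarrow> degree_class N a (F - G)"
  unfolding degree_class_def by (metis diff_zero fps_sub_nth diff_self)

lemma degree_class_sum:
  "(\<And>i. i \<in> I \<Longrightarrow> degree_class N a (F i)) \<Longrightarrow> degree_class N a (\<Sum>i\<in>I. F i)"
  by (induction I rule: infinite_finite_induct) (auto intro: degree_class_add degree_class_0)

lemma degree_class_mult:
  assumes "degree_class N a F" "degree_class N b G"
  shows "degree_class N (a + b) (F * G)"
  unfolding degree_class_def
proof (intro allI impI)
  fix i j assume "(F * G) $ i $ j \<noteq> 0"
  then obtain u where u: "u \<in> {0..i}" "(\<Sum>v=0..j. F $ u $ v * G $ (i - u) $ (j - v)) \<noteq> 0"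
    unfolding fps2_mult_nth by (meson sum.not_neutral_contains_not_neutral)
  then obtain v where v: "v \<in> {0..j}" "F $ u $ v * G $ (i - u) $ (j - v) \<noteq> 0"
    by (meson sum.not_neutral_contains_not_neutral)
  then have "F $ u $ v \<noteq> 0" "G $ (i - u) $ (j - v) \<noteq> 0" by auto
  then have "[u + v = a] (mod N)" "[i - u + (j - v) = b] (mod N)"
    using assms unfolding degree_class_def by blast+
  then have "[(u + v) + (i - u + (j - v)) = a + b] (mod N)" by (rule cong_add)
  moreover have "(u + v) + (i - u + (j - v)) = i + j" using u v by auto
  ultimately show "[i + j = a + b] (mod N)" by simp
qed

lemma degree_class_1: "degree_class N 0 1"
  unfolding degree_class_def by (metis fps_one_nth fps_zero_nth add.right_neutral cong_refl)

lemma degree_class_power: "degree_class N a F \<Longrightarrow> degree_class N (k * a) (F ^ k)"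
  by (induction k) (auto intro: degree_class_mult degree_class_1)

lemma degree_class_monomial: "degree_class N (a + b) (var_x ^ a * var_y ^ b)"
  unfolding degree_class_def by (auto simp: monomial_nth split: if_splits)

lemma degree_class_vector_field:
  assumes "degree_class N (Suc k) A" "degree_class N (Suc k) B" "degree_class N a F"
  shows "degree_class N (a + k) (vector_field A B F)"
proof -
  \<comment> \<open>Differentiation lowers the degree by one. Multiplying by \<open>var_x\<close>
    restores it, which avoids \<open>a - 1\<close> on natural numbers; it serves both derivatives,
    as only the total degree counts.\<close>
  have *: "degree_class N (a + k) (G * A)"
    if "degree_class N (Suc k) A" and G: "\<And>i j. G $ i $ j \<noteq> 0 \<Longrightarrow> [Suc (i + j) = a] (mod N)"
    for G A :: "'a fps fps"
    unfolding degree_class_def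
  proof (intro allI impI)
    fix i j assume "(G * A) $ i $ j \<noteq> 0"
    then have "(var_x * G * A) $ Suc i $ j \<noteq> 0"
      by (simp add: mult.assoc var_x_mult_nth)
    moreover have "degree_class N a (var_x * G)"
      unfolding degree_class_def using G
      by (auto simp: var_x_mult_nth split: if_splits) (metis Suc_pred add_Suc)
    ultimately have "[Suc i + j = a + Suc k] (mod N)"
      using degree_class_mult[OF _ that(1)] unfolding degree_class_def by blast
    then have "[(i + j) + 1 = (a + k) + 1] (mod N)" by simp
    then show "[i + j = a + k] (mod N)" by (simp only: cong_add_rcancel_nat)
  qed
  have "degree_class N (a + k) (deriv_x F * A)"
    using assms(3) by (intro * assms) (auto simp: degree_class_def, metis add_Suc)
  moreover have "degree_class N (a + k) (deriv_y F * B)"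
    using assms(3) by (intro * assms) (auto simp: degree_class_def, metis add_Suc_right)
  ultimately show ?thesis unfolding vector_field_def by (rule degree_class_add)
qed

lemma degree_class_mod: "degree_class 0 a F \<Longrightarrow> degree_class N a F"
  unfolding degree_class_def by (auto simp: cong_def)

lemma vanishes_below_homogeneous: "degree_class 0 a F \<Longrightarrow> vanishes_below a F"
  unfolding degree_class_def vanishes_below_def by (fastforce simp: cong_def)

lemma vanishes_below_power_diff:
  assumes "vanishes_below D (F - G)"
  shows "vanishes_below D (F ^ k - G ^ k)"
proof (induction k)
  case (Suc k)
  have "F ^ Suc k - G ^ Suc k = F * (F ^ k - G ^ k) + (F - G) * G ^ k"
    by (simp add: algebra_simps)
  moreover have "vanishes_below D (F * (F ^ k - G ^ k))" "vanishes_below D ((F - G) * G ^ k)"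
    by (rule vanishes_below_mult_left[OF Suc] vanishes_below_mult_right[OF assms])+
  ultimately show ?case by (simp only: vanishes_below_add)
qed simp

text \<open>Here \<open>c\<close> is a relative precision, counted from the leading orders
  \<open>a\<close> and \<open>b\<close>; products preserve it.\<close>

lemma vanishes_below_mult_diff:
  assumes "vanishes_below (a + c) (F - F')" "vanishes_below (b + c) (G - G')"
    and "vanishes_below a F" "vanishes_below b G'"
  shows "vanishes_below (a + b + c) (F * G - F' * G')"
proof -
  have "F * G - F' * G' = F * (G - G') + (F - F') * G'" by (simp add: algebra_simps)
  moreover have "vanishes_below (a + (b + c)) (F * (G - G'))" "vanishes_below (a + c + b) ((F - F') * G')"
    using assms by (auto intro: vanishes_below_mult)
  ultimately show ?thesis by (auto intro!: vanishes_below_add simp: ac_simps)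
qed

lemma vanishes_below_power_diff':
  assumes "vanishes_below (a + c) (F - F')" "vanishes_below a F" "vanishes_below a F'"
  shows "vanishes_below (k * a + c) (F ^ k - F' ^ k)"
proof (induction k)
  case (Suc k)
  have "vanishes_below (a + k * a + c) (F * F ^ k - F' * F' ^ k)"
    by (rule vanishes_below_mult_diff[OF assms(1) Suc assms(2)]) (rule vanishes_below_power[OF assms(3)])
  then show ?case by (simp add: ac_simps)
qed simp

section \<open>Series in powers of a fixed series without low terms\<close>

lemma power_sum_nth: "power_sum c U $ i $ j = (\<Sum>k=1..i + j. c k * (U ^ k) $ i $ j)"
  by (simp add: power_sum_def)

lemma power_sum_diff: "power_sum (\<lambda>k. c k - d k) U = power_sum c U - power_sum d U"
  by (rule fps2_eqI) (simp add: power_sum_nth left_diff_distrib sum_subtractf)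

lemma vanishes_below_power_sum_diff:
  assumes "vanishes_below D (U - U')"
  shows "vanishes_below D (power_sum c U - power_sum c U')"
  unfolding vanishes_below_def
proof (intro allI impI)
  fix i j assume "i + j < D"
  then have "(U ^ k) $ i $ j = (U' ^ k) $ i $ j" for k
    using vanishes_below_power_diff[OF assms, of k] by (simp add: vanishes_below_def)
  then show "(power_sum c U - power_sum c U') $ i $ j = 0" by (simp add: power_sum_nth)
qed

lemma vanishes_below_power_sum:
  assumes "vanishes_below s U" and "\<And>k. k \<ge> 1 \<Longrightarrow> k * s < D \<Longrightarrow> c k = 0"
  shows "vanishes_below D (power_sum c U)"
  unfolding vanishes_below_def
proof (intro allI impI)
  fix i j assume ij: "i + j < D"
  have *: "c k * (U ^ k) $ i $ j = 0" if "k \<ge> 1" for k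
    using vanishes_below_power[OF assms(1), of k] assms(2)[OF that] ij
    by (cases "i + j < k * s") (auto simp: vanishes_below_def)
  show "power_sum c U $ i $ j = 0"
    unfolding power_sum_nth by (intro sum.neutral ballI *) simp
qed

lemma power_sum_leading_term:
  assumes U: "vanishes_below s U" "s \<ge> 1" and "m \<ge> 1" and "\<And>k. 1 \<le> k \<Longrightarrow> k < m \<Longrightarrow> c k = 0"
  shows "vanishes_below (Suc m * s) (power_sum c U - scalar (c m) * U ^ m)"
  unfolding vanishes_below_def
proof (intro allI impI)
  fix i j assume ij: "i + j < Suc m * s"
  have "c k * (U ^ k) $ i $ j = (if k = m then c m * (U ^ m) $ i $ j else 0)" if "k \<ge> 1" for k
  proof (cases "k > m")
    case True
    then have "Suc m * s \<le> k * s" by (intro mult_right_mono) auto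
    then show ?thesis using vanishes_below_power[OF U(1), of k] ij True by (simp add: vanishes_below_def)
  qed (use that assms(4)[of k] in auto)
  then have "power_sum c U $ i $ j = (\<Sum>k=1..i + j. if k = m then c m * (U ^ m) $ i $ j else 0)"
    unfolding power_sum_nth by (intro sum.cong) auto
  also have "\<dots> = (if m \<le> i + j then c m * (U ^ m) $ i $ j else 0)" using \<open>m \<ge> 1\<close> by simp
  \<comment> \<open>The sum in \<open>power_sum\<close> stops at \<open>i + j\<close>; if it misses
    \<open>m\<close>, then \<open>U ^ m\<close> has no coefficient at this place, because
    \<open>s\<close> is at least 1.\<close>
  also have "\<dots> = c m * (U ^ m) $ i $ j"
  proof (cases "m \<le> i + j")
    case False
    moreover have "m \<le> m * s" using U(2) by simp
    ultimately have "i + j < m * s" by linarith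
    then show ?thesis using vanishes_below_power[OF U(1), of m] by (simp add: vanishes_below_def)
  qed simp
  finally show "(power_sum c U - scalar (c m) * U ^ m) $ i $ j = 0" by simp
qed

section \<open>Saddle orders and approximate first integrals\<close>

locale saddle =
  fixes p q :: nat and P Q :: "'a::field_char_0 fps fps"
  assumes p: "1 \<le> p" and q: "1 \<le> q" and coprime: "coprime p q"
    and P: "vanishes_below 2 P" and Q: "vanishes_below 2 Q"
begin

definition D :: "'a fps fps \<Rightarrow> 'a fps fps" where
  "D F = vector_field (of_nat p * var_x + P) (- of_nat q * var_y + Q) F"

definition u :: "'a fps fps" where "u = var_x ^ q * var_y ^ p"

lemma D_eq: "D F = vector_field (scalar (of_nat p) * var_x) (scalar (- of_nat q) * var_y) F + vector_field P Q F"
  unfolding D_def vector_field_add_fields by (simp add: scalar_of_nat flip: fps_const_neg)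

lemma D_nth:
  assumes "vanishes_below e F" "i + j = e"
  shows "D F $ i $ j = (of_nat p * of_nat i - of_nat q * of_nat j) * F $ i $ j"
proof -
  have "vanishes_below (e + 1) (vector_field P Q F)"
    using P Q assms(1) by (intro vanishes_below_vector_field) (simp_all add: numeral_2_eq_2)
  then show ?thesis
    using assms(2) unfolding D_eq by (simp add: vector_field_diagonal_nth vanishes_below_def)
qed

lemma D_add: "D (F + G) = D F + D G" and D_diff: "D (F - G) = D F - D G"
  and D_scalar_mult: "D (scalar c * F) = scalar c * D F"
  and D_mult: "D (F * G) = D F * G + F * D G"
  and D_power: "D (F ^ k) = of_nat k * F ^ (k - 1) * D F"
  unfolding D_def
  by (rule vector_field_add vector_field_diff vector_field_scalar_mult vector_field_mult vector_field_power)+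

lemma vanishes_below_D: "vanishes_below e F \<Longrightarrow> vanishes_below e (D F)"
  unfolding D_def using P Q
  by (intro vanishes_below_vector_field[where k = 0, simplified] vanishes_below_add
      vanishes_below_mult_left)
     (auto intro: vanishes_below_mono[where D = 2] vanishes_below_var_x[unfolded One_nat_def]
      vanishes_below_var_y[unfolded One_nat_def])

lemma u_power: "u ^ k = var_x ^ (q * k) * var_y ^ (p * k)"
  by (simp add: u_def power_mult_distrib power_mult)

lemma vanishes_below_u_power: "vanishes_below ((p + q) * k) (u ^ k)"
  using vanishes_below_monomial[of "q * k" "p * k"] by (simp add: u_power algebra_simps)

lemma vanishes_below_u: "vanishes_below (p + q) u"
  using vanishes_below_u_power[of 1] by simp

lemma resonant_iff:
  "of_nat p * of_nat i - of_nat q * of_nat j = (0 :: 'a) \<longleftrightarrow> (\<exists>k. i = q * k \<and> j = p * k)"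
proof
  assume "of_nat p * of_nat i - of_nat q * of_nat j = (0 :: 'a)"
  then have "of_nat (p * i) = (of_nat (q * j) :: 'a)" by simp
  then have eq: "p * i = q * j" by (simp only: of_nat_eq_iff)
  then have "q dvd i" using coprime by (metis coprime_commute coprime_dvd_mult_right_iff dvd_triv_left)
  then obtain k where k: "i = q * k" by (elim dvdE)
  then have "j = p * k" using eq q by (simp add: mult.left_commute)
  with k show "\<exists>k. i = q * k \<and> j = p * k" by blast
qed (auto simp: mult_ac)

lemma vanishes_below_leading_power:
  assumes "vanishes_below (Suc (p + q)) (h - u)"
  shows "vanishes_below (p + q) h" "vanishes_below (Suc ((p + q) * k)) (h ^ k - u ^ k)"
proof -
  show h: "vanishes_below (p + q) h"
    using vanishes_below_add[OF vanishes_below_mono[OF assms, of "p + q"] vanishes_below_u] by simp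
  show "vanishes_below (Suc ((p + q) * k)) (h ^ k - u ^ k)"
    using vanishes_below_power_diff'[of "p + q" 1 h u k] assms h vanishes_below_u
    by (simp add: mult.commute)
qed

text \<open>
  The coefficient of a resonant monomial in \<open>D F\<close> cannot be the lowest one: the lower resonant terms
  of \<open>F\<close> are removed by powers of an approximate first integral \<open>h\<close>, and then \<open>D\<close> acts on the
  lowest terms by its linear part, which kills resonant monomials.
\<close>
lemma no_resonant_leading_term:
  assumes h: "vanishes_below (Suc (p + q)) (h - u)" "vanishes_below (Suc ((p + q) * M)) (D h)"
    and F: "F $ 0 $ 0 = 0" "vanishes_below (Suc ((p + q) * M)) (D F - scalar c * u ^ M)"
    and M: "M \<ge> 1"
  shows "c = 0"
proof -
  let ?P = "\<lambda>e G. vanishes_below e G \<and> vanishes_below (Suc ((p + q) * M)) (D G - scalar c * u ^ M)"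
  have "e \<le> (p + q) * M \<Longrightarrow> \<exists>G. ?P e G" if "e \<ge> 1" for e
    using that
  proof (induction e rule: dec_induct)
    case base
    have "?P 1 F" using F by (auto simp: vanishes_below_def)
    then show ?case by blast
  next
    case (step e)
    then obtain G where G: "?P e G" by auto
    define k where "k = e div (p + q)"
    define g where "g = (if (p + q) dvd e then G $ (q * k) $ (p * k) else 0)"
    define G' where "G' = G - scalar g * h ^ k"
    have e: "e = (p + q) * k" if "(p + q) dvd e" using that by (simp add: k_def)
    have k1: "k \<ge> 1" if "(p + q) dvd e" using e[OF that] step by (cases k) auto
    have "vanishes_below e (scalar g * h ^ k)"
    proof (cases "(p + q) dvd e")
      case True
      have "vanishes_below e (h ^ k)"
        using vanishes_below_power[OF vanishes_below_leading_power(1)[OF h(1)], of k] e[OF True]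
        by (simp add: mult.commute)
      then show ?thesis by (rule vanishes_below_mult_left)
    qed (simp add: g_def)
    then have vG': "vanishes_below e G'" unfolding G'_def using G by (intro vanishes_below_diff) auto
    have "vanishes_below (Suc ((p + q) * M)) (D (h ^ k))"
      unfolding D_power using h(2) by (intro vanishes_below_mult_left)
    then have DG': "vanishes_below (Suc ((p + q) * M)) (D G' - scalar c * u ^ M)"
      using vanishes_below_diff[of _ "D G - scalar c * u ^ M" "scalar g * D (h ^ k)"] G
      by (simp add: G'_def D_diff D_scalar_mult vanishes_below_mult_left algebra_simps)
    have "G' $ i $ j = 0" if ij: "i + j = e" for i j
    proof (cases "\<exists>l. i = q * l \<and> j = p * l")
      case True
      then obtain l where l: "i = q * l" "j = p * l" by blast
      then have "e = (p + q) * l" using ij by (simp add: algebra_simps)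
      then have lk: "l = k" "(p + q) dvd e" using p by (auto simp: k_def)
      have "(h ^ k - u ^ k) $ i $ j = 0"
        using vanishes_below_leading_power(2)[OF h(1), of k] ij e[OF lk(2)]
        by (simp add: vanishes_below_def)
      then have "h ^ k $ i $ j = 1"
        using l lk by (simp add: u_power monomial_nth)
      then show ?thesis using l lk by (simp add: G'_def g_def)
    next
      case False
      have "i + j < (p + q) * M" using ij step.prems by simp
      then have "(D G' - scalar c * u ^ M) $ i $ j = 0" "u ^ M $ i $ j = 0"
        using DG' vanishes_below_u_power[of M] by (auto simp: vanishes_below_def)
      then have "D G' $ i $ j = 0" by simp
      then show ?thesis using D_nth[OF vG' ij] False resonant_iff by auto
    qed
    then have "vanishes_below (Suc e) G'"
      using vG' by (auto simp: vanishes_below_def less_Suc_eq)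
    with DG' show ?case by blast
  qed
  from this[of "(p + q) * M"] obtain G where G: "?P ((p + q) * M) G"
    using M p by (cases M) auto
  have "(D G - scalar c * u ^ M) $ (q * M) $ (p * M) = 0"
    using G by (auto simp: vanishes_below_def algebra_simps)
  moreover have "D G $ (q * M) $ (p * M) = 0"
    using D_nth[of "(p + q) * M" G "q * M" "p * M"] G by (simp add: algebra_simps)
  ultimately show "c = 0" by (simp add: u_power monomial_nth)
qed

section \<open>Existence of the normal form\<close>

text \<open>The argument \<open>h\<close> is kept independent of \<open>Z\<close>: both coordinates
  are corrected in the same step, and each correction changes \<open>X ^ q * Y ^ p\<close>.\<close>

definition defect :: "'a \<Rightarrow> 'a fps fps \<Rightarrow> (nat \<Rightarrow> 'a) \<Rightarrow> 'a fps fps \<Rightarrow> 'a fps fps" where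
  "defect \<mu> Z \<pi> h = D Z - scalar \<mu> * Z * (1 + power_sum \<pi> h)"

text \<open>Homological equation in degree \<open>e\<close>: off resonance the error is divided by
  the eigenvalue minus \<open>\<mu>\<close>, while the only monomial with eigenvalue
  \<open>\<mu>\<close>, the leading monomial of \<open>Z\<close> times \<open>u ^ k\<close>, is
  absorbed into \<open>\<pi> k\<close>. The pairs (1, 0) and (0, 1) for \<open>(a, b)\<close> treat
  \<open>X\<close> and \<open>Y\<close> by one argument, and the quantifier over \<open>h'\<close>
  leaves room for the simultaneous correction of the other coordinate.\<close>

lemma normal_form_step:
  fixes Z h :: "'a fps fps" and a b e :: nat
  defines "\<mu> \<equiv> of_nat p * of_nat a - of_nat q * of_nat b :: 'a"
  assumes ab: "a + b = 1" and e: "e \<ge> 2"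
    and Z: "vanishes_below 2 (Z - var_x ^ a * var_y ^ b)"
    and h: "vanishes_below (Suc (p + q)) (h - u)"
    and defect: "vanishes_below e (defect \<mu> Z \<pi> h)"
  shows "\<exists>\<zeta> \<pi>'. vanishes_below e \<zeta> \<and> (\<forall>k. Suc (k * (p + q)) \<noteq> e \<longrightarrow> \<pi>' k = \<pi> k) \<and>
    (\<forall>h'. vanishes_below e (h' - h) \<longrightarrow> vanishes_below (p + q) h' \<longrightarrow>
      vanishes_below (Suc e) (defect \<mu> (Z + \<zeta>) \<pi>' h'))"
proof -
  let ?z = "var_x ^ a * var_y ^ b :: 'a fps fps"
  have \<mu>: "\<mu> \<noteq> 0" using ab p q by (cases a) (auto simp: \<mu>_def)
  define E where "E = defect \<mu> Z \<pi> h"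
  \<comment> \<open>At the resonant exponents the denominator is 0 and the quotient is 0 by
    convention; \<open>\<rho>\<close> takes care of that coefficient.\<close>
  define \<zeta> where "\<zeta> = Abs_fps (\<lambda>i. Abs_fps (\<lambda>j. if i + j = e then
    - E $ i $ j / (of_nat p * of_nat i - of_nat q * of_nat j - \<mu>) else 0))"
  \<comment> \<open>A resonant monomial of degree \<open>e\<close> has degree
    \<open>1 + k * (p + q)\<close>, so there is none unless \<open>p + q\<close> divides
    \<open>e - 1\<close>.\<close>
  define k where "k = (e - 1) div (p + q)"
  define \<rho> where "\<rho> = (if (p + q) dvd (e - 1) then E $ (a + q * k) $ (b + p * k) / \<mu> else 0)"
  define \<pi>' where "\<pi>' = \<pi>(k := \<pi> k + \<rho>)"
  have e_k: "e = Suc (k * (p + q))" "k \<ge> 1" if "(p + q) dvd (e - 1)"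
  proof -
    have "(e - 1) = k * (p + q)" using that by (simp add: k_def)
    then show "e = Suc (k * (p + q))" "k \<ge> 1" using e by (cases k, auto)+
  qed
  have hv: "vanishes_below (p + q) h" by (rule vanishes_below_leading_power(1)[OF h])
  have zv: "vanishes_below 1 ?z" using vanishes_below_monomial[of a b] ab by simp
  have Zv: "vanishes_below 1 Z"
    using vanishes_below_add[OF vanishes_below_mono[OF Z, of 1] zv] by simp
  have \<zeta>v: "vanishes_below e \<zeta>" by (auto simp: \<zeta>_def vanishes_below_def)
  have \<pi>'_eq: "\<pi>' l = \<pi> l" if "Suc (l * (p + q)) \<noteq> e" for l
    using that e_k(1) by (auto simp: \<pi>'_def \<rho>_def)
  have \<rho>_term: "vanishes_below (Suc e) (scalar \<mu> * Z * (power_sum \<pi>' h - power_sum \<pi> h) -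
      scalar (\<mu> * \<rho>) * (?z * u ^ k))"
  proof (cases "(p + q) dvd (e - 1)")
    case True
    note e_k = e_k[OF True]
    have "vanishes_below (Suc k * (p + q))
        (power_sum (\<lambda>l. \<pi>' l - \<pi> l) h - scalar (\<pi>' k - \<pi> k) * h ^ k)"
      using hv e_k(2) p by (intro power_sum_leading_term) (auto simp: \<pi>'_def)
    moreover have "\<pi>' k - \<pi> k = \<rho>" by (simp add: \<pi>'_def)
    ultimately have 1: "vanishes_below (Suc (k * (p + q))) (power_sum \<pi>' h - power_sum \<pi> h - scalar \<rho> * h ^ k)"
      unfolding power_sum_diff using p by (auto elim: vanishes_below_mono)
    have "vanishes_below (1 + k * (p + q) + 1) (Z * h ^ k - ?z * u ^ k)"
      using Z Zv vanishes_below_leading_power(2)[OF h, of k] vanishes_below_u_power[of k]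
      by (intro vanishes_below_mult_diff) (auto simp: mult.commute numeral_2_eq_2)
    then have 2: "vanishes_below (Suc e) (Z * h ^ k - ?z * u ^ k)" using e_k by simp
    have "vanishes_below (1 + Suc (k * (p + q))) (Z * (power_sum \<pi>' h - power_sum \<pi> h - scalar \<rho> * h ^ k))"
      using Zv 1 by (rule vanishes_below_mult)
    then have 3: "vanishes_below (Suc e) (Z * (power_sum \<pi>' h - power_sum \<pi> h - scalar \<rho> * h ^ k))"
      using e_k by simp
    have "scalar \<mu> * Z * (power_sum \<pi>' h - power_sum \<pi> h) - scalar (\<mu> * \<rho>) * (?z * u ^ k) =
      scalar \<mu> * (Z * (power_sum \<pi>' h - power_sum \<pi> h - scalar \<rho> * h ^ k)) +
      scalar (\<mu> * \<rho>) * (Z * h ^ k - ?z * u ^ k)"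
      unfolding scalar_mult by (simp add: algebra_simps del: fps_const_mult)
    then show ?thesis using 2 3
      by (metis vanishes_below_add vanishes_below_mult_left)
  next
    case False
    then have "\<pi>' = \<pi>" by (auto simp: \<pi>'_def \<rho>_def)
    then show ?thesis using False by (simp add: \<rho>_def)
  qed
  have "vanishes_below (Suc e) (defect \<mu> (Z + \<zeta>) \<pi>' h')"
    if h': "vanishes_below e (h' - h)" "vanishes_below (p + q) h'" for h'
  proof -
    define R where "R = D \<zeta> - scalar \<mu> * \<zeta> - scalar (\<mu> * \<rho>) * (?z * u ^ k)"
    have eq: "defect \<mu> (Z + \<zeta>) \<pi>' h' = E + R - scalar \<mu> * (\<zeta> * power_sum \<pi>' h')
      - scalar \<mu> * (Z * (power_sum \<pi>' h' - power_sum \<pi>' h))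
      - (scalar \<mu> * Z * (power_sum \<pi>' h - power_sum \<pi> h) - scalar (\<mu> * \<rho>) * (?z * u ^ k))"
      by (simp add: E_def R_def defect_def D_add algebra_simps del: fps_const_mult)
    have "vanishes_below 1 (power_sum \<pi>' h')"
      using h'(2) p by (intro vanishes_below_power_sum[where s = "p + q"]) auto
    then have 1: "vanishes_below (Suc e) (\<zeta> * power_sum \<pi>' h')"
      using vanishes_below_mult[OF \<zeta>v] by fastforce
    have 2: "vanishes_below (Suc e) (Z * (power_sum \<pi>' h' - power_sum \<pi>' h))"
      using vanishes_below_mult[OF Zv vanishes_below_power_sum_diff[OF h'(1)]] by simp
    have "vanishes_below (Suc e) (E + R)"
      unfolding vanishes_below_def
    proof (intro allI impI)
      fix i j assume ij: "i + j < Suc e"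
      have zu: "(?z * u ^ k) $ i $ j = (if i = a + q * k \<and> j = b + p * k then 1 else 0)"
      proof -
        have "?z * u ^ k = var_x ^ (a + q * k) * var_y ^ (b + p * k)"
          unfolding u_power by (simp add: power_add mult_ac)
        then show ?thesis by (simp only: monomial_nth)
      qed
      show "(E + R) $ i $ j = 0"
      proof (cases "i + j = e")
        case True
        have R: "R $ i $ j = (of_nat p * of_nat i - of_nat q * of_nat j - \<mu>) * \<zeta> $ i $ j -
            \<mu> * \<rho> * (if i = a + q * k \<and> j = b + p * k then 1 else 0)"
          unfolding R_def fps_sub_nth scalar_mult_nth zu D_nth[OF \<zeta>v True]
          by (simp add: left_diff_distrib)
        show ?thesis
        proof (cases "i = a + q * k \<and> j = b + p * k")
          case ij': True
          then have "e = 1 + k * (p + q)" using True ab by (simp add: algebra_simps)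
          then have "(p + q) dvd (e - 1)" by simp
          then have "\<mu> * \<rho> = E $ i $ j" using ij' \<mu> by (simp add: \<rho>_def)
          moreover have "of_nat p * of_nat i - of_nat q * of_nat j = \<mu>"
            using ij' by (simp add: \<mu>_def algebra_simps)
          ultimately show ?thesis using R ij' by simp
        next
          case ij': False
          have "of_nat p * of_nat i - of_nat q * of_nat j \<noteq> \<mu>"
          proof
            assume eq: "of_nat p * of_nat i - of_nat q * of_nat j = \<mu>"
            consider "a = 1" "b = 0" | "a = 0" "b = 1" using ab by (cases a) auto
            \<comment> \<open>Removing one factor \<open>x\<close> or \<open>y\<close> reduces this
              to \<open>resonant_iff\<close>; that factor is present because of the signs of the
              eigenvalues.\<close>
            then have "\<exists>l. i = a + q * l \<and> j = b + p * l"
            proof cases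
              case 1
              have "i > 0"
              proof (rule Nat.gr0I)
                assume "i = 0"
                have "of_nat (p + q * j) = \<mu> + of_nat q * of_nat j" using 1 by (simp add: \<mu>_def)
                also have "\<dots> = 0" using \<open>i = 0\<close> by (simp flip: eq)
                finally have "of_nat (p + q * j) = (0 :: 'a)" .
                with p show False by (simp only: of_nat_eq_0_iff)
              qed
              then have "of_nat p * of_nat (i - 1) - of_nat q * of_nat j = (0 :: 'a)"
                using eq 1 by (simp add: \<mu>_def of_nat_diff algebra_simps)
              with 1 \<open>i > 0\<close> show ?thesis unfolding resonant_iff by force
            next
              case 2
              have "j > 0"
              proof (rule Nat.gr0I)
                assume "j = 0"
                then have "of_nat (p * i + q) = \<mu> + of_nat q" by (simp flip: eq)
                also have "\<dots> = 0" using 2 by (simp add: \<mu>_def)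
                finally have "of_nat (p * i + q) = (0 :: 'a)" .
                with q show False by (simp only: of_nat_eq_0_iff)
              qed
              then have "of_nat p * of_nat i - of_nat q * of_nat (j - 1) = (0 :: 'a)"
                using eq 2 by (simp add: \<mu>_def of_nat_diff algebra_simps)
              with 2 \<open>j > 0\<close> show ?thesis unfolding resonant_iff by force
            qed
            then obtain l where l: "i = a + q * l" "j = b + p * l" by blast
            then have "e - 1 = (p + q) * l" using True ab by (simp add: algebra_simps)
            then have "l = k" using p by (simp add: k_def)
            with l ij' show False by simp
          qed
          then show ?thesis using R ij' True by (auto simp: \<zeta>_def)
        qed
      next
        case False
        then have less: "i + j < e" using ij by simp
        have "E $ i $ j = 0" "\<zeta> $ i $ j = 0" "D \<zeta> $ i $ j = 0"
          using less defect \<zeta>v vanishes_below_D[OF \<zeta>v] by (auto simp: E_def vanishes_below_def)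
        moreover have "\<rho> * (?z * u ^ k) $ i $ j = 0"
          using less e_k(1) ab unfolding zu by (auto simp: \<rho>_def algebra_simps)
        ultimately show ?thesis
          by (simp add: R_def mult.assoc del: fps_const_mult)
      qed
    qed
    then show ?thesis unfolding eq
      by (rule vanishes_below_diff[OF vanishes_below_diff[OF vanishes_below_diff[OF _
          vanishes_below_mult_left[OF 1]] vanishes_below_mult_left[OF 2]] \<rho>_term])
  qed
  with \<zeta>v \<pi>'_eq show ?thesis by blast
qed

lemma leading_term_product:
  assumes "vanishes_below 2 (X - var_x)" "vanishes_below 2 (Y - var_y)"
  shows "vanishes_below (Suc (p + q)) (X ^ q * Y ^ p - u)"
proof -
  have v: "vanishes_below 1 X" "vanishes_below 1 Y"
    using vanishes_below_add[OF vanishes_below_mono[OF assms(1), of 1] vanishes_below_var_x]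
      vanishes_below_add[OF vanishes_below_mono[OF assms(2), of 1] vanishes_below_var_y] by simp_all
  have "vanishes_below (q + 1) (X ^ q - var_x ^ q)" "vanishes_below (p + 1) (Y ^ p - var_y ^ p)"
    using vanishes_below_power_diff'[of 1 1 X var_x q] vanishes_below_power_diff'[of 1 1 Y var_y p]
      assms v vanishes_below_var_x vanishes_below_var_y by (simp_all add: numeral_2_eq_2)
  moreover have "vanishes_below q (X ^ q)" "vanishes_below p (var_y ^ p)"
    using vanishes_below_power[OF v(1), of q] vanishes_below_power[OF vanishes_below_var_y, of p] by simp_all
  ultimately have "vanishes_below (q + p + 1) (X ^ q * Y ^ p - var_x ^ q * var_y ^ p)"
    by (rule vanishes_below_mult_diff)
  then show ?thesis by (simp add: u_def add.commute)
qed

text \<open>Limit of \<open>normal_form_step\<close>: stage \<open>n\<close> alters the coordinates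
  only from degree \<open>n + 2\<close> on, and each \<open>\<pi> k\<close> at no more than one
  stage, so every coefficient is eventually constant.\<close>

lemma normal_form_exists:
  "\<exists>X Y \<pi>1 \<pi>2. vanishes_below 2 (X - var_x) \<and> vanishes_below 2 (Y - var_y) \<and>
     D X = of_nat p * X * (1 + power_sum \<pi>1 (X ^ q * Y ^ p)) \<and>
     D Y = - of_nat q * Y * (1 + power_sum \<pi>2 (X ^ q * Y ^ p))"
proof -
  let ?h = "\<lambda>X Y. X ^ q * Y ^ p"
  define ok where "ok n = (\<lambda>(X, Y, \<pi>1, \<pi>2). vanishes_below 2 (X - var_x) \<and> vanishes_below 2 (Y - var_y) \<and>
     vanishes_below (n + 2) (defect (of_nat p) X \<pi>1 (?h X Y)) \<and>
     vanishes_below (n + 2) (defect (- of_nat q) Y \<pi>2 (?h X Y)))" for n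
  define next_to :: "nat \<Rightarrow> 'a fps fps \<times> 'a fps fps \<times> (nat \<Rightarrow> 'a) \<times> (nat \<Rightarrow> 'a) \<Rightarrow>
      'a fps fps \<times> 'a fps fps \<times> (nat \<Rightarrow> 'a) \<times> (nat \<Rightarrow> 'a) \<Rightarrow> bool" where "next_to n = (\<lambda>(X, Y, \<pi>1, \<pi>2) (X', Y', \<pi>1', \<pi>2').
     vanishes_below (n + 2) (X' - X) \<and> vanishes_below (n + 2) (Y' - Y) \<and>
     (\<forall>k. Suc (k * (p + q)) \<noteq> n + 2 \<longrightarrow> \<pi>1' k = \<pi>1 k \<and> \<pi>2' k = \<pi>2 k))"
    for n
  have "\<exists>s. \<forall>n. ok n (s n) \<and> next_to n (s n) (s (Suc n))"
  proof (rule dependent_nat_choice)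
    have zero: "power_sum (\<lambda>_. 0) U = 0" for U :: "'a fps fps"
      by (rule fps2_eqI) (simp add: power_sum_nth)
    have "deriv_x (var_x :: 'a fps fps) = 1" "deriv_y (var_y :: 'a fps fps) = 1"
      "deriv_x (var_y :: 'a fps fps) = 0" "deriv_y (var_x :: 'a fps fps) = 0"
      by (auto simp: deriv_x_def deriv_y_def var_x_def var_y_def fps_eq_iff fps_X_def)
    then have "D var_x = of_nat p * var_x + P" "D var_y = - of_nat q * var_y + Q"
      by (simp_all add: D_def vector_field_def)
    then have "ok 0 (var_x, var_y, \<lambda>_. 0, \<lambda>_. 0)"
      using P Q by (simp add: ok_def defect_def zero scalar_of_nat numeral_2_eq_2 flip: fps_const_neg)
    then show "\<exists>s. ok 0 s" by blast
  next
    fix s :: "'a fps fps \<times> 'a fps fps \<times> (nat \<Rightarrow> 'a) \<times> (nat \<Rightarrow> 'a)" and n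
    assume "ok n s"
    obtain X Y \<pi>1 \<pi>2 where s: "s = (X, Y, \<pi>1, \<pi>2)" by (cases s)
    have XY: "vanishes_below 2 (X - var_x)" "vanishes_below 2 (Y - var_y)"
      "vanishes_below (n + 2) (defect (of_nat p) X \<pi>1 (?h X Y))"
      "vanishes_below (n + 2) (defect (- of_nat q) Y \<pi>2 (?h X Y))"
      using \<open>ok n s\<close> by (auto simp: ok_def s)
    note h = leading_term_product[OF XY(1,2)]
    obtain \<zeta>1 \<pi>1' where 1: "vanishes_below (n + 2) \<zeta>1" "\<And>k. Suc (k * (p + q)) \<noteq> n + 2 \<Longrightarrow> \<pi>1' k = \<pi>1 k"
      "\<And>h'. vanishes_below (n + 2) (h' - ?h X Y) \<Longrightarrow> vanishes_below (p + q) h' \<Longrightarrow>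
        vanishes_below (Suc (n + 2)) (defect (of_nat p) (X + \<zeta>1) \<pi>1' h')"
      using normal_form_step[of 1 0 "n + 2" X "?h X Y" \<pi>1] XY h by auto
    obtain \<zeta>2 \<pi>2' where 2: "vanishes_below (n + 2) \<zeta>2" "\<And>k. Suc (k * (p + q)) \<noteq> n + 2 \<Longrightarrow> \<pi>2' k = \<pi>2 k"
      "\<And>h'. vanishes_below (n + 2) (h' - ?h X Y) \<Longrightarrow> vanishes_below (p + q) h' \<Longrightarrow>
        vanishes_below (Suc (n + 2)) (defect (- of_nat q) (Y + \<zeta>2) \<pi>2' h')"
      using normal_form_step[of 0 1 "n + 2" Y "?h X Y" \<pi>2] XY h by auto
    have X': "vanishes_below 2 (X + \<zeta>1 - var_x)" and Y': "vanishes_below 2 (Y + \<zeta>2 - var_y)"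
      using vanishes_below_add[OF XY(1) vanishes_below_mono[OF 1(1), of 2]]
        vanishes_below_add[OF XY(2) vanishes_below_mono[OF 2(1), of 2]] by (simp_all add: algebra_simps)
    have h'v: "vanishes_below (p + q) (?h (X + \<zeta>1) (Y + \<zeta>2))"
      by (rule vanishes_below_leading_power(1)[OF leading_term_product[OF X' Y']])
    have "vanishes_below (0 + 0 + (n + 2)) (?h (X + \<zeta>1) (Y + \<zeta>2) - ?h X Y)"
      using 1(1) 2(1) by (intro vanishes_below_mult_diff) (auto intro!: vanishes_below_power_diff)
    then have h'd: "vanishes_below (n + 2) (?h (X + \<zeta>1) (Y + \<zeta>2) - ?h X Y)" by simp
    have "ok (Suc n) (X + \<zeta>1, Y + \<zeta>2, \<pi>1', \<pi>2')"
      using X' Y' 1(3)[OF h'd h'v] 2(3)[OF h'd h'v] by (simp add: ok_def)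
    moreover have "next_to n s (X + \<zeta>1, Y + \<zeta>2, \<pi>1', \<pi>2')"
      using 1(1,2) 2(1,2) by (simp add: next_to_def s)
    ultimately show "\<exists>s'. ok (Suc n) s' \<and> next_to n s s'" by blast
  qed
  then obtain s where s: "\<And>n. ok n (s n)" "\<And>n. next_to n (s n) (s (Suc n))" by blast
  define x where "x n = fst (s n)" for n
  define y where "y n = fst (snd (s n))" for n
  define c1 where "c1 n = fst (snd (snd (s n)))" for n
  define c2 where "c2 n = snd (snd (snd (s n)))" for n
  have ok: "vanishes_below 2 (x n - var_x)" "vanishes_below 2 (y n - var_y)"
     "vanishes_below (n + 2) (defect (of_nat p) (x n) (c1 n) (?h (x n) (y n)))"
     "vanishes_below (n + 2) (defect (- of_nat q) (y n) (c2 n) (?h (x n) (y n)))" for n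
    using s(1)[of n] by (auto simp: ok_def x_def y_def c1_def c2_def split: prod.splits)
  have nxt: "vanishes_below (n + 2) (x (Suc n) - x n)" "vanishes_below (n + 2) (y (Suc n) - y n)"
     "Suc (k * (p + q)) \<noteq> n + 2 \<Longrightarrow> c1 (Suc n) k = c1 n k \<and> c2 (Suc n) k = c2 n k" for n k
    using s(2)[of n] by (auto simp: next_to_def x_def y_def c1_def c2_def split: prod.splits)
  have stable: "vanishes_below (n + 2) (x m - x n) \<and> vanishes_below (n + 2) (y m - y n)" if "n \<le> m" for n m
    using that
  proof (induction m rule: dec_induct)
    case (step m)
    have "vanishes_below (n + 2) (x (Suc m) - x m)" "vanishes_below (n + 2) (y (Suc m) - y m)"
      using nxt(1,2)[of m] step(1) by (auto elim: vanishes_below_mono)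
    then show ?case using step.IH
      vanishes_below_add[of "n + 2" "x (Suc m) - x m" "x m - x n"]
      vanishes_below_add[of "n + 2" "y (Suc m) - y m" "y m - y n"] by simp
  qed simp
  have stable_c: "c1 m k = c1 n k \<and> c2 m k = c2 n k" if "n \<le> m" "Suc (k * (p + q)) < n + 2" for n m k
    using that(1)
  proof (induction m rule: dec_induct)
    case (step m)
    then show ?case using nxt(3)[of k m] that(2) by auto
  qed simp
  define X where "X = Abs_fps (\<lambda>i. Abs_fps (\<lambda>j. x (i + j) $ i $ j))"
  define Y where "Y = Abs_fps (\<lambda>i. Abs_fps (\<lambda>j. y (i + j) $ i $ j))"
  \<comment> \<open>Entry \<open>k\<close> can change only in the step from stage
    \<open>k * (p + q) - 1\<close> to the next one; the index chosen here lies beyond it.\<close>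
  define \<pi>1 where "\<pi>1 k = c1 (Suc (k * (p + q))) k" for k
  define \<pi>2 where "\<pi>2 k = c2 (Suc (k * (p + q))) k" for k
  have XY: "vanishes_below (n + 2) (X - x n)" "vanishes_below (n + 2) (Y - y n)" for n
  proof -
    have "X $ i $ j = x n $ i $ j \<and> Y $ i $ j = y n $ i $ j" if "i + j < n + 2" for i j
    proof (cases "i + j \<le> n")
      case True
      then show ?thesis using stable[OF True] by (simp add: X_def Y_def vanishes_below_def)
    next
      case False
      then show ?thesis using stable[of n "i + j"] that by (simp add: X_def Y_def vanishes_below_def)
    qed
    then show "vanishes_below (n + 2) (X - x n)" "vanishes_below (n + 2) (Y - y n)"
      by (auto simp: vanishes_below_def)
  qed
  have \<pi>: "\<pi>1 k = c1 n k \<and> \<pi>2 k = c2 n k" if "Suc (k * (p + q)) < n + 2" for n k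
    using stable_c[of n "Suc (k * (p + q))" k] stable_c[of "Suc (k * (p + q))" n k] that
    unfolding \<pi>1_def \<pi>2_def by (cases "n \<le> Suc (k * (p + q))") auto
  have X: "vanishes_below 2 (X - var_x)" and Y: "vanishes_below 2 (Y - var_y)"
    using vanishes_below_add[of 2 "X - x 0" "x 0 - var_x"] vanishes_below_add[of 2 "Y - y 0" "y 0 - var_y"]
      XY[of 0] ok(1,2)[of 0] by (simp_all add: numeral_2_eq_2)
  have h: "vanishes_below (p + q) (?h (x n) (y n))" for n
    by (rule vanishes_below_leading_power(1)[OF leading_term_product[OF ok(1,2)]])
  have hd: "vanishes_below (n + 2) (?h X Y - ?h (x n) (y n))" for n
  proof -
    have "vanishes_below (0 + 0 + (n + 2)) (?h X Y - ?h (x n) (y n))"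
      using XY[of n] by (intro vanishes_below_mult_diff) (auto intro!: vanishes_below_power_diff)
    then show ?thesis by simp
  qed
  have limit: "vanishes_below n (defect \<mu> Z c (?h X Y))"
    if "vanishes_below (n + 2) (defect \<mu> z d (?h (x n) (y n)))" "vanishes_below (n + 2) (Z - z)"
      "\<And>k. Suc (k * (p + q)) < n + 2 \<Longrightarrow> c k = d k" for \<mu> Z z c d n
  proof -
    have "vanishes_below n (power_sum (\<lambda>k. c k - d k) (?h (x n) (y n)))"
      using h that(3) by (intro vanishes_below_power_sum) auto
    then have 1: "vanishes_below n (power_sum c (?h (x n) (y n)) - power_sum d (?h (x n) (y n)))"
      by (simp only: power_sum_diff)
    have 2: "vanishes_below n (power_sum c (?h X Y) - power_sum c (?h (x n) (y n)))"
      by (rule vanishes_below_mono[OF vanishes_below_power_sum_diff[OF hd]]) simp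
    have 3: "vanishes_below n (Z - z)" "vanishes_below n (defect \<mu> z d (?h (x n) (y n)))"
      using that(1,2) by (auto elim: vanishes_below_mono)
    have "defect \<mu> Z c (?h X Y) = defect \<mu> z d (?h (x n) (y n)) + D (Z - z)
       - (scalar \<mu> * (1 + power_sum c (?h X Y))) * (Z - z)
       - (scalar \<mu> * z) * (power_sum c (?h X Y) - power_sum c (?h (x n) (y n)))
       - (scalar \<mu> * z) * (power_sum c (?h (x n) (y n)) - power_sum d (?h (x n) (y n)))"
      by (simp add: defect_def D_diff algebra_simps)
    moreover have "vanishes_below n \<dots>"
      by (rule vanishes_below_diff[OF vanishes_below_diff[OF vanishes_below_diff[OF
          vanishes_below_add[OF 3(2) vanishes_below_D[OF 3(1)]] vanishes_below_mult_left[OF 3(1)]]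
          vanishes_below_mult_left[OF 2]] vanishes_below_mult_left[OF 1]])
    ultimately show ?thesis by simp
  qed
  have zero: "F = 0" if "\<And>n. vanishes_below n F" for F :: "'a fps fps"
    using that by (intro fps2_eqI) (auto simp: vanishes_below_def)
  have "defect (of_nat p) X \<pi>1 (?h X Y) = 0"
    using limit[OF ok(3) XY(1)] \<pi> by (intro zero) blast
  moreover have "defect (- of_nat q) Y \<pi>2 (?h X Y) = 0"
    using limit[OF ok(4) XY(2)] \<pi> by (intro zero) blast
  ultimately have "D X = scalar (of_nat p) * X * (1 + power_sum \<pi>1 (?h X Y))"
    "D Y = scalar (- of_nat q) * Y * (1 + power_sum \<pi>2 (?h X Y))"
    by (simp_all only: defect_def right_minus_eq)
  moreover have "scalar (- of_nat q) = (- of_nat q :: 'a fps fps)"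
    by (simp add: scalar_of_nat flip: fps_const_neg)
  ultimately show ?thesis using X Y unfolding scalar_of_nat by auto
qed

end

text \<open>Both \<open>h = X ^ q * Y ^ p\<close> and \<open>H\<close> are approximate first
  integrals, and \<open>no_resonant_leading_term\<close> is used in both directions: with
  \<open>h\<close> in the role of the integral it excludes that \<open>L 1\<close>, ...,
  \<open>L N\<close> all vanish; with \<open>H\<close> in that role it excludes a first nonzero
  \<open>L m\<close> with \<open>m < N\<close>.\<close>

lemma has_saddle_orderI:
  fixes P Q :: "'a::field_char_0 poly poly" and H :: "'a fps fps"
  assumes pq: "1 \<le> p" "1 \<le> q" "coprime p q"
    and P: "no_low_terms (fps2_of_poly2 P)" and Q: "no_low_terms (fps2_of_poly2 Q)"
    and H: "vanishes_below (Suc (p + q)) (H - var_x ^ q * var_y ^ p)"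
    and DH: "vanishes_below (Suc ((p + q) * Suc N))
      (time_deriv p q P Q H - scalar c * (var_x ^ q * var_y ^ p) ^ Suc N)"
    and c: "c \<noteq> 0" and N: "N \<ge> 1"
  shows "has_saddle_order p q P Q N"
proof -
  interpret saddle p q "fps2_of_poly2 P" "fps2_of_poly2 Q"
    using assms by unfold_locales (auto simp: no_low_terms_def vanishes_below_def)
  have D: "time_deriv p q P Q F = D F" for F by (simp add: time_deriv_def D_def vector_field_def)
  obtain X Y \<pi>1 \<pi>2 where X: "vanishes_below 2 (X - var_x)" and Y: "vanishes_below 2 (Y - var_y)"
    and nf: "D X = of_nat p * X * (1 + power_sum \<pi>1 (X ^ q * Y ^ p))"
      "D Y = - of_nat q * Y * (1 + power_sum \<pi>2 (X ^ q * Y ^ p))"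
    using normal_form_exists by blast
  define h where "h = X ^ q * Y ^ p"
  define L where "L k = \<pi>1 k - \<pi>2 k" for k
  have h: "vanishes_below (Suc (p + q)) (h - u)" unfolding h_def using X Y by (rule leading_term_product)
  note hv = vanishes_below_leading_power(1)[OF h]
  have H': "vanishes_below (Suc (p + q)) (H - u)" using H by (simp add: u_def)
  have H0: "H $ 0 $ 0 = 0" "h $ 0 $ 0 = 0"
    using vanishes_below_leading_power(1)[OF H'] hv pq by (auto simp: vanishes_below_def)
  have Dh: "D h = scalar (of_nat (p * q)) * h * power_sum L h"
  proof -
    have pow: "of_nat k * Z ^ (k - 1) * (C * Z * G) = of_nat k * C * Z ^ k * G" if "k \<ge> 1"
      for k and Z C G :: "'a fps fps"
      using that by (cases k) (simp_all add: mult_ac)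
    have "D h = of_nat q * of_nat p * X ^ q * (1 + power_sum \<pi>1 h) * Y ^ p +
       X ^ q * (of_nat p * (- of_nat q) * Y ^ p * (1 + power_sum \<pi>2 h))"
      unfolding h_def D_mult D_power nf pow[OF pq(1)] pow[OF pq(2)] ..
    also have "\<dots> = of_nat (p * q) * h * (power_sum \<pi>1 h - power_sum \<pi>2 h)"
      by (simp add: h_def algebra_simps)
    also have "power_sum \<pi>1 h - power_sum \<pi>2 h = power_sum L h"
      using power_sum_diff[of \<pi>1 \<pi>2 h] by (simp add: L_def[abs_def])
    finally show ?thesis by (simp only: scalar_of_nat)
  qed
  have uv: "vanishes_below ((p + q) * Suc N) (u ^ Suc N)" by (rule vanishes_below_u_power)
  have DH': "vanishes_below (Suc ((p + q) * Suc N)) (D H - scalar c * u ^ Suc N)"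
    using DH by (simp only: D u_def)
  have "\<exists>k. 1 \<le> k \<and> k \<le> N \<and> L k \<noteq> 0"
  proof (rule ccontr)
    assume "\<not> ?thesis"
    then have "L k = 0" if "1 \<le> k" "k \<le> N" for k using that by blast
    moreover have "k \<le> N" if "k * (p + q) < Suc N * (p + q)" for k
      using that by (simp only: mult_less_cancel2 less_Suc_eq_le)
    ultimately have "vanishes_below (Suc N * (p + q)) (power_sum L h)"
      using hv by (intro vanishes_below_power_sum) auto
    then have "vanishes_below ((p + q) + Suc N * (p + q)) (h * power_sum L h)"
      by (rule vanishes_below_mult[OF hv])
    then have "vanishes_below (Suc ((p + q) * Suc N)) (h * power_sum L h)"
      using pq by (elim vanishes_below_mono) (simp add: algebra_simps)
    then have "vanishes_below (Suc ((p + q) * Suc N)) (D h)"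
      unfolding Dh mult.assoc by (rule vanishes_below_mult_left)
    then have "c = 0" using no_resonant_leading_term[OF h _ H0(1) DH'] by simp
    with c show False by simp
  qed
  then obtain k where k: "1 \<le> k" "k \<le> N" "L k \<noteq> 0" by blast
  define m where "m = (LEAST k. 1 \<le> k \<and> L k \<noteq> 0)"
  have m: "1 \<le> m" "L m \<noteq> 0" "m \<le> N"
    using LeastI[of "\<lambda>k. 1 \<le> k \<and> L k \<noteq> 0" k] Least_le[of "\<lambda>k. 1 \<le> k \<and> L k \<noteq> 0" k] k
    by (simp_all add: m_def)
  have least: "L k = 0" if "1 \<le> k" "k < m" for k
    using not_less_Least[of k "\<lambda>k. 1 \<le> k \<and> L k \<noteq> 0"] that by (simp add: m_def)
  have "m = N"
  proof (rule ccontr)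
    assume "m \<noteq> N"
    then have "Suc (Suc m) \<le> Suc N" using m(3) by simp
    then have "(p + q) * Suc (Suc m) \<le> (p + q) * Suc N" by (rule mult_le_mono2)
    then have less: "Suc ((p + q) * Suc m) \<le> (p + q) * Suc N" using pq by simp
    have "vanishes_below (Suc ((p + q) * Suc m)) (D H)"
    proof -
      have "vanishes_below (Suc ((p + q) * Suc m)) (D H - scalar c * u ^ Suc N)"
        using DH' by (rule vanishes_below_mono) (use less in linarith)
      moreover have "vanishes_below (Suc ((p + q) * Suc m)) (scalar c * u ^ Suc N)"
        using uv less by (intro vanishes_below_mult_left) (rule vanishes_below_mono)
      ultimately have "vanishes_below (Suc ((p + q) * Suc m))
          (D H - scalar c * u ^ Suc N + scalar c * u ^ Suc N)"
        by (rule vanishes_below_add)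
      then show ?thesis by (simp only: diff_add_cancel)
    qed
    moreover have "vanishes_below (Suc ((p + q) * Suc m))
        (D h - scalar (of_nat (p * q) * L m) * u ^ Suc m)"
    proof -
      have "D h - scalar (of_nat (p * q) * L m) * u ^ Suc m =
          scalar (of_nat (p * q)) * (h * (power_sum L h - scalar (L m) * h ^ m)) +
          scalar (of_nat (p * q) * L m) * (h ^ Suc m - u ^ Suc m)"
        unfolding Dh scalar_mult by (simp add: algebra_simps)
      moreover have "vanishes_below ((p + q) + Suc m * (p + q)) (h * (power_sum L h - scalar (L m) * h ^ m))"
        using m least pq by (intro vanishes_below_mult hv power_sum_leading_term) auto
      then have "vanishes_below (Suc ((p + q) * Suc m)) (h * (power_sum L h - scalar (L m) * h ^ m))"
        using pq by (elim vanishes_below_mono) (simp add: algebra_simps)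
      ultimately show ?thesis
        using vanishes_below_leading_power(2)[OF h, of "Suc m"]
        by (metis vanishes_below_add vanishes_below_mult_left)
    qed
    ultimately have "of_nat (p * q) * L m = 0"
      by (rule no_resonant_leading_term[OF H' _ H0(2)]) simp
    then show False using m pq by simp
  qed
  with m least have "L N \<noteq> 0" "\<And>k. 1 \<le> k \<Longrightarrow> k < N \<Longrightarrow> L k = 0" by auto
  moreover have "normal_form_change p q P Q X Y \<pi>1 \<pi>2"
    using X Y nf by (simp add: normal_form_change_def D no_low_terms_def vanishes_below_def)
  ultimately show ?thesis unfolding has_saddle_order_def L_def using N by blast
qed

section \<open>Algebraic tools\<close>

text \<open>Fixed point iteration for \<open>T\<close> on a small ball. Only the finitely many
  coordinates in \<open>I\<close> are followed, so completeness of the field itself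
  suffices.\<close>

lemma quadratic_system_solution:
  fixes q :: "'i \<Rightarrow> 'i \<Rightarrow> 'i \<Rightarrow> 'a::{real_normed_field,banach}"
  assumes fin: "finite I" and s0: "s0 \<in> I"
  shows "\<exists>w \<delta>. \<delta> \<noteq> 0 \<and>
    (\<forall>s\<in>I. w s + (\<Sum>t\<in>I. \<Sum>u\<in>I. w t * w u * q t u s) = (if s = s0 then \<delta> else 0))"
proof -
  define K where "K = 1 + (\<Sum>s\<in>I. \<Sum>t\<in>I. \<Sum>u\<in>I. norm (q t u s))"
  have K1: "K \<ge> 1" unfolding K_def by (simp add: sum_nonneg)
  have K: "(\<Sum>t\<in>I. \<Sum>u\<in>I. norm (q t u s)) \<le> K" if "s \<in> I" for s
  proof -
    have "(\<Sum>t\<in>I. \<Sum>u\<in>I. norm (q t u s)) \<le> (\<Sum>s\<in>I. \<Sum>t\<in>I. \<Sum>u\<in>I. norm (q t u s))"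
      using that fin by (intro member_le_sum) (auto intro!: sum_nonneg)
    then show ?thesis by (simp add: K_def)
  qed
  \<comment> \<open>On the ball of radius \<open>\<rho>\<close> the quadratic term is at most
    \<open>\<rho> / 4\<close>, and its Lipschitz constant \<open>2 * \<rho> * K\<close> is one half.
    The right-hand side \<open>\<rho> / 2\<close> therefore keeps the iterates in the ball.\<close>
  define \<rho> where "\<rho> = 1 / (4 * K)"
  have \<rho>: "\<rho> > 0" "2 * \<rho> * K = 1/2" using K1 by (auto simp: \<rho>_def)
  define T where "T w s = (if s = s0 then of_real (\<rho> / 2) else 0) -
    (\<Sum>t\<in>I. \<Sum>u\<in>I. w t * w u * q t u s)" for w s
  have quad: "norm (\<Sum>t\<in>I. \<Sum>u\<in>I. x t u * q t u s) \<le> M * K"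
    if "s \<in> I" "\<And>t u. t \<in> I \<Longrightarrow> u \<in> I \<Longrightarrow> norm (x t u) \<le> M" "M \<ge> 0" for x s M
  proof -
    have "norm (\<Sum>t\<in>I. \<Sum>u\<in>I. x t u * q t u s) \<le> (\<Sum>t\<in>I. \<Sum>u\<in>I. M * norm (q t u s))"
      by (intro sum_norm_le) (auto simp: norm_mult intro!: mult_right_mono that)
    also have "\<dots> = M * (\<Sum>t\<in>I. \<Sum>u\<in>I. norm (q t u s))" by (simp add: sum_distrib_left)
    also have "\<dots> \<le> M * K" using K[OF that(1)] that(3) by (rule mult_left_mono)
    finally show ?thesis .
  qed
  define W where "W k = (T ^^ k) (\<lambda>_. 0)" for k
  have W_Suc: "W (Suc k) = T (W k)" for k by (simp add: W_def)
  have W_bound: "norm (W k s) \<le> \<rho>" if "s \<in> I" for k s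
    using that
  proof (induction k arbitrary: s)
    case 0
    then show ?case using \<rho> by (simp add: W_def)
  next
    case (Suc k)
    have "norm (W k t * W k u) \<le> \<rho> * \<rho>" if "t \<in> I" "u \<in> I" for t u
      unfolding norm_mult using Suc.IH that \<rho> by (intro mult_mono) auto
    then have "norm (\<Sum>t\<in>I. \<Sum>u\<in>I. W k t * W k u * q t u s) \<le> \<rho> * \<rho> * K"
      using \<rho> by (intro quad Suc.prems) auto
    also have "\<dots> = \<rho> / 4" using \<rho> by (simp add: mult.assoc)
    finally have "norm (\<Sum>t\<in>I. \<Sum>u\<in>I. W k t * W k u * q t u s) \<le> \<rho> / 4" .
    moreover have "norm (if s = s0 then of_real (\<rho> / 2) else 0 :: 'a) \<le> \<rho> / 2"
      using \<rho> by (simp del: of_real_divide)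
    ultimately show ?case unfolding W_Suc T_def using \<rho> by (intro norm_triangle_le_diff) auto
  qed
  have W_step: "norm (W (Suc k) s - W k s) \<le> \<rho> * (1/2) ^ k" if "s \<in> I" for k s
    using that
  proof (induction k arbitrary: s)
    case 0
    then show ?case using W_bound[of s "Suc 0"] by (simp add: W_def)
  next
    case (Suc k)
    let ?e = "\<rho> * (1/2) ^ k"
    have "norm (W (Suc k) t * W (Suc k) u - W k t * W k u) \<le> 2 * \<rho> * ?e"
      if "t \<in> I" "u \<in> I" for t u
    proof -
      have "W (Suc k) t * W (Suc k) u - W k t * W k u =
          W (Suc k) t * (W (Suc k) u - W k u) + (W (Suc k) t - W k t) * W k u"
        by (simp add: algebra_simps)
      also have "norm \<dots> \<le> \<rho> * ?e + ?e * \<rho>"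
        by (intro norm_triangle_le add_mono)
           (use \<rho>(1) in \<open>auto simp: norm_mult intro!: mult_mono W_bound Suc.IH that\<close>)
      finally show ?thesis by (simp add: algebra_simps)
    qed
    then have "norm (\<Sum>t\<in>I. \<Sum>u\<in>I. (W (Suc k) t * W (Suc k) u - W k t * W k u) * q t u s)
        \<le> (2 * \<rho> * ?e) * K"
      using \<rho> by (intro quad Suc.prems) auto
    also have "\<dots> = 2 * \<rho> * K * ?e" by simp
    also have "\<dots> = \<rho> * (1/2) ^ Suc k" by (simp only: \<rho>(2)) simp
    finally have "norm (\<Sum>t\<in>I. \<Sum>u\<in>I. (W (Suc k) t * W (Suc k) u - W k t * W k u) * q t u s)
        \<le> \<rho> * (1/2) ^ Suc k" .
    moreover have "W (Suc (Suc k)) s - W (Suc k) s =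
        - (\<Sum>t\<in>I. \<Sum>u\<in>I. (W (Suc k) t * W (Suc k) u - W k t * W k u) * q t u s)"
      unfolding W_Suc[of "Suc k"] W_Suc[of k] T_def
      by (simp add: left_diff_distrib sum_subtractf)
    ultimately show ?case by (simp only: norm_minus_cancel)
  qed
  define w where "w s = lim (\<lambda>k. W k s)" for s
  have lim: "(\<lambda>k. W k s) \<longlonglongrightarrow> w s" if "s \<in> I" for s
  proof -
    have "summable (\<lambda>k. W (Suc k) s - W k s)"
      by (rule summable_comparison_test'[of "\<lambda>k. \<rho> * (1/2) ^ k" 0])
         (auto intro: W_step that summable_mult summable_geometric)
    then have "convergent (\<lambda>k. \<Sum>i<k. W (Suc i) s - W i s)"
      by (simp add: summable_iff_convergent)
    then have "convergent (\<lambda>k. W k s)"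
      unfolding sum_lessThan_telescope[of "\<lambda>k. W k s"] by (simp add: W_def)
    then show ?thesis by (simp add: w_def convergent_LIMSEQ_iff)
  qed
  have "w s + (\<Sum>t\<in>I. \<Sum>u\<in>I. w t * w u * q t u s) =
      (if s = s0 then of_real (\<rho> / 2) else 0)" if "s \<in> I" for s
  proof -
    have "(\<lambda>k. W (Suc k) s) \<longlonglongrightarrow> (if s = s0 then of_real (\<rho> / 2) else 0) -
        (\<Sum>t\<in>I. \<Sum>u\<in>I. w t * w u * q t u s)"
      unfolding W_Suc T_def by (intro tendsto_intros lim)
    with LIMSEQ_Suc[OF lim[OF that]] have "w s = (if s = s0 then of_real (\<rho> / 2) else 0) -
        (\<Sum>t\<in>I. \<Sum>u\<in>I. w t * w u * q t u s)"
      by (rule LIMSEQ_unique)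
    then show ?thesis by simp
  qed
  moreover have "of_real (\<rho> / 2) \<noteq> (0 :: 'a)" using \<rho> by simp
  ultimately show ?thesis by blast
qed

lemma polynomial_interpolation:
  fixes x y :: "nat \<Rightarrow> 'a::field"
  assumes "inj_on x {..k}"
  shows "\<exists>g. degree g \<le> k \<and> (\<forall>i\<le>k. poly g (x i) = y i)"
  using assms
proof (induction k)
  case 0
  show ?case by (intro exI[of _ "[:y 0:]"]) simp
next
  case (Suc k)
  then obtain g where g: "degree g \<le> k" "\<And>i. i \<le> k \<Longrightarrow> poly g (x i) = y i"
    using inj_on_subset[of x "{..Suc k}" "{..k}"] by auto
  define h where "h = (\<Prod>i\<le>k. [:- x i, 1:])"
  have h: "poly h (x i) = 0" if "i \<le> k" for i
    using that by (auto simp: h_def poly_prod)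
  have h': "poly h (x (Suc k)) \<noteq> 0"
  proof -
    have "x i \<noteq> x (Suc k)" if "i \<le> k" for i
      using inj_onD[OF Suc.prems, of i "Suc k"] that by auto
    then show ?thesis by (simp add: h_def poly_prod) (metis atMost_iff)
  qed
  have "degree h \<le> Suc k"
    unfolding h_def using degree_prod_sum_le[of "{..k}" "\<lambda>i. [:- x i, 1:]"] by simp
  then have "degree (g + smult c h) \<le> Suc k" for c
    using g(1) by (intro degree_add_le order.trans[OF degree_smult_le]) auto
  moreover have "poly (g + smult ((y (Suc k) - poly g (x (Suc k))) / poly h (x (Suc k))) h) (x i) = y i"
    if "i \<le> Suc k" for i
    using that g(2) h h' by (cases "i = Suc k") auto
  ultimately show ?case by blast
qed

text \<open>
  The products are a Newton-like basis of two interlaced kinds of linear factors: the last index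
  isolates the root of the last factor \<open>Q z - r - 1 + m\<close>, which can then be divided out. This works
  unless that root is shared with an earlier factor \<open>P z + 1 - t\<close>, which only happens at \<open>z = 0\<close>.
\<close>
lemma two_sided_newton_basis:
  fixes P Q r :: nat and g :: "'a::field_char_0 poly"
  assumes Q: "Q > 0"
    and no_common_root: "\<And>t t'. t < t' \<Longrightarrow> t' \<le> m \<Longrightarrow> int Q * (int t - 1) = int P * (int r + 1 - int t') \<Longrightarrow>
      t = 1 \<and> t' = r + 1"
    and P: "P > 0" and r: "r \<ge> 1"
    and "degree g \<le> m" and "m \<ge> r + 1 \<Longrightarrow> poly g 0 = 0"
  shows "\<exists>\<theta>. g = (\<Sum>i\<le>m. smult (\<theta> i)
    ((\<Prod>t<i. [:1 - of_nat t, of_nat P:]) * (\<Prod>t\<in>{i<..m}. [:of_nat t - of_nat r - 1, of_nat Q:])))"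
  using no_common_root assms(5,6)
proof (induction m arbitrary: g)
  case 0
  then obtain c where "g = [:c:]" by (auto elim: degree_eq_zeroE)
  then show ?case by (intro exI[of _ "\<lambda>_. c"]) simp
next
  case (Suc m)
  define u :: "nat \<Rightarrow> 'a poly" where "u t = [:1 - of_nat t, of_nat P:]" for t
  define v :: "nat \<Rightarrow> 'a poly" where "v t = [:of_nat t - of_nat r - 1, of_nat Q:]" for t
  define f where "f = (\<Prod>t<Suc m. u t)"
  define z :: 'a where "z = (of_nat r + 1 - of_nat (Suc m)) / of_nat Q"
  have deg_u: "degree (u t) = 1" for t using P by (simp add: u_def)
  have deg_v: "degree (v t) = 1" "v t \<noteq> 0" for t using Q by (auto simp: v_def)
  have v_z: "v (Suc m) = smult (of_nat Q) [:- z, 1:]"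
    using Q by (simp add: v_def z_def field_simps)
  have deg_f: "degree f \<le> Suc m"
    unfolding f_def using degree_prod_sum_le[of "{..<Suc m}" u] by (simp add: deg_u)
  \<comment> \<open>Only the last product \<open>f\<close> lacks the factor
    \<open>v (Suc m)\<close>, so its coefficient must make the remainder vanish at \<open>z\<close>.
    If \<open>Suc m = r + 1\<close>, then \<open>z = 0\<close> and \<open>g\<close> already vanishes
    there.\<close>
  have "\<exists>c. poly (g - smult c f) z = 0 \<and> (Suc m = r + 1 \<longrightarrow> c = 0)"
  proof (cases "Suc m = r + 1")
    case True
    then show ?thesis using Suc.prems(3) by (intro exI[of _ 0]) (simp add: z_def)
  next
    case False
    have "poly (u t) z \<noteq> 0" if "t < Suc m" for t
    proof
      assume "poly (u t) z = 0"
      then have "of_nat P * (of_nat r + 1 - of_nat (Suc m)) = (of_nat t - 1) * (of_nat Q :: 'a)"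
        using Q by (simp add: u_def z_def field_simps)
      then have "of_int (int P * (int r + 1 - int (Suc m))) = (of_int ((int t - 1) * int Q) :: 'a)"
        by simp
      then have "int Q * (int t - 1) = int P * (int r + 1 - int (Suc m))"
        unfolding of_int_eq_iff by (simp add: mult.commute)
      with Suc.prems(1)[OF that] False show False by simp
    qed
    then have "poly f z \<noteq> 0" unfolding f_def poly_prod by simp
    then show ?thesis using False by (intro exI[of _ "poly g z / poly f z"]) simp
  qed
  then obtain c where c: "poly (g - smult c f) z = 0" "Suc m = r + 1 \<Longrightarrow> c = 0" by blast
  have "v (Suc m) dvd g - smult c f"
    unfolding v_z using c(1) Q by (intro smult_dvd) (simp_all only: poly_eq_0_iff_dvd of_nat_eq_0_iff)
  then obtain g' where g': "g - smult c f = v (Suc m) * g'" by (elim dvdE)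
  have "degree (g - smult c f) \<le> Suc m"
    using Suc.prems(2) deg_f by (intro degree_diff_le order.trans[OF degree_smult_le]) auto
  then have "degree g' \<le> m"
    unfolding g' using deg_v[of "Suc m"] by (cases "g' = 0") (auto simp: degree_mult_eq)
  moreover have "poly g' 0 = 0" if "m \<ge> r + 1"
  proof -
    have "poly f 0 = 0" unfolding f_def poly_prod using that
      by (auto intro!: prod_zero bexI[of _ 1] simp: u_def)
    moreover have "poly g 0 = 0" using Suc.prems(3) that by simp
    ultimately have "poly (v (Suc m)) 0 * poly g' 0 = 0"
      by (simp flip: poly_mult g')
    moreover have "poly (v (Suc m)) 0 = of_nat (m - r)"
      using that by (simp add: v_def of_nat_diff)
    ultimately show ?thesis using that by simp
  qed
  ultimately obtain \<theta> where \<theta>: "g' = (\<Sum>i\<le>m. smult (\<theta> i) ((\<Prod>t<i. u t) * (\<Prod>t\<in>{i<..m}. v t)))"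
    using Suc.IH[of g'] Suc.prems(1) unfolding u_def v_def by fastforce
  have v_prod: "(\<Prod>t\<in>{i<..Suc m}. v t) = v (Suc m) * (\<Prod>t\<in>{i<..m}. v t)" if "i \<le> m" for i
  proof -
    have "{i<..Suc m} = insert (Suc m) {i<..m}" using that by auto
    then show ?thesis by simp
  qed
  have "g = smult c f + v (Suc m) * g'" using g' by (simp add: algebra_simps)
  also have "v (Suc m) * g' = (\<Sum>i\<le>m. smult (\<theta> i) ((\<Prod>t<i. u t) * (\<Prod>t\<in>{i<..Suc m}. v t)))"
    unfolding \<theta> sum_distrib_left by (intro sum.cong) (simp_all add: v_prod mult_ac)
  finally have "g = (\<Sum>i\<le>Suc m. smult ((\<theta>(Suc m := c)) i)
      ((\<Prod>t<i. u t) * (\<Prod>t\<in>{i<..Suc m}. v t)))"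
    by (simp add: f_def)
  then show ?case unfolding u_def v_def by blast
qed

text \<open>Take the largest divisor \<open>c\<close> of \<open>p\<close> that is coprime to
  \<open>a\<close>. A prime dividing both \<open>r\<close> and \<open>a * p\<close> can divide
  neither \<open>a\<close> nor \<open>c\<close>, hence divides \<open>p\<close>; multiplying
  \<open>c\<close> by it contradicts maximality.\<close>

lemma exists_coprime_shift:
  fixes a p :: nat
  assumes "p \<ge> 1"
  shows "\<exists>c\<ge>1. c \<le> p \<and> (\<forall>r. r + c = a \<longrightarrow> coprime r (a * p))"
proof -
  define S where "S = {c. c dvd p \<and> coprime c a}"
  have S: "finite S" "1 \<in> S" using assms by (auto simp: S_def)
  define c where "c = Max S"
  have cS: "c \<in> S" unfolding c_def using S by (intro Max_in) auto
  then have c: "c dvd p" "coprime c a" by (auto simp: S_def)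
  have cp: "c \<ge> 1" "c \<le> p" using assms c by (auto intro: dvd_imp_le Nat.gr0I)
  have "coprime r (a * p)" if r: "r + c = a" for r
  proof (rule ccontr)
    assume "\<not> coprime r (a * p)"
    then obtain l where l: "prime l" "l dvd r" "l dvd a * p"
      by (meson coprime_iff_gcd_eq_1 prime_factor_nat dvd_trans gcd_dvd1 gcd_dvd2)
    have "\<not> l dvd c"
    proof
      assume "l dvd c"
      moreover then have "l dvd a" using l(2) r by (metis dvd_add)
      ultimately show False using c(2) l(1) by (metis coprime_common_divisor_nat not_prime_1 nat_dvd_1_iff_1)
    qed
    moreover have "l dvd c" if "l dvd a" using l(2) r that by (metis dvd_add_right_iff)
    ultimately have "\<not> l dvd a" "l dvd p" using l by (auto simp: prime_dvd_mult_iff)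
    moreover have "coprime c l" using \<open>\<not> l dvd c\<close> l(1) by (metis coprime_commute prime_imp_coprime)
    ultimately have "c * l dvd p" using c by (simp add: divides_mult)
    moreover have "coprime (c * l) a"
      using c(2) \<open>\<not> l dvd a\<close> l(1) by (simp add: prime_imp_coprime)
    ultimately have "c * l \<in> S" by (simp add: S_def)
    then have "c * l \<le> c" unfolding c_def using S by simp
    then show False using cp(1) prime_gt_1_nat[OF l(1)] by simp
  qed
  with cp show ?thesis by blast
qed

text \<open>Recurrence for the coefficients of \<open>(1 - z) powr a\<close>, used for the first
  integral as well as for the integrating factors.\<close>

lemma gbinomial_sign_recurrence:
  fixes a :: "'a::field_char_0"
  shows "(-1) ^ Suc l * (a gchoose Suc l) * of_nat (Suc l) = (-1) ^ l * (a gchoose l) * (of_nat l - a)"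
proof -
  have "of_nat (Suc l) * (a gchoose Suc l) = (a - of_nat l) * (a gchoose l)"
    using gbinomial_mult_1[of a l] by (simp only: left_diff_distrib) (simp add: algebra_simps)
  moreover have "(-1) ^ Suc l * (a gchoose Suc l) * of_nat (Suc l) =
      - ((-1) ^ l * (of_nat (Suc l) * (a gchoose Suc l)))"
    by (simp del: of_nat_Suc add: mult_ac)
  ultimately show ?thesis by (simp only:) (simp add: algebra_simps)
qed

lemma linear_form_power_nth:
  "(var_x ^ a * (var_x + var_y) ^ b :: 'a::field_char_0 fps fps) $ i $ j =
    (if i + j = a + b then of_nat (b choose j) else 0)"
proof (induction b arbitrary: i j)
  case 0
  show ?case using monomial_nth[of a 0 i j, where ?'a = 'a] by (cases j) auto
next
  case (Suc b)
  let ?G = "var_x ^ a * (var_x + var_y) ^ b :: 'a fps fps"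
  have "var_x ^ a * (var_x + var_y) ^ Suc b = var_x * ?G + var_y * ?G"
    by (simp add: algebra_simps)
  then have "(var_x ^ a * (var_x + var_y) ^ Suc b :: 'a fps fps) $ i $ j =
      (if i = 0 then 0 else ?G $ (i - 1) $ j) + (if j = 0 then 0 else ?G $ i $ (j - 1))"
    by (simp only: fps_add_nth var_x_mult_nth var_y_mult_nth)
  also have "\<dots> = (if i + j = a + Suc b then of_nat (Suc b choose j) else 0)"
    unfolding Suc.IH by (cases i; cases j) (auto simp: binomial_eq_0)
  finally show ?case .
qed

lemma homogeneous_polynomial_exists:
  fixes F :: "'a::field_char_0 fps fps"
  assumes "degree_class 0 n F"
  shows "\<exists>P. homogeneous2 n P \<and> fps2_of_poly2 P = F"
proof -
  define P where "P = (\<Sum>i\<le>n. monom (monom (F $ i $ (n - i)) (n - i)) i)"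
  have "coeff (coeff P i) j = F $ i $ j" for i j
  proof -
    have "coeff P i = (if i \<le> n then monom (F $ i $ (n - i)) (n - i) else 0)"
      by (simp add: P_def coeff_sum if_distrib cong: if_cong)
    then have "coeff (coeff P i) j = (if i \<le> n \<and> j = n - i then F $ i $ (n - i) else 0)"
      by simp
    then show ?thesis using assms
      unfolding degree_class_def cong_def by (metis add_diff_cancel_left' le_add1 le_add_diff_inverse mod_0 mod_by_0)
  qed
  then have "homogeneous2 n P" "fps2_of_poly2 P = F"
    using assms by (auto simp: homogeneous2_def degree_class_def cong_def fps2_of_poly2_def
        coeff_map_poly intro!: fps2_eqI)
  then show ?thesis by blast
qed

text \<open>Write the binomial coefficient as m! / (v! w!) with v = P J + 1 - i and w = Q J + i - r
  - 1. The row factor turns it into the two falling factorials (P J + 1)! / v! and (Q J + s + 1 -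
  r)! / w!, which for fixed \<open>i\<close> are polynomials in \<open>J\<close> of total degree
  \<open>s + 2\<close>. Where v or w would be negative, one linear factor is zero, matching the zero
  on the left.\<close>

lemma binomial_eq_newton_products:
  fixes P Q r J i s m :: nat
  assumes M: "m + r = (P + Q) * J" and i: "i \<le> s + 2" and r: "r \<le> s"
  shows "of_nat (if i \<le> P * J + 1 then m choose (P * J + 1 - i) else 0) *
      (of_nat (fact (P * J + 1) * fact (Q * J + s + 1 - r)) / of_nat (fact m)) =
    (\<Prod>t<i. of_nat P * of_nat J + 1 - of_nat t) *
    (\<Prod>t\<in>{i<..s + 2}. of_nat Q * of_nat J + (of_nat t - of_nat r - 1) :: 'a::field_char_0)"
    (is "?L = ?A * ?B")
proof (cases "i \<le> P * J + 1")
  case False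
  have "?A = 0"
    using False by (intro prod_zero) (auto intro!: bexI[of _ "P * J + 1"])
  then show ?thesis using False by simp
next
  case iP: True
  define v where "v = P * J + 1 - i"
  show ?thesis
  proof (cases "v \<le> m")
    case False
    then have lt: "Q * J + i < r + 1" using M iP by (simp add: v_def algebra_simps)
    have "?B = 0"
    proof (rule prod_zero)
      have "of_nat (r + 1 - Q * J) = (of_nat r + 1 - of_nat Q * of_nat J :: 'a)"
        using lt by (simp add: of_nat_diff)
      then show "\<exists>t\<in>{i<..s + 2}. of_nat Q * of_nat J + (of_nat t - of_nat r - 1) = (0 :: 'a)"
        using lt r by (intro bexI[of _ "r + 1 - Q * J"]) auto
    qed simp
    then show ?thesis using False iP by (simp add: v_def binomial_eq_0)
  next
    case True
    then have ge: "r + 1 \<le> Q * J + i" using M iP by (simp add: v_def algebra_simps)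
    define w where "w = Q * J + i - (r + 1)"
    have mw: "m - v = w" using M iP ge True by (simp add: v_def w_def algebra_simps)
    have A: "?A * of_nat (fact v) = of_nat (fact (P * J + 1))"
    proof -
      have "?A * of_nat (fact (P * J + 1 - i)) = (of_nat (fact (P * J + 1)) :: 'a)" if "i \<le> P * J + 1"
        using that
      proof (induction i)
        case (Suc i)
        have "P * J + 1 - i = Suc (P * J + 1 - Suc i)" using Suc.prems by simp
        then have "fact (P * J + 1 - i) = (P * J + 1 - i) * (fact (P * J + 1 - Suc i) :: nat)"
          by (metis fact_Suc of_nat_id)
        moreover have "of_nat (P * J + 1 - i) = (of_nat P * of_nat J + 1 - of_nat i :: 'a)"
          using Suc.prems by (simp add: of_nat_diff)
        ultimately have "(of_nat P * of_nat J + 1 - of_nat i) * of_nat (fact (P * J + 1 - Suc i)) =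
            (of_nat (fact (P * J + 1 - i)) :: 'a)"
          by (simp only: of_nat_mult)
        moreover have "(\<Prod>t<i. of_nat P * of_nat J + 1 - of_nat t) * of_nat (fact (P * J + 1 - i)) =
            (of_nat (fact (P * J + 1)) :: 'a)"
          using Suc by simp
        ultimately show ?case by (simp only: prod.lessThan_Suc mult.assoc)
      qed simp
      then show ?thesis using iP by (simp add: v_def)
    qed
    have B: "?B * of_nat (fact w) = of_nat (fact (Q * J + s + 1 - r))"
    proof -
      have "(\<Prod>t\<in>{i<..i + k}. of_nat Q * of_nat J + (of_nat t - of_nat r - 1)) * of_nat (fact w) =
          (of_nat (fact (w + k)) :: 'a)" for k
      proof (induction k)
        case (Suc k)
        let ?F = "\<lambda>t. of_nat Q * of_nat J + (of_nat t - of_nat r - 1) :: 'a"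
        have set: "{i<..i + Suc k} = insert (i + Suc k) {i<..i + k}" by auto
        have "prod ?F {i<..i + Suc k} = ?F (i + Suc k) * prod ?F {i<..i + k}"
          unfolding set by (subst prod.insert) auto
        moreover have "of_nat (Suc (w + k)) = (of_nat Q * of_nat J + (of_nat (i + Suc k) - of_nat r - 1) :: 'a)"
          using ge by (simp add: w_def of_nat_diff algebra_simps)
        moreover have "of_nat (fact (w + Suc k)) = (of_nat (Suc (w + k)) * of_nat (fact (w + k)) :: 'a)"
          by (simp only: add_Suc_right fact_Suc of_nat_mult of_nat_id)
        ultimately show ?case using Suc by (simp only: mult.assoc)
      qed simp
      moreover have "i + (s + 2 - i) = s + 2" "w + (s + 2 - i) = Q * J + s + 1 - r"
        using i ge r by (auto simp: w_def)
      ultimately show ?thesis by metis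
    qed
    have "(m choose v) * (fact v * fact w) = (fact m :: nat)"
      using binomial_fact_lemma[OF True] mw by (simp add: mult_ac)
    then have C: "of_nat (m choose v) * (of_nat (fact v) * of_nat (fact w)) = (of_nat (fact m) :: 'a)"
      by (metis of_nat_mult)
    have "?L = of_nat (m choose v) * (?A * of_nat (fact v) * (?B * of_nat (fact w))) / of_nat (fact m)"
      unfolding A B using iP by (simp only: v_def if_True of_nat_mult times_divide_eq_right)
    also have "\<dots> = ?A * ?B * (of_nat (m choose v) * (of_nat (fact v) * of_nat (fact w))) / of_nat (fact m)"
      by (simp add: mult_ac)
    also have "\<dots> = ?A * ?B" unfolding C by simp
    finally show ?thesis .
  qed
qed

lemma sum_antidiagonal:
  fixes g :: "nat \<Rightarrow> nat \<Rightarrow> 'b::comm_monoid_add"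
  assumes "\<And>j l. j + l \<noteq> M \<Longrightarrow> g j l = 0" "M \<le> A" "M < B"
  shows "(\<Sum>j\<le>A. \<Sum>l<B. g j l) = (\<Sum>l=0..M. g (M - l) l)"
proof -
  have "(\<Sum>j\<le>A. g j l) = (if l \<in> {0..M} then g (M - l) l else 0)" for l
  proof (cases "l \<le> M")
    case True
    have "(\<Sum>j\<le>A. g j l) = (\<Sum>j\<in>{M - l}. g j l)"
    proof (intro sum.mono_neutral_right ballI)
      fix j assume "j \<in> {..A} - {M - l}"
      with True show "g j l = 0" by (intro assms(1)) auto
    qed (use True assms in auto)
    then show ?thesis using True by simp
  next
    case False
    then show ?thesis using assms(1) by (simp add: sum.neutral)
  qed
  then have "(\<Sum>j\<le>A. \<Sum>l<B. g j l) = (\<Sum>l<B. if l \<in> {0..M} then g (M - l) l else 0)"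
    by (subst sum.swap) simp
  also have "\<dots> = (\<Sum>l=0..M. if l \<in> {0..M} then g (M - l) l else 0)"
    using assms(3) by (intro sum.mono_neutral_right) auto
  finally show ?thesis by simp
qed

section \<open>The perturbed system\<close>

text \<open>
  The degree of the system is \<open>n = s + 1\<close>; \<open>k1\<close> and \<open>m1\<close> stand for \<open>(n - 1) / d\<close> and \<open>(p + q) / d\<close>, and
  \<open>\<kappa>\<close> for \<open>(p + q) / (n - 1)\<close>. The bound on saddle orders reads \<open>(n\<^sup>2 - 1) / d = (s + 2) k1\<close>.
\<close>

locale perturbed_saddle =
  fixes p q s r k1 m1 :: nat and \<kappa> :: "'a::field_char_0"
  assumes p: "1 \<le> p" and q: "1 \<le> q" and coprime: "coprime p q"
    and ratio: "(p + q) * k1 = s * m1" and coprime_k1_m1: "coprime k1 m1"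
    and r: "1 \<le> r" "r \<le> s" "coprime r (p * k1)" "p * k1 < r * m1"
    and large: "2 \<le> p * k1" "p + q < s"
    and \<kappa>: "\<kappa> * of_nat s = of_nat (p + q)"
begin

lemma k1: "1 \<le> k1" and m1: "1 \<le> m1" and s: "1 \<le> s"
proof -
  show "1 \<le> k1" using large by (cases k1) auto
  show "1 \<le> m1" using r by (cases m1) auto
  show "1 \<le> s" using large by auto
qed

lemma \<kappa>_k1: "\<kappa> * of_nat k1 = of_nat m1"
proof -
  have "\<kappa> * of_nat k1 * of_nat s = of_nat ((p + q) * k1)"
    using \<kappa> by (metis mult.assoc mult.commute of_nat_mult)
  also have "\<dots> = of_nat m1 * of_nat s" unfolding ratio by simp
  finally show ?thesis using s by simp
qed

section \<open>Surjectivity of the matrix of binomial coefficients\<close>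

text \<open>With \<open>J * m1 = Suc M\<close>, the upper index is the exponent of
  \<open>x + y\<close> in \<open>\<alpha> ^ M\<close>; the lower index is the power of
  \<open>y\<close> that the \<open>i\<close>-th perturbation leaves to \<open>\<alpha> ^ M\<close>.
  The guard is needed because subtraction is truncated.\<close>

definition coefficient :: "nat \<Rightarrow> nat \<Rightarrow> nat" where
  "coefficient J i = (if i \<le> p * k1 * J + 1 then r * (J * m1 - 1) choose (p * k1 * J + 1 - i) else 0)"

lemma coprime_m1_p: "coprime p m1"
proof -
  have "m1 dvd (p + q) * k1" unfolding ratio by simp
  then have "m1 dvd p + q" using coprime_k1_m1 by (metis coprime_commute coprime_dvd_mult_left_iff)
  then show ?thesis using coprime
    by (metis coprime_add_one_right coprime_divisors coprime_commute dvd_refl gcd_add2 coprime_iff_gcd_eq_1)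
qed

text \<open>Scaling row \<open>J\<close> by \<open>\<rho> J\<close> makes column \<open>i\<close>
  the values of a product from \<open>two_sided_newton_basis\<close>. A combination of columns is
  then a polynomial \<open>g\<close> evaluated at \<open>J\<close>, and interpolation prescribes
  it.\<close>

lemma coefficient_surjective:
  "\<exists>t. \<forall>J\<in>{1..s + 2}. (\<Sum>i\<le>s + 2. t i * of_nat (coefficient J i)) = (\<tau> J :: 'a)"
proof -
  define P where "P = p * k1"
  define Q where "Q = r * m1 - P"
  have PQ: "P + Q = r * m1" "Q > 0" "P \<ge> 2" using r large by (auto simp: P_def Q_def)
  have "coprime P (r * m1)"
    using r(3) coprime_k1_m1 coprime_m1_p unfolding P_def by (simp add: coprime_commute)
  then have coprime_PQ: "coprime P Q" unfolding PQ(1)[symmetric]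
    by (simp add: coprime_iff_gcd_eq_1)
  define \<rho> :: "nat \<Rightarrow> 'a" where
    "\<rho> J = of_nat (fact (P * J + 1) * fact (Q * J + s + 1 - r)) / of_nat (fact (r * (J * m1 - 1)))" for J
  have \<rho>: "\<rho> J \<noteq> 0" for J
    by (simp only: \<rho>_def divide_eq_0_iff of_nat_eq_0_iff mult_eq_0_iff fact_nonzero) simp
  \<comment> \<open>The extra node 0 with value 0 is forced: every product contains the factor with
    \<open>t = 1\<close> on the left or \<open>t = r + 1\<close> on the right.\<close>
  obtain g :: "'a poly" where g: "degree g \<le> s + 2"
    "\<And>J. J \<le> s + 2 \<Longrightarrow> poly g (of_nat J) = (if J = 0 then 0 else \<tau> J * \<rho> J)"
    using polynomial_interpolation[of of_nat "s + 2" "\<lambda>J. if J = 0 then 0 else \<tau> J * \<rho> J"]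
    by (auto simp: inj_on_def)
  have "\<exists>\<theta>. g = (\<Sum>i\<le>s + 2. smult (\<theta> i)
    ((\<Prod>t<i. [:1 - of_nat t, of_nat P:]) * (\<Prod>t\<in>{i<..s + 2}. [:of_nat t - of_nat r - 1, of_nat Q:])))"
  proof (rule two_sided_newton_basis[OF PQ(2) _ _ r(1) g(1)])
    \<comment> \<open>By coprimality a common root is an integer \<open>a\<close>. If
      \<open>a \<ge> 1\<close>, adding the two equations gives
      \<open>(P + Q) * a = r + t - t' < r\<close>, although \<open>P + Q = r * m1\<close>; a
      negative \<open>a\<close> is excluded because \<open>P \<ge> 2\<close>. So the root is
      0.\<close>
    fix t t' assume t: "t < t'" "t' \<le> s + 2" and eq: "int Q * (int t - 1) = int P * (int r + 1 - int t')"
    have "int P dvd int Q * (int t - 1)" unfolding eq by simp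
    moreover have "coprime (int P) (int Q)" using coprime_PQ by simp
    ultimately have "int P dvd int t - 1" by (simp add: coprime_dvd_mult_right_iff)
    then obtain a where a: "int t - 1 = int P * a" by (elim dvdE)
    then have "int P * (int Q * a) = int P * (int r + 1 - int t')" using eq by (simp add: mult.left_commute)
    then have a': "int Q * a = int r + 1 - int t'" using PQ(3) by simp
    have "a \<ge> 0"
    proof (rule ccontr)
      assume "\<not> a \<ge> 0"
      then have "int P * a \<le> int P * (- 1)" by (intro mult_left_mono) auto
      then show False using a PQ(3) by simp
    qed
    moreover have "\<not> a \<ge> 1"
    proof
      assume a1: "a \<ge> 1"
      have "int P * a + int Q * a < int r" using a a' t(1) by simp
      then have "int (P + Q) * a < int r" by (simp add: distrib_right)
      moreover have "1 * 1 \<le> int m1 * a" using a1 m1 by (intro mult_mono) auto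
      then have "int r * 1 \<le> int (P + Q) * a"
        unfolding PQ(1) of_nat_mult mult.assoc by (intro mult_left_mono) auto
      ultimately show False by simp
    qed
    ultimately have "a = 0" by simp
    then show "t = 1 \<and> t' = r + 1" using a a' by simp
  qed (use PQ g(2)[of 0] in auto)
  then obtain \<theta> where \<theta>: "g = (\<Sum>i\<le>s + 2. smult (\<theta> i)
    ((\<Prod>t<i. [:1 - of_nat t, of_nat P:]) * (\<Prod>t\<in>{i<..s + 2}. [:of_nat t - of_nat r - 1, of_nat Q:])))"
    by blast
  have "(\<Sum>i\<le>s + 2. \<theta> i * of_nat (coefficient J i)) = \<tau> J" if J: "J \<in> {1..s + 2}" for J
  proof -
    have "r * (J * m1 - 1) + r = r * (J * m1)" using J m1 by (cases "J * m1") auto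
    also have "\<dots> = (P + Q) * J" by (simp add: PQ mult_ac)
    finally have M: "r * (J * m1 - 1) + r = (P + Q) * J" .
    have "\<tau> J * \<rho> J = poly g (of_nat J)" using g(2) J by simp
    also have "\<dots> = (\<Sum>i\<le>s + 2. \<theta> i * ((\<Prod>t<i. of_nat P * of_nat J + 1 - of_nat t) *
        (\<Prod>t\<in>{i<..s + 2}. of_nat Q * of_nat J + (of_nat t - of_nat r - 1))))"
      unfolding \<theta> poly_sum by (simp add: poly_prod algebra_simps)
    also have "\<dots> = (\<Sum>i\<le>s + 2. \<theta> i * (of_nat (coefficient J i) * \<rho> J))"
      unfolding coefficient_def \<rho>_def P_def[symmetric]
      by (intro sum.cong refl arg_cong2[where f = "(*)"] binomial_eq_newton_products[symmetric] M r(2)) simp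
    also have "\<dots> = (\<Sum>i\<le>s + 2. \<theta> i * of_nat (coefficient J i)) * \<rho> J"
      by (simp only: sum_distrib_right mult.assoc)
    finally show ?thesis using \<rho>[of J] by simp
  qed
  then show ?thesis by blast
qed

section \<open>The unperturbed system: linear part plus \<open>f\<close> times the Euler
  field\<close>

definition \<alpha> :: "'a fps fps" where "\<alpha> = var_x ^ (s - r) * (var_x + var_y) ^ r"

definition D0 :: "'a fps fps \<Rightarrow> 'a fps fps" where
  "D0 = vector_field (scalar (of_nat p) * var_x) (scalar (- of_nat q) * var_y)"

text \<open>The Euler field, with its unit factors written out so that it fits
  \<open>vector_field_diagonal_nth\<close>.\<close>

definition E :: "'a fps fps \<Rightarrow> 'a fps fps" where
  "E = vector_field (scalar 1 * var_x) (scalar 1 * var_y)"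

text \<open>This choice makes 1 - \<alpha> semi-invariant: \<open>V\<close> maps it to s f (1 -
  \<alpha>). Multiplication by powers of 1 - \<alpha> can therefore cancel the effect of
  \<open>f\<close>.\<close>

definition f :: "'a fps fps" where "f = scalar (- 1 / of_nat s) * D0 \<alpha>"

definition V :: "'a fps fps \<Rightarrow> 'a fps fps" where "V F = D0 F + f * E F"

definition u :: "'a fps fps" where "u = var_x ^ q * var_y ^ p"

lemma D0_nth: "D0 F $ i $ j = (of_nat p * of_nat i - of_nat q * of_nat j) * F $ i $ j"
  by (simp add: D0_def vector_field_diagonal_nth)

lemma E_nth: "E F $ i $ j = of_nat (i + j) * F $ i $ j"
  unfolding E_def vector_field_diagonal_nth by simp

lemma E_homogeneous: "degree_class 0 a F \<Longrightarrow> E F = of_nat a * F"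
proof (rule fps2_eqI)
  fix i j assume F: "degree_class 0 a F"
  show "E F $ i $ j = (of_nat a * F) $ i $ j"
  proof (cases "F $ i $ j = 0")
    case True
    then show ?thesis by (simp only: E_nth of_nat_mult_nth mult_zero_right)
  next
    case False
    then have "i + j = a" using F by (simp add: degree_class_def cong_def)
    then show ?thesis by (simp only: E_nth of_nat_mult_nth)
  qed
qed

lemma D0_mult: "D0 (F * G) = D0 F * G + F * D0 G" and E_mult: "E (F * G) = E F * G + F * E G"
  by (simp_all add: D0_def E_def vector_field_mult)

lemma V_add: "V (F + G) = V F + V G" and V_diff: "V (F - G) = V F - V G"
  and V_sum: "V (\<Sum>i\<in>I. K i) = (\<Sum>i\<in>I. V (K i))"
  by (simp_all add: V_def D0_def E_def vector_field_add vector_field_diff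
      vector_field_sum sum.distrib sum_distrib_left algebra_simps)

lemma V_scalar_mult: "V (scalar c * F) = scalar c * V F"
  by (simp only: V_def D0_def E_def vector_field_scalar_mult distrib_left mult.left_commute)

lemma homogeneous_\<alpha>: "degree_class 0 s \<alpha>"
  using r by (auto simp: degree_class_def \<alpha>_def linear_form_power_nth)

lemma homogeneous_\<alpha>_power: "degree_class 0 (l * s) (\<alpha> ^ l)"
  by (rule degree_class_power[OF homogeneous_\<alpha>])

lemma homogeneous_D0: "degree_class N a F \<Longrightarrow> degree_class N a (D0 F)"
  by (auto simp: degree_class_def D0_nth)

lemma homogeneous_f: "degree_class 0 s f"
  unfolding f_def by (intro degree_class_scalar_mult homogeneous_D0 homogeneous_\<alpha>)

lemma homogeneous_u: "degree_class 0 (p + q) u"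
  unfolding u_def using degree_class_monomial[of 0 q p] by (simp add: add.commute)

lemma degree_class_V: "degree_class s a F \<Longrightarrow> degree_class s a (V F)"
proof -
  assume F: "degree_class s a F"
  then have "degree_class s a (E F)" by (auto simp: degree_class_def E_nth)
  from degree_class_mult[OF degree_class_mod[OF homogeneous_f] this]
  have "degree_class s a (f * E F)" by (simp add: degree_class_def cong_def)
  then show ?thesis unfolding V_def by (intro degree_class_add homogeneous_D0 F)
qed

lemma vanishes_below_E: "vanishes_below e F \<Longrightarrow> vanishes_below e (E F)"
  by (auto simp: vanishes_below_def E_nth)

lemma vanishes_below_V: "vanishes_below e F \<Longrightarrow> vanishes_below e (V F)"
  unfolding V_def
  by (intro vanishes_below_add vanishes_below_mult_left vanishes_below_E)
     (auto simp: vanishes_below_def D0_nth)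

lemma V_nth:
  assumes "vanishes_below e F" "i + j = e"
  shows "V F $ i $ j = (of_nat p * of_nat i - of_nat q * of_nat j) * F $ i $ j"
proof -
  have "vanishes_below (s + e) (f * E F)"
    by (intro vanishes_below_mult vanishes_below_homogeneous[OF homogeneous_f] vanishes_below_E assms)
  then show ?thesis using s assms by (simp add: V_def D0_nth vanishes_below_def)
qed

lemma D0_\<alpha>: "D0 \<alpha> = - (of_nat s * f)"
proof -
  have "of_nat s * f = scalar (of_nat s * (- 1 / of_nat s)) * D0 \<alpha>"
    unfolding f_def scalar_mult scalar_of_nat by (simp only: mult.assoc)
  also have "of_nat s * (- 1 / of_nat s) = (- 1 :: 'a)" using s by simp
  finally show ?thesis by (simp flip: fps_const_neg)
qed

lemma D0_\<alpha>_power: "D0 (\<alpha> ^ l) = - (of_nat (l * s) * (\<alpha> ^ (l - 1) * f))"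
proof -
  have "D0 (\<alpha> ^ l) = of_nat l * \<alpha> ^ (l - 1) * D0 \<alpha>" by (simp add: D0_def vector_field_power)
  then show ?thesis unfolding D0_\<alpha> by (simp add: mult_ac)
qed

lemma D0_u: "D0 u = 0"
  by (rule fps2_eqI) (auto simp: D0_nth u_def monomial_nth)

subsection \<open>The first integral of the unperturbed system\<close>

definition h :: "nat \<Rightarrow> 'a" where "h l = (-1) ^ l * ((- \<kappa>) gchoose l)"

text \<open>\<open>first_integral (Suc L)\<close> is the truncation of \<open>u (1 - \<alpha>) powr (- \<kappa>)\<close> at \<open>\<alpha> ^ L\<close>.\<close>

definition first_integral :: "nat \<Rightarrow> 'a fps fps" where
  "first_integral L = (\<Sum>l<L. scalar (h l) * (u * \<alpha> ^ l))"

lemma h_Suc: "h (Suc l) * of_nat (Suc l * s) = h l * of_nat (p + q + l * s)"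
proof -
  have "h (Suc l) * of_nat (Suc l) = h l * (of_nat l + \<kappa>)"
    unfolding h_def gbinomial_sign_recurrence by simp
  then have "h (Suc l) * of_nat (Suc l * s) = h l * (of_nat l + \<kappa>) * of_nat s"
    by (simp only: of_nat_mult mult.assoc[symmetric])
  also have "\<dots> = h l * of_nat (p + q + l * s)"
    unfolding mult.assoc distrib_right \<kappa> by (simp add: add.commute)
  finally show ?thesis .
qed

lemma V_term: "V (u * \<alpha> ^ l) =
  of_nat (p + q + l * s) * (f * u * \<alpha> ^ l) - of_nat (l * s) * (f * u * \<alpha> ^ (l - 1))"
proof -
  have "E (u * \<alpha> ^ l) = of_nat (p + q + l * s) * (u * \<alpha> ^ l)"
    by (intro E_homogeneous degree_class_mult homogeneous_u homogeneous_\<alpha>_power)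
  then show ?thesis unfolding V_def D0_mult D0_u D0_\<alpha>_power by (simp add: algebra_simps)
qed

text \<open>The sum telescopes: by \<open>h_Suc\<close> the lower term produced by each summand
  cancels the upper term of its predecessor, and only the last upper term survives.\<close>

lemma V_first_integral:
  "V (first_integral (Suc L)) = scalar (h L * of_nat (p + q + L * s)) * (f * u * \<alpha> ^ L)"
proof (induction L)
  case 0
  show ?case using V_term[of 0]
    by (simp add: first_integral_def h_def scalar_of_nat del: of_nat_add)
next
  case (Suc L)
  have "V (first_integral (Suc (Suc L))) =
      V (first_integral (Suc L)) + scalar (h (Suc L)) * V (u * \<alpha> ^ Suc L)"
    unfolding first_integral_def sum.lessThan_Suc[of _ "Suc L"] V_add V_scalar_mult ..
  also have "\<dots> = scalar (h (Suc L) * of_nat (Suc L * s)) * (f * u * \<alpha> ^ L) +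
      (scalar (h (Suc L) * of_nat (p + q + Suc L * s)) * (f * u * \<alpha> ^ Suc L) -
       scalar (h (Suc L) * of_nat (Suc L * s)) * (f * u * \<alpha> ^ L))"
    unfolding Suc V_term h_Suc[of L, symmetric] scalar_mult scalar_of_nat diff_Suc_1
    by (simp only: right_diff_distrib mult.assoc)
  finally show ?case by simp
qed

lemma vanishes_below_V_first_integral: "vanishes_below (p + q + Suc L * s) (V (first_integral (Suc L)))"
proof -
  have "degree_class 0 (s + (p + q) + L * s) (f * u * \<alpha> ^ L)"
    by (intro degree_class_mult homogeneous_f homogeneous_u homogeneous_\<alpha>_power)
  then have "degree_class 0 (p + q + Suc L * s) (f * u * \<alpha> ^ L)" by (simp add: ac_simps)
  then show ?thesis unfolding V_first_integral
    by (rule vanishes_below_mult_left[OF vanishes_below_homogeneous])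
qed

subsection \<open>The obstructions to solving \<open>V G = F\<close>\<close>

text \<open>Coefficients of (1 - z) to the power m + \<kappa> - 1. A power c of 1 - \<alpha> solves
  the adjoint equation in degree \<open>p + q + m * s\<close> exactly when s (1 + c) equals that
  degree.\<close>

definition \<omega> :: "nat \<Rightarrow> nat \<Rightarrow> 'a" where
  "\<omega> m j = (-1) ^ j * ((of_nat m + \<kappa> - 1) gchoose j)"

definition weight :: "nat \<Rightarrow> nat \<Rightarrow> 'a fps fps" where
  "weight m t = (\<Sum>j\<le>t. scalar (\<omega> m j) * \<alpha> ^ j)"

lemma \<omega>_Suc: "\<omega> m (Suc t) * of_nat (Suc t * s) + \<omega> m t * (of_nat (p + q + m * s) - of_nat (Suc t * s)) = 0"
proof -
  have "\<omega> m (Suc t) * of_nat (Suc t) = \<omega> m t * (of_nat t - (of_nat m + \<kappa> - 1))"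
    unfolding \<omega>_def by (rule gbinomial_sign_recurrence)
  then have "\<omega> m (Suc t) * of_nat (Suc t * s) = \<omega> m t * ((of_nat t - (of_nat m + \<kappa> - 1)) * of_nat s)"
    by (simp only: of_nat_mult mult.assoc[symmetric])
  also have "(of_nat t - (of_nat m + \<kappa> - 1)) * of_nat s = of_nat (Suc t * s) - of_nat (p + q + m * s)"
    using \<kappa> by (simp add: algebra_simps)
  finally show ?thesis by (simp add: algebra_simps)
qed

text \<open>
  For \<open>t = m\<close> the truncated power \<open>weight m t\<close> of \<open>1 - \<alpha>\<close> is, up to high order, an integrating factor:
  the left hand side is the formal adjoint of \<open>V\<close> applied to \<open>weight m t\<close> times a resonant monomial.
\<close>
lemma adjoint_weight:
  "of_nat (p + q + m * s) * (weight m t * f) - D0 (weight m t) - E (weight m t * f) =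
   scalar (\<omega> m t * (of_nat (p + q + m * s) - of_nat (Suc t * s))) * (f * \<alpha> ^ t)"
proof (induction t)
  case 0
  have "weight m 0 = 1" "D0 1 = 0" "\<omega> m 0 = 1" by (simp_all add: weight_def \<omega>_def D0_def)
  then show ?case
    by (simp only: E_homogeneous[OF homogeneous_f] scalar_diff scalar_of_nat mult_1_left mult_1_right
        power_0 diff_0_right left_diff_distrib One_nat_def[symmetric])
next
  case (Suc t)
  let ?c = "\<omega> m (Suc t)"
  have w: "weight m (Suc t) = weight m t + scalar ?c * \<alpha> ^ Suc t" by (simp add: weight_def)
  have "degree_class 0 (Suc t * s + s) (\<alpha> ^ Suc t * f)"
    by (intro degree_class_mult homogeneous_f homogeneous_\<alpha>_power)
  then have "E (\<alpha> ^ Suc t * f) = of_nat (Suc (Suc t) * s) * (\<alpha> ^ Suc t * f)"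
    using E_homogeneous by (metis add.commute mult_Suc)
  then have E: "E (weight m (Suc t) * f) = E (weight m t * f) + scalar ?c * (of_nat (Suc (Suc t) * s) * (\<alpha> ^ Suc t * f))"
    unfolding w distrib_right mult.assoc by (simp add: E_def vector_field_add vector_field_scalar_mult del: fps_const_mult)
  have D: "D0 (weight m (Suc t)) = D0 (weight m t) - scalar ?c * (of_nat (Suc t * s) * (\<alpha> ^ t * f))"
    unfolding w using D0_\<alpha>_power[of "Suc t"]
    by (simp add: D0_def vector_field_add vector_field_scalar_mult del: fps_const_mult)
  have "of_nat (p + q + m * s) * (weight m (Suc t) * f) - D0 (weight m (Suc t)) - E (weight m (Suc t) * f) =
     (of_nat (p + q + m * s) * (weight m t * f) - D0 (weight m t) - E (weight m t * f)) +
     scalar (?c * of_nat (Suc t * s)) * (f * \<alpha> ^ t) +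
     scalar (?c * (of_nat (p + q + m * s) - of_nat (Suc (Suc t) * s))) * (f * \<alpha> ^ Suc t)"
    unfolding D E unfolding w scalar_mult scalar_diff scalar_of_nat
    by (simp add: algebra_simps del: fps_const_mult fps_const_sub of_nat_add of_nat_mult of_nat_Suc)
  also have "\<dots> = scalar (?c * of_nat (Suc t * s) + \<omega> m t * (of_nat (p + q + m * s) - of_nat (Suc t * s))) * (f * \<alpha> ^ t)
     + scalar (?c * (of_nat (p + q + m * s) - of_nat (Suc (Suc t) * s))) * (f * \<alpha> ^ Suc t)"
    unfolding Suc scalar_add by (simp only: distrib_right add_ac)
  finally show ?case unfolding \<omega>_Suc by simp
qed

text \<open>\<open>\<Phi> J F\<close> is, up to high order, the coefficient of the \<open>J\<close>-th resonant monomial of \<open>F\<close> in the coordinates that linearize \<open>V\<close>.\<close>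

definition \<Phi> :: "nat \<Rightarrow> 'a fps fps \<Rightarrow> 'a" where
  "\<Phi> J F = (weight (J * m1) (J * m1) * F) $ (q * (J * k1 + 1)) $ (p * (J * k1 + 1))"

lemma resonant_degree: "q * (J * k1 + 1) + p * (J * k1 + 1) = p + q + J * m1 * s"
proof -
  have "q * (J * k1 + 1) + p * (J * k1 + 1) = p + q + J * ((p + q) * k1)" by (simp add: algebra_simps)
  then show ?thesis unfolding ratio by (simp add: mult_ac)
qed

lemma \<Phi>_diff: "\<Phi> J (F - G) = \<Phi> J F - \<Phi> J G"
  by (simp add: \<Phi>_def right_diff_distrib)

lemma \<Phi>_scalar_mult: "\<Phi> J (scalar c * F) = c * \<Phi> J F"
  unfolding \<Phi>_def by (subst mult.left_commute) simp

lemma \<Phi>_sum: "\<Phi> J (\<Sum>i\<in>I. F i) = (\<Sum>i\<in>I. \<Phi> J (F i))"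
  unfolding \<Phi>_def sum_distrib_left fps_sum_nth ..

text \<open>At the resonant place \<open>D0\<close> contributes 0 and \<open>E\<close> contributes
  the degree, so moving \<open>V\<close> onto the weight leaves the adjoint expression of
  \<open>adjoint_weight\<close>. Its truncation error starts in degree \<open>(m + 1) * s\<close>,
  beyond the resonant degree \<open>p + q + m * s\<close> because \<open>p + q < s\<close>.\<close>

lemma \<Phi>_V: "\<Phi> J (V G) = 0"
proof -
  define m where "m = J * m1"
  let ?W = "weight m m" and ?A = "q * (J * k1 + 1)" and ?B = "p * (J * k1 + 1)"
  let ?Z = "of_nat (p + q + m * s) * (?W * f) - D0 ?W - E (?W * f)"
  have AB: "?A + ?B = p + q + m * s" unfolding m_def by (rule resonant_degree)
  have eq: "?W * V G = D0 (?W * G) + E (?W * f * G) - of_nat (p + q + m * s) * (?W * f * G) + ?Z * G"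
    unfolding V_def D0_mult E_mult by (simp add: algebra_simps)
  have "(D0 (?W * G)) $ ?A $ ?B = 0" unfolding D0_nth by (simp add: algebra_simps)
  moreover have "E (?W * f * G) $ ?A $ ?B = (of_nat (p + q + m * s) * (?W * f * G)) $ ?A $ ?B"
    unfolding E_nth AB of_nat_mult_nth ..
  moreover have "(?Z * G) $ ?A $ ?B = 0"
  proof -
    have "degree_class 0 (s + m * s) (f * \<alpha> ^ m)"
      by (intro degree_class_mult homogeneous_f homogeneous_\<alpha>_power)
    then have "vanishes_below (s + m * s) (?Z * G)"
      unfolding adjoint_weight
      by (intro vanishes_below_mult_right vanishes_below_mult_left vanishes_below_homogeneous)
    moreover have "?A + ?B < s + m * s" unfolding AB using large by simp
    ultimately show ?thesis unfolding vanishes_below_def by blast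
  qed
  ultimately have "(?W * V G) $ ?A $ ?B = 0" unfolding eq by simp
  then show ?thesis by (simp add: \<Phi>_def m_def)
qed

lemma \<Phi>_leading:
  assumes "vanishes_below (p + q + J * m1 * s) F"
  shows "\<Phi> J F = F $ (q * (J * k1 + 1)) $ (p * (J * k1 + 1))"
proof -
  let ?W = "weight (J * m1) (J * m1)"
  have "(?W * F - F) = (\<Sum>j\<in>{..J * m1} - {0}. scalar (\<omega> (J * m1) j) * \<alpha> ^ j) * F"
    unfolding weight_def by (subst sum.remove[of _ 0]) (auto simp: \<omega>_def algebra_simps)
  moreover have "vanishes_below (1 + (p + q + J * m1 * s)) \<dots>"
  proof (intro vanishes_below_mult vanishes_below_sum vanishes_below_mult_left assms)
    fix j assume "j \<in> {..J * m1} - {0}"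
    then have "1 \<le> j * s" using s by (cases j) auto
    then show "vanishes_below 1 (\<alpha> ^ j)"
      using vanishes_below_homogeneous[OF homogeneous_\<alpha>_power] by (rule vanishes_below_mono[rotated])
  qed
  ultimately have "vanishes_below (Suc (p + q + J * m1 * s)) (?W * F - F)" by simp
  then have "(?W * F - F) $ (q * (J * k1 + 1)) $ (p * (J * k1 + 1)) = 0"
    unfolding vanishes_below_def resonant_degree by (metis lessI resonant_degree)
  then show ?thesis by (simp add: \<Phi>_def)
qed

text \<open>Degree by degree, the remainder is divided by the eigenvalue of the linear part. At a
  resonant monomial its coefficient equals \<open>\<Phi> J\<close> of the remainder by
  \<open>\<Phi>_leading\<close>, hence \<open>\<Phi> J F\<close> by \<open>\<Phi>_V\<close>, which
  is 0. The class modulo \<open>s\<close> leaves no other resonant monomials.\<close>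

lemma solve_modulo_obstructions:
  assumes F_class: "degree_class s (p + q) F" and low: "vanishes_below (Suc (p + q)) F"
    and \<Phi>: "\<And>J. J \<in> {1..s + 2} \<Longrightarrow> \<Phi> J F = 0"
  shows "\<exists>G. degree_class s (p + q) G \<and> vanishes_below (Suc (p + q)) G \<and>
    vanishes_below (Suc (p + q + (s + 2) * m1 * s)) (F - V G)"
proof -
  let ?P = "\<lambda>e G. degree_class s (p + q) G \<and> vanishes_below (Suc (p + q)) G \<and> vanishes_below e (F - V G)"
  have V0: "V 0 = 0" using V_diff[of 0 0] by simp
  have "e \<le> Suc (p + q + (s + 2) * m1 * s) \<Longrightarrow> \<exists>G. ?P e G" if "Suc (p + q) \<le> e" for e
    using that
  proof (induction e rule: dec_induct)
    case base
    show ?case using low by (intro exI[of _ 0]) (simp add: V0 degree_class_0)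
  next
    case (step e)
    then obtain G where G: "?P e G" by auto
    define F' where "F' = F - V G"
    have F': "degree_class s (p + q) F'" "vanishes_below e F'"
      using G F_class by (auto simp: F'_def intro: degree_class_diff degree_class_V)
    define K where "K = Abs_fps (\<lambda>i. Abs_fps (\<lambda>j. if i + j = e then
      F' $ i $ j / (of_nat p * of_nat i - of_nat q * of_nat j) else 0))"
    have K_nth: "K $ i $ j = (if i + j = e then
      F' $ i $ j / (of_nat p * of_nat i - of_nat q * of_nat j) else 0)" for i j
      by (simp add: K_def)
    have K: "degree_class s (p + q) K" "vanishes_below e K"
      using F'(1) by (auto simp: degree_class_def vanishes_below_def K_nth split: if_splits)
    have "(F' - V K) $ i $ j = 0" if ij: "i + j = e" for i j
    proof (cases "of_nat p * of_nat i - of_nat q * of_nat j = (0 :: 'a)")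
      case False
      then show ?thesis using V_nth[OF K(2) ij] ij by (simp add: K_nth)
    next
      case True
      have "F' $ i $ j = 0"
      proof (rule ccontr)
        assume nz: "F' $ i $ j \<noteq> 0"
        have "of_nat (p * i) = (of_nat (q * j) :: 'a)" using True by simp
        then have eq: "p * i = q * j" by (simp only: of_nat_eq_iff)
        then have "q dvd i" using coprime by (metis coprime_commute coprime_dvd_mult_right_iff dvd_triv_left)
        then obtain k where k: "i = q * k" by (elim dvdE)
        then have k': "j = p * k" using eq q by (simp add: mult.left_commute)
        have e_k: "e = (p + q) * k" using ij k k' by (simp add: algebra_simps)
        have "k \<noteq> 0" using step(1) e_k by (intro notI) simp
        then obtain k' where k_eq: "k = Suc k'" by (cases k) auto
        have "[e = p + q] (mod s)" using F'(1) nz ij by (auto simp: degree_class_def)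
        then have "[e - (p + q) = 0] (mod s)"
          using step(1) by (simp add: cong_altdef_nat' cong_0_iff)
        \<comment> \<open>With \<open>ratio\<close> and the coprimality of \<open>k1\<close> and
          \<open>m1\<close>, this divisibility yields \<open>k' = J * k1\<close>.\<close>
        then have "s dvd (p + q) * k'" using e_k k_eq by (simp add: cong_0_iff)
        then obtain l where l: "(p + q) * k' = s * l" by (elim dvdE)
        have "s * (l * k1) = (p + q) * k1 * k'" using l by (simp add: mult_ac)
        also have "\<dots> = s * (m1 * k')" unfolding ratio by (simp add: mult_ac)
        finally have lk: "l * k1 = m1 * k'" using s by simp
        then have "m1 dvd l" using coprime_k1_m1
          by (metis coprime_commute coprime_dvd_mult_left_iff dvd_triv_left)
        then obtain J where J: "l = m1 * J" by (elim dvdE)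
        then have kJ: "k' = J * k1" using lk m1 by (simp add: mult_ac)
        have eJ: "e = p + q + J * m1 * s" using l J e_k k_eq by (simp add: mult_ac)
        have "J \<noteq> 0" using eJ step(1) by (intro notI) simp
        moreover have "p + q + J * m1 * s \<le> p + q + (s + 2) * m1 * s" using eJ step.prems by linarith
        then have "J * (m1 * s) \<le> (s + 2) * (m1 * s)" by (simp only: nat_add_left_cancel_le mult.assoc)
        then have "0 < m1 * s \<longrightarrow> J \<le> s + 2" by (simp only: mult_le_cancel2)
        then have "J \<le> s + 2" using m1 s by simp
        ultimately have "\<Phi> J F' = 0" using \<Phi>[of J] by (simp add: F'_def \<Phi>_diff \<Phi>_V)
        moreover have "\<Phi> J F' = F' $ i $ j"
          using \<Phi>_leading[of J F'] F'(2) eJ k k' k_eq kJ by simp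
        ultimately show False using nz by simp
      qed
      then show ?thesis using V_nth[OF K(2) ij] True by simp
    qed
    then have "vanishes_below (Suc e) (F' - V K)"
      using vanishes_below_diff[OF F'(2) vanishes_below_V[OF K(2)]]
      unfolding vanishes_below_def less_Suc_eq by blast
    then have "?P (Suc e) (G + K)"
      using G K step(1) by (auto simp: F'_def V_add algebra_simps intro: degree_class_add
          vanishes_below_add vanishes_below_mono[OF K(2)])
    then show ?case by blast
  qed
  from this[of "Suc (p + q + (s + 2) * m1 * s)"] show ?thesis by simp
qed

subsection \<open>The perturbations\<close>

text \<open>There are \<open>s + 3\<close> perturbations for \<open>s + 2\<close> obstructions,
  since all columns of the matrix, as polynomials in \<open>J\<close>, vanish at 0. The minus sign
  lets the factor \<open>\<kappa> * (i - 1) - p\<close> be the same formula for the perturbation of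
  x' as for those of y'.\<close>

definition field_x :: "nat \<Rightarrow> 'a fps fps" where
  "field_x i = (if i \<le> s + 1 then 0 else - (var_x ^ 0 * var_y ^ (s + 1)))"

definition field_y :: "nat \<Rightarrow> 'a fps fps" where
  "field_y i = (if i \<le> s + 1 then var_x ^ (s + 1 - i) * var_y ^ i else 0)"

definition \<Delta> :: "nat \<Rightarrow> 'a fps fps \<Rightarrow> 'a fps fps" where
  "\<Delta> i = vector_field (field_x i) (field_y i)"

lemma homogeneous_field: "degree_class 0 (Suc s) (field_x i)" "degree_class 0 (Suc s) (field_y i)"
proof -
  have "degree_class 0 (Suc s) (- (var_x ^ 0 * var_y ^ (s + 1)) :: 'a fps fps)"
    using degree_class_monomial[of 0 0 "s + 1", where ?'a = 'a] by (simp add: degree_class_def)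
  then show "degree_class 0 (Suc s) (field_x i)" by (simp add: field_x_def degree_class_0)
  show "degree_class 0 (Suc s) (field_y i)"
  proof (cases "i \<le> s + 1")
    case True
    then have "s + 1 - i + i = Suc s" by simp
    then show ?thesis using True degree_class_monomial[of 0 "s + 1 - i" i, where ?'a = 'a]
      by (simp only: field_y_def if_True)
  qed (simp add: field_y_def degree_class_0)
qed

lemma degree_class_\<Delta>: "degree_class s a F \<Longrightarrow> degree_class s a (\<Delta> i F)"
  using degree_class_vector_field[OF homogeneous_field[THEN degree_class_mod], of s a F i i]
  by (simp add: \<Delta>_def degree_class_def cong_def)

lemma homogeneous_\<Delta>: "degree_class 0 a F \<Longrightarrow> degree_class 0 (a + s) (\<Delta> i F)"
  using degree_class_vector_field[OF homogeneous_field, of a F i i] by (simp add: \<Delta>_def)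

lemma vanishes_below_\<Delta>: "vanishes_below a F \<Longrightarrow> vanishes_below (a + s) (\<Delta> i F)"
  unfolding \<Delta>_def
  by (rule vanishes_below_vector_field[OF homogeneous_field[THEN vanishes_below_homogeneous]])

lemma \<Delta>_mult: "\<Delta> i (F * G) = \<Delta> i F * G + F * \<Delta> i G"
  and \<Delta>_power: "\<Delta> i (F ^ k) = of_nat k * F ^ (k - 1) * \<Delta> i F"
  and \<Delta>_scalar_mult: "\<Delta> i (scalar c * F) = scalar c * \<Delta> i F"
  and \<Delta>_sum: "\<Delta> i (\<Sum>j\<in>I. K j) = (\<Sum>j\<in>I. \<Delta> i (K j))"
  unfolding \<Delta>_def by (rule vector_field_mult vector_field_power vector_field_scalar_mult vector_field_sum)+

text \<open>Coefficients of \<open>(1 - z) powr (M + \<kappa>) * (1 - z) powr (- \<kappa>)\<close> and of its analogue with the second factor differentiated.\<close>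

lemma weight_convolution:
  "(\<Sum>l=0..M. \<omega> (Suc M) (M - l) * h l) = (-1) ^ M"
  "M \<ge> 1 \<Longrightarrow> (\<Sum>l=0..M. of_nat l * (\<omega> (Suc M) (M - l) * h l)) = - (\<kappa> * (-1) ^ M)"
proof -
  let ?a = "- \<kappa>" and ?b = "of_nat M + \<kappa>"
  have product: "\<omega> (Suc M) (M - l) * h l = (-1) ^ M * ((?a gchoose l) * (?b gchoose (M - l)))"
    if "l \<in> {0..M}" for l
  proof -
    have "(-1) ^ (M - l) * (-1) ^ l = ((-1) ^ M :: 'a)" using that by (simp flip: power_add)
    then show ?thesis by (simp add: \<omega>_def h_def mult_ac)
  qed
  have one: "(of_nat N gchoose N) = (1 :: 'a)" for N by (simp flip: binomial_gbinomial)
  have "(\<Sum>l=0..M. \<omega> (Suc M) (M - l) * h l) =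
      (-1) ^ M * (\<Sum>l=0..M. (?a gchoose l) * (?b gchoose (M - l)))"
    unfolding sum_distrib_left by (intro sum.cong refl product)
  also have "\<dots> = (-1) ^ M" unfolding gbinomial_Vandermonde by (simp add: one)
  finally show "(\<Sum>l=0..M. \<omega> (Suc M) (M - l) * h l) = (-1) ^ M" .
  assume "M \<ge> 1"
  then obtain N where M: "M = Suc N" by (cases M) auto
  have "(\<Sum>l=0..M. of_nat l * (\<omega> (Suc M) (M - l) * h l)) =
      (-1) ^ M * (\<Sum>l=0..M. of_nat l * ((?a gchoose l) * (?b gchoose (M - l))))"
    unfolding sum_distrib_left by (intro sum.cong refl) (simp only: product mult.left_commute)
  also have "(\<Sum>l=0..M. of_nat l * ((?a gchoose l) * (?b gchoose (M - l)))) =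
      (\<Sum>l=0..N. of_nat (Suc l) * (?a gchoose Suc l) * (?b gchoose (N - l)))"
    unfolding M by (subst sum.atLeast0_atMost_Suc_shift) (simp add: mult.assoc)
  also have "\<dots> = ?a * (\<Sum>l=0..N. ((?a - 1) gchoose l) * (?b gchoose (N - l)))"
    unfolding gbinomial_absorption sum_distrib_left by (simp add: mult.assoc)
  also have "(\<Sum>l=0..N. ((?a - 1) gchoose l) * (?b gchoose (N - l))) = 1"
    unfolding gbinomial_Vandermonde using one[of N] by (simp add: M)
  finally show "(\<Sum>l=0..M. of_nat l * (\<omega> (Suc M) (M - l) * h l)) = - (\<kappa> * (-1) ^ M)" by simp
qed

text \<open>The truncation is long enough that \<open>V H0\<close> starts above degree
  \<open>p + q + (s + 2) * m1 * s\<close>, that of the last resonant monomial considered.\<close>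

definition H0 :: "'a fps fps" where "H0 = first_integral (Suc ((s + 2) * m1))"

text \<open>By homogeneity only the products of \<alpha>^j with the derivative of u \<alpha>^l for j
  + l = M reach the resonant place. The product rule splits them into one part independent of l and
  one proportional to l; \<open>weight_convolution\<close> evaluates the two remaining sums.\<close>

lemma \<Phi>_\<Delta>_H0:
  assumes J: "J \<in> {1..s + 2}" and M: "J * m1 = Suc M"
  shows "\<Phi> J (\<Delta> i H0) = (-1) ^ M *
    ((\<Delta> i u * \<alpha> ^ M) $ (q * (J * k1 + 1)) $ (p * (J * k1 + 1)) -
     (if M = 0 then 0 else \<kappa> * (u * \<alpha> ^ (M - 1) * \<Delta> i \<alpha>) $ (q * (J * k1 + 1)) $ (p * (J * k1 + 1))))"
proof -
  let ?A = "q * (J * k1 + 1)" and ?B = "p * (J * k1 + 1)" and ?L = "Suc ((s + 2) * m1)"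
  define g where "g j l = \<omega> (Suc M) j * h l * (\<alpha> ^ j * \<Delta> i (u * \<alpha> ^ l)) $ ?A $ ?B" for j l
  define a where "a = (\<Delta> i u * \<alpha> ^ M) $ ?A $ ?B"
  define b where "b = (u * \<alpha> ^ (M - 1) * \<Delta> i \<alpha>) $ ?A $ ?B"
  have AB: "?A + ?B = p + q + Suc M * s" using resonant_degree[of J] by (simp add: M)
  have "J * m1 \<le> (s + 2) * m1" using J by (intro mult_right_mono) auto
  then have L: "M < ?L" using M by simp
  have "g j l = 0" if "j + l \<noteq> M" for j l
  proof -
    have "degree_class 0 (j * s + (p + q + l * s + s)) (\<alpha> ^ j * \<Delta> i (u * \<alpha> ^ l))"
      by (intro degree_class_mult homogeneous_\<alpha>_power homogeneous_\<Delta> homogeneous_u)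
    moreover have "j * s + (p + q + l * s + s) \<noteq> ?A + ?B"
    proof
      assume "j * s + (p + q + l * s + s) = ?A + ?B"
      then have "(j + l) * s = M * s" unfolding AB by (simp add: algebra_simps)
      with that s show False by simp
    qed
    ultimately have "(\<alpha> ^ j * \<Delta> i (u * \<alpha> ^ l)) $ ?A $ ?B = 0"
      unfolding degree_class_def cong_def by (metis mod_by_0)
    then show ?thesis by (simp only: g_def mult_zero_right)
  qed
  then have "(\<Sum>j\<le>Suc M. \<Sum>l<?L. g j l) = (\<Sum>l=0..M. g (M - l) l)"
    using L by (intro sum_antidiagonal) auto
  moreover have "\<Phi> J (\<Delta> i H0) = (\<Sum>j\<le>Suc M. \<Sum>l<?L. g j l)"
  proof -
    have "weight (Suc M) (Suc M) * \<Delta> i H0 =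
        (\<Sum>j\<le>Suc M. \<Sum>l<?L. scalar (\<omega> (Suc M) j * h l) * (\<alpha> ^ j * \<Delta> i (u * \<alpha> ^ l)))"
      unfolding weight_def H0_def first_integral_def \<Delta>_sum \<Delta>_scalar_mult sum_product scalar_mult
      by (simp only: mult_ac)
    then show ?thesis
      unfolding \<Phi>_def M by (simp only: fps_sum_nth scalar_mult_nth g_def)
  qed
  moreover have "g (M - l) l = a * (\<omega> (Suc M) (M - l) * h l) + b * (of_nat l * (\<omega> (Suc M) (M - l) * h l))"
    if "l \<in> {0..M}" for l
  proof -
    have "\<alpha> ^ (M - l) * \<Delta> i (u * \<alpha> ^ l) = \<Delta> i u * \<alpha> ^ M + of_nat l * (u * \<alpha> ^ (M - 1) * \<Delta> i \<alpha>)"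
    proof (cases l)
      case 0
      then show ?thesis by (simp add: mult.commute)
    next
      case (Suc l')
      have "\<alpha> ^ (M - l) * \<alpha> ^ l = \<alpha> ^ M" "\<alpha> ^ (M - l) * \<alpha> ^ (l - 1) = \<alpha> ^ (M - 1)"
        using power_add[of \<alpha> "M - l" l] power_add[of \<alpha> "M - l" "l - 1"] that Suc
        by (simp_all del: power_Suc)
      moreover have "\<alpha> ^ (M - l) * \<Delta> i (u * \<alpha> ^ l) = \<Delta> i u * (\<alpha> ^ (M - l) * \<alpha> ^ l) +
          of_nat l * (u * (\<alpha> ^ (M - l) * \<alpha> ^ (l - 1)) * \<Delta> i \<alpha>)"
        unfolding \<Delta>_mult \<Delta>_power by (simp only: distrib_left mult_ac)
      ultimately show ?thesis by simp
    qed
    then show ?thesis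
      unfolding g_def by (simp only: fps_add_nth of_nat_mult_nth a_def b_def) (simp only: distrib_left mult_ac)
  qed
  ultimately have "\<Phi> J (\<Delta> i H0) = a * (\<Sum>l=0..M. \<omega> (Suc M) (M - l) * h l) +
      b * (\<Sum>l=0..M. of_nat l * (\<omega> (Suc M) (M - l) * h l))"
    by (simp add: sum.distrib sum_distrib_left)
  also have "\<dots> = (-1) ^ M * (a - (if M = 0 then 0 else \<kappa> * b))"
    using weight_convolution(2)[of M] unfolding weight_convolution(1) by (cases M) (simp_all add: algebra_simps)
  finally show ?thesis unfolding a_def b_def .
qed

lemma \<alpha>_power_nth:
  "\<alpha> ^ M $ i $ j = (if i + j = M * s then of_nat (r * M choose j) else 0)"
proof -
  have "\<alpha> ^ M = var_x ^ ((s - r) * M) * (var_x + var_y) ^ (r * M)"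
    by (simp add: \<alpha>_def power_mult_distrib power_mult)
  moreover have "(s - r) * M + r * M = M * s" using r by (simp flip: add_mult_distrib)
  ultimately show ?thesis by (simp only: linear_form_power_nth)
qed

text \<open>The one-variable form of \<open>\<Phi>_\<Delta>_H0\<close>; multiplying by \<open>M\<close> turns \<open>\<alpha> ^ (M - 1) * \<Delta> i \<alpha>\<close> into \<open>\<Delta> i (\<alpha> ^ M)\<close>.\<close>

lemma resonant_nth:
  assumes J: "J \<in> {1..s + 2}" and M: "J * m1 = Suc M" and i: "i \<le> s + 2"
  shows "(\<Delta> i u * \<alpha> ^ M) $ (q * (J * k1 + 1)) $ (p * (J * k1 + 1)) =
      (if i \<le> s + 1 then of_nat p else - of_nat q) * of_nat (coefficient J i)"
    and "(u * \<Delta> i (\<alpha> ^ M)) $ (q * (J * k1 + 1)) $ (p * (J * k1 + 1)) =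
      (if i \<le> s + 1 then of_nat (p * k1 * J + 1) - of_nat i else - of_nat (q * k1 * J + 1)) *
        of_nat (coefficient J i)"
proof -
  let ?A = "q * (J * k1 + 1)" and ?B = "p * (J * k1 + 1)"
  define a where "a = q * k1 * J"
  define b where "b = p * k1 * J"
  have A: "?A = q + a" and B: "?B = p + b" by (simp_all add: a_def b_def algebra_simps)
  have coeff: "coefficient J i = (if i \<le> b + 1 then r * M choose (b + 1 - i) else 0)"
    using M by (simp add: coefficient_def b_def)
  have deg: "a + b = M * s + s"
  proof -
    have "a + b = (p + q) * k1 * J" by (simp add: a_def b_def algebra_simps)
    also have "\<dots> = s * (J * m1)" unfolding ratio by (simp add: mult_ac)
    finally show ?thesis unfolding M by (simp add: algebra_simps)
  qed
  have rMs: "r * M \<le> M * s" using r by simp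
  have deriv_u: "deriv_x u = of_nat q * (var_x ^ (q - 1) * var_y ^ p)"
    "deriv_y u = of_nat p * (var_x ^ q * var_y ^ (p - 1))"
  proof -
    show "deriv_x u = of_nat q * (var_x ^ (q - 1) * var_y ^ p)"
      using q by (intro fps2_eqI) (auto simp: u_def monomial_nth)
    show "deriv_y u = of_nat p * (var_x ^ q * var_y ^ (p - 1))"
      using p by (intro fps2_eqI) (auto simp: u_def monomial_nth)
  qed
  have "(\<Delta> i u * \<alpha> ^ M) $ (q + a) $ (p + b) =
      (if i \<le> s + 1 then of_nat p else - of_nat q) * of_nat (coefficient J i) \<and>
    (u * \<Delta> i (\<alpha> ^ M)) $ (q + a) $ (p + b) =
      (if i \<le> s + 1 then of_nat (b + 1) - of_nat i else - of_nat (a + 1)) *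
        of_nat (coefficient J i)"
  proof (cases "i \<le> s + 1")
    case True
    define d where "d = s + 1 - i"
    have fields: "field_x i = 0" "field_y i = var_x ^ d * var_y ^ i"
      using True by (simp_all add: field_x_def field_y_def d_def)
    have 1: "\<Delta> i u * \<alpha> ^ M = of_nat p * (var_x ^ (q + d) * var_y ^ (p - 1 + i) * \<alpha> ^ M)"
      by (simp add: \<Delta>_def vector_field_def fields deriv_u power_add mult_ac)
    have 2: "u * \<Delta> i (\<alpha> ^ M) = var_x ^ (q + d) * var_y ^ (p + i) * deriv_y (\<alpha> ^ M)"
      by (simp add: \<Delta>_def vector_field_def fields u_def power_add mult_ac)
    \<comment> \<open>If the perturbation carries too many factors \<open>x\<close> to contribute,
      the binomial coefficient agrees: its lower index exceeds \<open>r * M\<close>.\<close>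
    have big: "r * M choose (b + 1 - i) = 0" if "a < d"
    proof (rule binomial_eq_0)
      show "r * M < b + 1 - i" using that deg rMs True unfolding d_def by linarith
    qed
    have "(var_x ^ (q + d) * var_y ^ (p - 1 + i) * \<alpha> ^ M) $ (q + a) $ (p + b) =
        of_nat (coefficient J i)"
    proof (cases "i \<le> b + 1 \<and> d \<le> a")
      case True
      then have "p + b - (p - 1 + i) = b + 1 - i" "q + a - (q + d) + (b + 1 - i) = M * s"
          "q + d \<le> q + a \<and> p - 1 + i \<le> p + b" "i \<le> b + 1"
        using p deg \<open>i \<le> s + 1\<close> by (auto simp: d_def)
      then show ?thesis
        unfolding monomial_mult_nth \<alpha>_power_nth coeff by (simp only: if_True simp_thms)
    next
      case False
      then show ?thesis using p big unfolding monomial_mult_nth coeff by auto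
    qed
    moreover have "(var_x ^ (q + d) * var_y ^ (p + i) * deriv_y (\<alpha> ^ M)) $ (q + a) $ (p + b) =
        (of_nat (b + 1) - of_nat i) * of_nat (coefficient J i)"
    proof (cases "i \<le> b \<and> d \<le> a")
      case True
      then have "Suc (b - i) = b + 1 - i" "a - d + (b + 1 - i) = M * s"
        using deg \<open>i \<le> s + 1\<close> by (auto simp: d_def)
      moreover have "of_nat (b + 1) - of_nat i = (of_nat (b + 1 - i) :: 'a)"
        using True by (simp add: of_nat_diff)
      ultimately show ?thesis using True
        unfolding monomial_mult_nth deriv_y_nth \<alpha>_power_nth coeff by simp
    next
      case False
      then have "i = b + 1 \<or> coefficient J i = 0" using big unfolding coeff by auto
      then show ?thesis using False unfolding monomial_mult_nth by auto
    qed
    ultimately show ?thesis unfolding 1 2 of_nat_mult_nth using True by simp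
  next
    case False
    then have i_eq: "i = s + 2" using i by simp
    have coeff': "coefficient J i = (if s + 1 \<le> b then r * M choose (b - (s + 1)) else 0)"
      unfolding coeff by (simp add: i_eq)
    have fields: "field_x i = - (var_y ^ (s + 1))" "field_y i = 0"
      using False by (simp_all add: field_x_def field_y_def)
    have 1: "\<Delta> i u * \<alpha> ^ M = - (of_nat q * (var_x ^ (q - 1) * var_y ^ (p + (s + 1)) * \<alpha> ^ M))"
      by (simp add: \<Delta>_def vector_field_def fields deriv_u power_add mult_ac)
    have 2: "u * \<Delta> i (\<alpha> ^ M) = - (var_x ^ q * var_y ^ (p + (s + 1)) * deriv_x (\<alpha> ^ M))"
      by (simp add: \<Delta>_def vector_field_def fields u_def power_add mult_ac)
    have "(var_x ^ (q - 1) * var_y ^ (p + (s + 1)) * \<alpha> ^ M) $ (q + a) $ (p + b) =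
        of_nat (coefficient J i)"
    proof (cases "s + 1 \<le> b")
      case True
      then have "q + a - (q - 1) + (p + b - (p + (s + 1))) = M * s" "q - 1 \<le> q + a \<and> p + (s + 1) \<le> p + b"
        "p + b - (p + (s + 1)) = b - (s + 1)"
        using q deg by auto
      then show ?thesis using True
        unfolding monomial_mult_nth \<alpha>_power_nth coeff' by (simp only: if_True simp_thms)
    qed (unfold monomial_mult_nth coeff', simp)
    moreover have "(var_x ^ q * var_y ^ (p + (s + 1)) * deriv_x (\<alpha> ^ M)) $ (q + a) $ (p + b) =
        of_nat (a + 1) * of_nat (coefficient J i)"
    proof (cases "s + 1 \<le> b")
      case True
      then have "Suc (q + a - q) + (p + b - (p + (s + 1))) = M * s" "q \<le> q + a \<and> p + (s + 1) \<le> p + b"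
        "p + b - (p + (s + 1)) = b - (s + 1)" "Suc (q + a - q) = a + 1"
        using deg by auto
      then show ?thesis using True
        unfolding monomial_mult_nth deriv_x_nth \<alpha>_power_nth coeff' by (simp only: if_True simp_thms)
    qed (unfold monomial_mult_nth coeff', simp)
    ultimately show ?thesis unfolding 1 2 fps_neg_nth of_nat_mult_nth using False
      by (simp only: if_False mult_minus_left simp_thms)
  qed
  then show "(\<Delta> i u * \<alpha> ^ M) $ ?A $ ?B =
      (if i \<le> s + 1 then of_nat p else - of_nat q) * of_nat (coefficient J i)"
    "(u * \<Delta> i (\<alpha> ^ M)) $ ?A $ ?B =
      (if i \<le> s + 1 then of_nat (p * k1 * J + 1) - of_nat i else - of_nat (q * k1 * J + 1)) *
        of_nat (coefficient J i)" unfolding A B a_def b_def by blast+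
qed

text \<open>
  The factor \<open>\<kappa> (i - 1) - p\<close> is proportional to the eigenvalue of the \<open>i\<close>-th perturbation; it vanishes
  only for a resonant perturbation, which exists only for \<open>m1 = 1\<close>, and then occurs only in \<open>\<Phi> 1\<close>.
\<close>
lemma \<Phi>_\<Delta>_H0_coefficient:
  assumes J: "J \<in> {1..s + 2}" and i: "i \<le> s + 2" and M: "J * m1 = Suc M"
  shows "of_nat M * \<Phi> J (\<Delta> i H0) =
      (-1) ^ M * ((\<kappa> * (of_nat i - 1) - of_nat p) * of_nat (coefficient J i))"
    and "M = 0 \<Longrightarrow> \<Phi> J (\<Delta> i H0) = of_nat p * of_nat (coefficient J i)"
proof -
  let ?A = "q * (J * k1 + 1)" and ?B = "p * (J * k1 + 1)"
  define c :: 'a where "c = of_nat (coefficient J i)"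
  \<comment> \<open>For \<open>M = 0\<close> the perturbation of x' would carry the factor
    \<open>- q\<close> instead of \<open>p\<close>; its coefficient is zero, so one formula covers
    all \<open>i\<close>.\<close>
  have M0: "coefficient J (s + 2) = 0" if "M = 0"
  proof -
    have "J = 1" "m1 = 1" using that M by auto
    then have "p * k1 + q * k1 = s" using ratio by (simp add: algebra_simps)
    moreover have "q * k1 \<ge> 1" using q k1 by simp
    ultimately show ?thesis using \<open>J = 1\<close> by (simp add: coefficient_def)
  qed
  show "\<Phi> J (\<Delta> i H0) = of_nat p * of_nat (coefficient J i)" if "M = 0"
    unfolding \<Phi>_\<Delta>_H0[OF J M] resonant_nth(1)[OF J M i]
    using that M0 i by (cases "i \<le> s + 1") (auto simp: le_Suc_eq)
  show "of_nat M * \<Phi> J (\<Delta> i H0) =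
      (-1) ^ M * ((\<kappa> * (of_nat i - 1) - of_nat p) * of_nat (coefficient J i))"
  proof (cases M)
    case 0
    have "(\<kappa> * (of_nat i - 1) - of_nat p) * c = 0"
    proof (cases "coefficient J i = 0")
      case False
      have J1: "J = 1" "m1 = 1" using 0 M by auto
      then have "coefficient J i = (if i \<le> p * k1 + 1 then 0 choose (p * k1 + 1 - i) else 0)"
        unfolding coefficient_def by simp
      then have "i = p * k1 + 1" using False by (auto split: if_splits simp: binomial_eq_0_iff)
      then have "\<kappa> * (of_nat i - 1) = of_nat p * (\<kappa> * of_nat k1)" by simp
      then show ?thesis unfolding \<kappa>_k1 J1 by simp
    qed (simp add: c_def)
    then show ?thesis using 0 by (simp add: c_def)
  next
    case (Suc M')
    have "of_nat M * (u * \<alpha> ^ (M - 1) * \<Delta> i \<alpha>) = u * \<Delta> i (\<alpha> ^ M)"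
      unfolding \<Delta>_power by (simp only: mult_ac)
    then have "of_nat M * (u * \<alpha> ^ (M - 1) * \<Delta> i \<alpha>) $ ?A $ ?B = (u * \<Delta> i (\<alpha> ^ M)) $ ?A $ ?B"
      by (simp only: of_nat_mult_nth[symmetric])
    then have "of_nat M * \<Phi> J (\<Delta> i H0) = (-1) ^ M *
        (of_nat M * (\<Delta> i u * \<alpha> ^ M) $ ?A $ ?B - \<kappa> * (u * \<Delta> i (\<alpha> ^ M)) $ ?A $ ?B)"
      unfolding \<Phi>_\<Delta>_H0[OF J M] using Suc by (simp add: right_diff_distrib mult.left_commute)
    also have "of_nat M * (\<Delta> i u * \<alpha> ^ M) $ ?A $ ?B - \<kappa> * (u * \<Delta> i (\<alpha> ^ M)) $ ?A $ ?B =
        (\<kappa> * (of_nat i - 1) - of_nat p) * c"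
    proof -
      have \<kappa>J: "\<kappa> * (of_nat k1 * of_nat J) = of_nat M + 1"
      proof -
        have "\<kappa> * (of_nat k1 * of_nat J) = of_nat (J * m1)"
          using \<kappa>_k1 by (simp add: mult.assoc[symmetric] mult.commute)
        then show ?thesis unfolding M by simp
      qed
      show ?thesis
      proof (cases "i \<le> s + 1")
        case True
        have "of_nat M * of_nat p - \<kappa> * (of_nat (p * k1 * J + 1) - of_nat i) =
            of_nat M * of_nat p - of_nat p * (\<kappa> * (of_nat k1 * of_nat J)) + \<kappa> * (of_nat i - 1)"
          by (simp add: algebra_simps)
        also have "\<dots> = \<kappa> * (of_nat i - 1) - of_nat p"
          unfolding \<kappa>J by (simp add: algebra_simps)
        finally have eq: "of_nat M * of_nat p - \<kappa> * (of_nat (p * k1 * J + 1) - of_nat i) =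
            \<kappa> * (of_nat i - 1) - of_nat p" .
        have "of_nat M * (of_nat p * c) - \<kappa> * ((of_nat (p * k1 * J + 1) - of_nat i) * c) =
            (of_nat M * of_nat p - \<kappa> * (of_nat (p * k1 * J + 1) - of_nat i)) * c"
          by (simp only: left_diff_distrib mult.assoc)
        then show ?thesis unfolding resonant_nth[OF J M i] c_def[symmetric] eq
          using True by (simp only: if_True)
      next
        case False
        then have i_eq: "i = s + 2" using i by simp
        have "of_nat M * (- of_nat q) - \<kappa> * (- of_nat (q * k1 * J + 1)) =
            - (of_nat M * of_nat q) + of_nat q * (\<kappa> * (of_nat k1 * of_nat J)) + \<kappa>"
          by (simp add: algebra_simps)
        also have "\<dots> = \<kappa> * of_nat s + \<kappa> - of_nat p"
          unfolding \<kappa>J \<kappa> by (simp add: algebra_simps)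
        also have "\<dots> = \<kappa> * (of_nat i - 1) - of_nat p"
          unfolding i_eq by (simp add: algebra_simps)
        finally have eq: "of_nat M * (- of_nat q) - \<kappa> * (- of_nat (q * k1 * J + 1)) =
            \<kappa> * (of_nat i - 1) - of_nat p" .
        have "of_nat M * (- of_nat q * c) - \<kappa> * (- of_nat (q * k1 * J + 1) * c) =
            (of_nat M * (- of_nat q) - \<kappa> * (- of_nat (q * k1 * J + 1))) * c"
          by (simp only: left_diff_distrib mult.assoc)
        then show ?thesis unfolding resonant_nth[OF J M i] c_def[symmetric] eq
          using False by (simp only: if_False)
      qed
    qed
    finally show ?thesis by (simp add: c_def)
  qed
qed

text \<open>Up to the row factors of \<open>\<Phi>_\<Delta>_H0_coefficient\<close> and the column
  factors \<open>b i\<close>, this is the matrix of \<open>coefficient_surjective\<close>. The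
  exception is a resonant column, with \<open>b i = 0\<close>: it enters only row 1, and in that
  case row 1 contains no other column.\<close>

lemma obstructions_surjective:
  "\<exists>\<theta>. \<forall>J\<in>{1..s + 2}. (\<Sum>i\<le>s + 2. \<theta> i * \<Phi> J (\<Delta> i H0)) = \<tau> J"
proof -
  define b :: "nat \<Rightarrow> 'a" where "b i = \<kappa> * (of_nat i - 1) - of_nat p" for i
  \<comment> \<open>The factor \<open>J * m1 - 1\<close> compensates the multiplication by
    \<open>M\<close>. If \<open>m1 = 1\<close>, it makes \<open>\<sigma> 1 = 0\<close>, which forces
    \<open>t\<close> to vanish at the resonant index, so \<open>\<theta> i * b i = t i\<close>
    needed for the other rows survives there.\<close>
  define \<sigma> :: "nat \<Rightarrow> 'a" where "\<sigma> J = (-1) ^ (J * m1 - 1) * of_nat (J * m1 - 1) * \<tau> J" for J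
  obtain t where t: "\<And>J. J \<in> {1..s + 2} \<Longrightarrow> (\<Sum>i\<le>s + 2. t i * of_nat (coefficient J i)) = \<sigma> J"
    using coefficient_surjective[of \<sigma>] by blast
  \<comment> \<open>At the resonant index the value is free for the rows with \<open>M > 0\<close>
    and is chosen to solve row 1, whose single entry is \<open>p\<close>.\<close>
  define \<theta> where "\<theta> i = (if b i = 0 then \<tau> 1 / of_nat p else t i / b i)" for i
  have one: "coefficient 1 i = (if i = p * k1 + 1 then 1 else 0)" if "m1 = 1" for i
  proof -
    have "coefficient 1 i = (if i \<le> p * k1 + 1 then 0 choose (p * k1 + 1 - i) else 0)"
      unfolding coefficient_def using that by simp
    then show ?thesis by (auto simp: binomial_eq_0_iff)
  qed
  have pk: "p * k1 + 1 \<le> s + 2" if "m1 = 1"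
  proof -
    have "p * k1 + q * k1 = s" using ratio that by (simp add: algebra_simps)
    then show ?thesis by simp
  qed
  have resonant: "m1 = 1 \<and> i = p * k1 + 1" if "b i = 0" for i
  proof -
    have "i \<noteq> 0"
    proof
      assume "i = 0"
      then have "\<kappa> + of_nat p = 0" using that by (simp add: b_def add_eq_0_iff)
      then have "of_nat (p + q) + of_nat p * of_nat s = (0 :: 'a)"
        using \<kappa> by (metis distrib_right mult_zero_left)
      then have "of_nat (p + q + p * s) = (0 :: 'a)" by simp
      then show False using p by (simp only: of_nat_eq_0_iff)
    qed
    then obtain l where l: "i = Suc l" by (cases i) auto
    then have "\<kappa> * of_nat l = of_nat p" using that by (simp add: b_def)
    then have "of_nat m1 * of_nat l = (of_nat p * of_nat k1 :: 'a)"
      unfolding \<kappa>_k1[symmetric] by (metis mult.assoc mult.commute)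
    then have "of_nat (m1 * l) = (of_nat (p * k1) :: 'a)" by simp
    then have eq: "m1 * l = p * k1" by (simp only: of_nat_eq_iff)
    then have "m1 dvd p * k1" by (metis dvd_triv_left)
    moreover have "coprime m1 (p * k1)"
      using coprime_m1_p coprime_k1_m1 by (simp add: coprime_commute)
    ultimately have "m1 = 1" by (metis coprime_common_divisor_nat dvd_refl)
    then show ?thesis using eq l by simp
  qed
  have "(\<Sum>i\<le>s + 2. \<theta> i * \<Phi> J (\<Delta> i H0)) = \<tau> J" if J: "J \<in> {1..s + 2}" for J
  proof -
    have "J * m1 \<noteq> 0" using J m1 by simp
    then obtain M where M: "J * m1 = Suc M" by (cases "J * m1") auto
    show ?thesis
    proof (cases M)
      case 0
      then have J1: "J = 1" "m1 = 1" using M by auto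
      have "b (p * k1 + 1) = of_nat p * (\<kappa> * of_nat k1 - 1)"
        by (simp add: b_def algebra_simps)
      then have "b (p * k1 + 1) = 0" unfolding \<kappa>_k1 J1 by simp
      then have \<theta>1: "\<theta> (p * k1 + 1) * of_nat p = \<tau> 1" using p by (simp add: \<theta>_def)
      have "(\<Sum>i\<le>s + 2. \<theta> i * \<Phi> J (\<Delta> i H0)) =
          (\<Sum>i\<le>s + 2. if i = p * k1 + 1 then \<theta> i * of_nat p else 0)"
      proof (intro sum.cong refl)
        fix i assume "i \<in> {..s + 2}"
        then have "\<Phi> J (\<Delta> i H0) = of_nat p * of_nat (coefficient 1 i)"
          using \<Phi>_\<Delta>_H0_coefficient(2)[OF J _ M 0] J1 by simp
        then show "\<theta> i * \<Phi> J (\<Delta> i H0) = (if i = p * k1 + 1 then \<theta> i * of_nat p else 0)"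
          by (simp only: one[OF J1(2)]) simp
      qed
      also have "\<dots> = \<tau> 1" unfolding sum.delta[OF finite_atMost] using pk[OF J1(2)] \<theta>1 by simp
      finally show ?thesis using J1 by simp
    next
      case (Suc M')
      have "of_nat M * (\<Sum>i\<le>s + 2. \<theta> i * \<Phi> J (\<Delta> i H0)) =
          (\<Sum>i\<le>s + 2. \<theta> i * (of_nat M * \<Phi> J (\<Delta> i H0)))"
        by (simp only: sum_distrib_left mult.left_commute)
      also have "\<dots> = (\<Sum>i\<le>s + 2. (-1) ^ M * (t i * of_nat (coefficient J i)))"
      proof (intro sum.cong refl)
        fix i assume i: "i \<in> {..s + 2}"
        have "\<theta> i * (of_nat M * \<Phi> J (\<Delta> i H0)) = (-1) ^ M * (\<theta> i * b i * of_nat (coefficient J i))"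
          using \<Phi>_\<Delta>_H0_coefficient(1)[OF J _ M] i by (simp add: b_def)
        also have "\<theta> i * b i = t i"
        proof (cases "b i = 0")
          case True
          note res = resonant[OF True]
          have "(\<Sum>i\<le>s + 2. t i * of_nat (coefficient 1 i)) = t (p * k1 + 1)"
            unfolding one[OF conjunct1[OF res]] using pk res
            by (simp add: if_distrib[of "\<lambda>x. _ * x"] if_distrib[of of_nat] cong: if_cong)
          moreover have "(\<Sum>i\<le>s + 2. t i * of_nat (coefficient 1 i)) = 0"
            using t[of 1] res by (simp add: \<sigma>_def)
          ultimately show ?thesis using True res by simp
        qed (simp add: \<theta>_def)
        finally show "\<theta> i * (of_nat M * \<Phi> J (\<Delta> i H0)) = (-1) ^ M * (t i * of_nat (coefficient J i))" .
      qed
      also have "\<dots> = (-1) ^ M * \<sigma> J" unfolding sum_distrib_left[symmetric] t[OF J] ..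
      also have "\<dots> = of_nat M * \<tau> J"
      proof -
        have "(-1) ^ M * (-1) ^ M = (1 :: 'a)" by (simp flip: power_mult_distrib)
        moreover have "(-1) ^ M * \<sigma> J = ((-1) ^ M * (-1) ^ M) * (of_nat M * \<tau> J)"
          unfolding \<sigma>_def M by (simp only: diff_Suc_1 mult.assoc)
        ultimately show ?thesis by (simp only: mult_1_left)
      qed
      finally have eq: "of_nat M * (\<Sum>i\<le>s + 2. \<theta> i * \<Phi> J (\<Delta> i H0)) = of_nat M * \<tau> J" .
      have "of_nat M \<noteq> (0 :: 'a)" using Suc by (simp del: of_nat_Suc)
      from mult_left_cancel[OF this] eq show ?thesis by (rule iffD1)
    qed
  qed
  then show ?thesis by (intro exI[of _ \<theta>] ballI)
qed

section \<open>Solving the linearized equation for each monomial\<close>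

lemma vanishes_below_H0_diff: "vanishes_below (Suc (p + q)) (H0 - u)"
proof -
  have "H0 - u = (\<Sum>l\<in>{..<Suc ((s + 2) * m1)} - {0}. scalar (h l) * (u * \<alpha> ^ l))"
    unfolding H0_def first_integral_def by (subst sum.remove[of _ 0]) (auto simp: h_def)
  moreover have "vanishes_below (p + q + 1) \<dots>"
  proof (intro vanishes_below_sum vanishes_below_mult_left[where G = "u * _"] vanishes_below_mult
      vanishes_below_homogeneous[OF homogeneous_u])
    fix l assume "l \<in> {..<Suc ((s + 2) * m1)} - {0}"
    then have "1 \<le> l * s" using s by (cases l) auto
    then show "vanishes_below 1 (\<alpha> ^ l)"
      using vanishes_below_homogeneous[OF homogeneous_\<alpha>_power] by (rule vanishes_below_mono[rotated])
  qed
  ultimately show ?thesis by simp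
qed

lemma degree_class_H0: "degree_class s (p + q) H0"
  unfolding H0_def first_integral_def
proof (intro degree_class_sum degree_class_scalar_mult)
  fix l
  have "degree_class s (p + q + l * s) (u * \<alpha> ^ l)"
    by (rule degree_class_mod[OF degree_class_mult[OF homogeneous_u homogeneous_\<alpha>_power]])
  then show "degree_class s (p + q) (u * \<alpha> ^ l)"
    by (rule degree_class_cong) (simp add: cong_def)
qed

text \<open>The monomials \<open>x\<^sup>i y\<^sup>j\<close> on which the perturbed equation is solved exactly.\<close>

definition exponents :: "(nat \<times> nat) set" where
  "exponents = {(i, j). p + q < i + j \<and> i + j \<le> p + q + (s + 2) * m1 * s \<and> [i + j = p + q] (mod s)}"

lemma finite_exponents: "finite exponents"
proof (rule finite_subset)
  show "exponents \<subseteq> {..p + q + (s + 2) * m1 * s} \<times> {..p + q + (s + 2) * m1 * s}"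
    by (auto simp: exponents_def)
qed simp

text \<open>The perturbation reproduces all obstructions of the given monomial; what is left has
  none and is an image under \<open>V\<close> up to high degree.\<close>

lemma linearized_equation_solvable:
  assumes "ij \<in> exponents"
  shows "\<exists>\<theta> G. degree_class s (p + q) G \<and> vanishes_below (Suc (p + q)) G \<and>
    vanishes_below (Suc (p + q + (s + 2) * m1 * s))
      (V G + (\<Sum>i\<le>s + 2. scalar (\<theta> i) * \<Delta> i H0) - var_x ^ fst ij * var_y ^ snd ij)"
proof -
  let ?e = "var_x ^ fst ij * var_y ^ snd ij :: 'a fps fps"
  obtain \<theta> where \<theta>: "\<And>J. J \<in> {1..s + 2} \<Longrightarrow> (\<Sum>i\<le>s + 2. \<theta> i * \<Phi> J (\<Delta> i H0)) = \<Phi> J ?e"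
    using obstructions_surjective[of "\<lambda>J. \<Phi> J ?e"] by blast
  let ?F = "?e - (\<Sum>i\<le>s + 2. scalar (\<theta> i) * \<Delta> i H0)"
  have "vanishes_below (Suc (p + q)) (\<Delta> i H0)" for i
  proof -
    have "vanishes_below (p + q) H0"
      using vanishes_below_add[OF vanishes_below_mono[OF vanishes_below_H0_diff, of "p + q"]
          vanishes_below_homogeneous[OF homogeneous_u]] by simp
    then show ?thesis using vanishes_below_\<Delta>[of "p + q" H0 i] s by (auto elim: vanishes_below_mono)
  qed
  moreover have "vanishes_below (Suc (p + q)) ?e"
    using assms by (auto simp: exponents_def intro: vanishes_below_mono[OF vanishes_below_monomial])
  ultimately have "vanishes_below (Suc (p + q)) ?F"
    by (intro vanishes_below_diff vanishes_below_sum vanishes_below_mult_left[where G = "\<Delta> _ H0"])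
  moreover have "degree_class s (p + q) ?F"
  proof (intro degree_class_diff degree_class_sum degree_class_scalar_mult degree_class_\<Delta> degree_class_H0)
    show "degree_class s (p + q) ?e"
      using assms by (auto simp: exponents_def degree_class_def monomial_nth split: if_splits)
  qed
  moreover have "\<Phi> J ?F = 0" if "J \<in> {1..s + 2}" for J
    using \<theta>[OF that] by (simp only: \<Phi>_diff \<Phi>_sum \<Phi>_scalar_mult) simp
  ultimately obtain G where G: "degree_class s (p + q) G" "vanishes_below (Suc (p + q)) G"
    "vanishes_below (Suc (p + q + (s + 2) * m1 * s)) (?F - V G)"
    using solve_modulo_obstructions[of ?F] by blast
  from vanishes_below_uminus[OF G(3)] have "vanishes_below (Suc (p + q + (s + 2) * m1 * s))
      (V G + (\<Sum>i\<le>s + 2. scalar (\<theta> i) * \<Delta> i H0) - ?e)"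
    by (simp only: minus_diff_eq diff_diff_eq2 add.commute)
  with G show ?thesis by blast
qed

end

section \<open>From the linearized equation to an exact perturbation\<close>

text \<open>The linearized solutions \<open>(\<theta> t, G t)\<close> are superposed with one set of
  weights \<open>w t\<close> for both field and first integral. The linear terms then give
  \<open>w t\<close> as the coefficient of the monomial \<open>t\<close>, and the cross terms are
  quadratic in \<open>w\<close>.\<close>

lemma saddle_order_attained:
  fixes \<kappa> :: "'a::{real_normed_field,banach}"
  assumes "perturbed_saddle p q s r k1 m1 \<kappa>"
  shows "\<exists>P Q :: 'a poly poly. homogeneous2 (Suc s) P \<and> homogeneous2 (Suc s) Q \<and>
     no_low_terms (fps2_of_poly2 P) \<and> no_low_terms (fps2_of_poly2 Q) \<and>
     has_saddle_order p q P Q ((s + 2) * k1)"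
proof -
  interpret perturbed_saddle p q s r k1 m1 \<kappa> by fact
  let ?N = "(s + 2) * k1" and ?d = "p + q + (s + 2) * m1 * s"
  let ?top = "(q * Suc ?N, p * Suc ?N)"
  have deg: "(p + q) * Suc ?N = ?d"
  proof -
    have "(p + q) * Suc ?N = p + q + (s + 2) * ((p + q) * k1)" by (simp add: algebra_simps)
    then show ?thesis unfolding ratio by (simp only: mult_ac)
  qed
  define solves where "solves t \<theta> G \<longleftrightarrow> degree_class s (p + q) G \<and> vanishes_below (Suc (p + q)) G \<and>
    vanishes_below (Suc ?d) (V G + (\<Sum>i\<le>s + 2. scalar (\<theta> i) * \<Delta> i H0) - var_x ^ fst t * var_y ^ snd t)"
    for t \<theta> G
  have "\<forall>t\<in>exponents. \<exists>\<theta> G. solves t \<theta> G"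
    unfolding solves_def by (intro ballI linearized_equation_solvable)
  then obtain \<theta> where "\<forall>t\<in>exponents. \<exists>G. solves t (\<theta> t) G"
    using bchoice[of exponents "\<lambda>t \<theta>. \<exists>G. solves t \<theta> G"] by blast
  then obtain G where "\<forall>t\<in>exponents. solves t (\<theta> t) (G t)"
    using bchoice[of exponents "\<lambda>t G. solves t (\<theta> t) G"] by blast
  then have \<theta>G: "degree_class s (p + q) (G t)" "vanishes_below (Suc (p + q)) (G t)"
    "vanishes_below (Suc ?d) (V (G t) + (\<Sum>i\<le>s + 2. scalar (\<theta> t i) * \<Delta> i H0) - var_x ^ fst t * var_y ^ snd t)"
    if "t \<in> exponents" for t
    using that by (simp_all add: solves_def)
  \<comment> \<open>The second-order effect: the perturbation belonging to \<open>t\<close> acting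
    on the correction belonging to \<open>t'\<close>.\<close>
  define B where "B t t' = (\<Sum>i\<le>s + 2. scalar (\<theta> t i) * \<Delta> i (G t'))" for t t'
  have sum_top: "q * Suc ?N + p * Suc ?N = ?d"
    using deg by (simp add: algebra_simps)
  have top: "?top \<in> exponents"
  proof -
    have "(s + 2) * m1 * s > 0" using m1 s by simp
    then have "p + q < ?d \<and> ?d \<le> ?d \<and> [?d = p + q] (mod s)"
      by (intro conjI) (linarith, simp, simp add: cong_def)
    then show ?thesis by (simp only: exponents_def mem_Collect_eq case_prod_conv sum_top)
  qed
  \<comment> \<open>All equations are homogeneous except the one for the top resonant monomial,
    where \<delta> becomes the nonzero leading coefficient.\<close>
  obtain w \<delta> where \<delta>: "\<delta> \<noteq> 0" and w: "\<And>t. t \<in> exponents \<Longrightarrow>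
    w t + (\<Sum>t1\<in>exponents. \<Sum>t2\<in>exponents. w t1 * w t2 * B t1 t2 $ fst t $ snd t) =
    (if t = ?top then \<delta> else 0)"
    using quadratic_system_solution[OF finite_exponents top, of "\<lambda>t1 t2 t. B t1 t2 $ fst t $ snd t"] by blast
  define \<Theta> where "\<Theta> i = (\<Sum>t\<in>exponents. w t * \<theta> t i)" for i
  define H where "H = H0 + (\<Sum>t\<in>exponents. scalar (w t) * G t)"
  define A' where "A' = var_x * f + (\<Sum>i\<le>s + 2. scalar (\<Theta> i) * field_x i)"
  define B' where "B' = var_y * f + (\<Sum>i\<le>s + 2. scalar (\<Theta> i) * field_y i)"
  have "degree_class 0 (1 + s) (var_x * f)" "degree_class 0 (1 + s) (var_y * f)"
    using degree_class_monomial[of 0 1 0, where ?'a = 'a] degree_class_monomial[of 0 0 1, where ?'a = 'a]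
    by (intro degree_class_mult homogeneous_f; simp)+
  then have hom: "degree_class 0 (Suc s) A'" "degree_class 0 (Suc s) B'"
    unfolding A'_def B'_def
    by (intro degree_class_add degree_class_sum degree_class_scalar_mult homogeneous_field; simp)+
  then obtain P Q where P: "homogeneous2 (Suc s) P" "fps2_of_poly2 P = A'"
    and Q: "homogeneous2 (Suc s) Q" "fps2_of_poly2 Q = B'"
    using homogeneous_polynomial_exists by metis
  have low: "vanishes_below 2 A'" "vanishes_below 2 B'"
    using hom[THEN vanishes_below_homogeneous] s by (auto elim: vanishes_below_mono)
  then have PQ_low: "no_low_terms (fps2_of_poly2 P)" "no_low_terms (fps2_of_poly2 Q)"
    unfolding P Q by (simp_all add: no_low_terms_def vanishes_below_def)
  have time: "time_deriv p q P Q F = V F + (\<Sum>i\<le>s + 2. scalar (\<Theta> i) * \<Delta> i F)" for F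
  proof -
    have "time_deriv p q P Q F = vector_field (scalar (of_nat p) * var_x + A') (scalar (- of_nat q) * var_y + B') F"
      by (simp add: time_deriv_def vector_field_def P Q scalar_of_nat flip: fps_const_neg)
    also have "\<dots> = D0 F + vector_field (f * var_x) (f * var_y) F +
        vector_field (\<Sum>i\<le>s + 2. scalar (\<Theta> i) * field_x i) (\<Sum>i\<le>s + 2. scalar (\<Theta> i) * field_y i) F"
      unfolding A'_def B'_def vector_field_add_fields by (simp only: D0_def mult.commute[of f] add.assoc)
    also have "\<dots> = V F + (\<Sum>i\<le>s + 2. scalar (\<Theta> i) * \<Delta> i F)"
      unfolding vector_field_sum_fields vector_field_mult_fields by (simp add: V_def E_def \<Delta>_def)
    finally show ?thesis .
  qed
  define R where "R = time_deriv p q P Q H - scalar \<delta> * u ^ Suc ?N"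
  have u_pow: "u ^ Suc ?N = var_x ^ (q * Suc ?N) * var_y ^ (p * Suc ?N)"
    unfolding u_def by (simp only: power_mult_distrib power_mult)
  have R_eq: "R = V H0 + (\<Sum>t\<in>exponents. scalar (w t) *
        (V (G t) + (\<Sum>i\<le>s + 2. scalar (\<theta> t i) * \<Delta> i H0) - var_x ^ fst t * var_y ^ snd t)) +
      ((\<Sum>t\<in>exponents. scalar (w t) * (var_x ^ fst t * var_y ^ snd t)) +
       (\<Sum>t\<in>exponents. \<Sum>t'\<in>exponents. scalar (w t * w t') * B t t') - scalar \<delta> * u ^ Suc ?N)"
  proof -
    have \<Theta>: "(\<Sum>i\<le>s + 2. scalar (\<Theta> i) * F i) = (\<Sum>t\<in>exponents. scalar (w t) * (\<Sum>i\<le>s + 2. scalar (\<theta> t i) * F i))" for F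
    proof -
      have eq: "scalar (\<Theta> i) = (\<Sum>t\<in>exponents. scalar (w t) * scalar (\<theta> t i))" for i
        unfolding \<Theta>_def scalar_mult[symmetric] by (rule scalar_sum)
      show ?thesis unfolding eq sum_distrib_left sum_distrib_right mult.assoc by (rule sum.swap)
    qed
    have inner: "(\<Sum>i\<le>s + 2. scalar (\<theta> t i) * \<Delta> i (\<Sum>t'\<in>exponents. scalar (w t') * G t')) =
        (\<Sum>t'\<in>exponents. scalar (w t') * B t t')" for t
      unfolding B_def \<Delta>_sum \<Delta>_scalar_mult sum_distrib_left
      by (subst sum.swap) (simp only: mult.left_commute)
    have "(\<Sum>i\<le>s + 2. scalar (\<Theta> i) * \<Delta> i (\<Sum>t'\<in>exponents. scalar (w t') * G t')) =
        (\<Sum>t\<in>exponents. \<Sum>t'\<in>exponents. scalar (w t * w t') * B t t')"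
      unfolding \<Theta>[of "\<lambda>i. \<Delta> i (\<Sum>t'\<in>exponents. scalar (w t') * G t')"] inner
      by (simp only: scalar_mult mult.assoc sum_distrib_left)
    moreover have "V H = V H0 + (\<Sum>t\<in>exponents. scalar (w t) * V (G t))"
      unfolding H_def V_add V_sum V_scalar_mult ..
    moreover have "(\<Sum>i\<le>s + 2. scalar (\<Theta> i) * \<Delta> i H) = (\<Sum>i\<le>s + 2. scalar (\<Theta> i) * \<Delta> i H0) +
        (\<Sum>i\<le>s + 2. scalar (\<Theta> i) * \<Delta> i (\<Sum>t'\<in>exponents. scalar (w t') * G t'))"
      unfolding H_def \<Delta>_def vector_field_add by (simp only: distrib_left sum.distrib)
    ultimately show ?thesis
      unfolding R_def time \<Theta>[of "\<lambda>i. \<Delta> i H0"]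
      by (simp only: right_diff_distrib distrib_left sum.distrib sum_subtractf) (simp add: algebra_simps)
  qed
  have G_low: "vanishes_below (Suc (p + q)) (\<Sum>t\<in>exponents. scalar (w t) * G t)"
    by (intro vanishes_below_sum vanishes_below_mult_left[where F = "scalar _"] \<theta>G(2))
  have G_class: "degree_class s (p + q) (\<Sum>t\<in>exponents. scalar (w t) * G t)"
    by (intro degree_class_sum degree_class_scalar_mult \<theta>G(1))
  have H_u: "vanishes_below (Suc (p + q)) (H - u)"
    using vanishes_below_add[OF vanishes_below_H0_diff G_low] by (simp add: H_def algebra_simps)
  have R_nth: "R $ fst t $ snd t = 0" if t: "t \<in> exponents" for t
  proof -
    have t_deg: "fst t + snd t < Suc ?d" using t by (auto simp: exponents_def)
    have "vanishes_below (Suc ?d) (V H0)"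
      unfolding H0_def using vanishes_below_V_first_integral[of "(s + 2) * m1"] s
      by (auto elim!: vanishes_below_mono)
    moreover have "vanishes_below (Suc ?d) (\<Sum>t\<in>exponents. scalar (w t) *
        (V (G t) + (\<Sum>i\<le>s + 2. scalar (\<theta> t i) * \<Delta> i H0) - var_x ^ fst t * var_y ^ snd t))"
      by (intro vanishes_below_sum vanishes_below_mult_left[where F = "scalar _"] \<theta>G(3))
    moreover have "(\<Sum>t'\<in>exponents. scalar (w t') * (var_x ^ fst t' * var_y ^ snd t')) $ fst t $ snd t = w t"
    proof -
      have "(\<Sum>t'\<in>exponents. scalar (w t') * (var_x ^ fst t' * var_y ^ snd t')) $ fst t $ snd t =
          (\<Sum>t'\<in>exponents. if t' = t then w t' else 0)"
        unfolding fps_sum_nth scalar_mult_nth monomial_nth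
        by (intro sum.cong refl) (auto simp: prod_eq_iff)
      then show ?thesis using t finite_exponents by simp
    qed
    moreover have "(scalar \<delta> * u ^ Suc ?N) $ fst t $ snd t = (if t = ?top then \<delta> else 0)"
      unfolding u_pow scalar_mult_nth monomial_nth by (auto simp: prod_eq_iff)
    moreover have "(\<Sum>t1\<in>exponents. \<Sum>t2\<in>exponents. scalar (w t1 * w t2) * B t1 t2) $ fst t $ snd t =
        (\<Sum>t1\<in>exponents. \<Sum>t2\<in>exponents. w t1 * w t2 * B t1 t2 $ fst t $ snd t)"
      by (simp only: fps_sum_nth scalar_mult_nth)
    ultimately show ?thesis
      unfolding R_eq fps_add_nth fps_sub_nth using w[OF t] t_deg by (simp add: vanishes_below_def)
  qed
  have "vanishes_below (Suc (p + q)) R"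
  proof -
    have "vanishes_below (p + q) H"
      using vanishes_below_add[OF vanishes_below_mono[OF H_u, of "p + q"]
          vanishes_below_homogeneous[OF homogeneous_u]] by simp
    then have "vanishes_below (Suc (p + q)) (\<Delta> i H)" for i
      using vanishes_below_\<Delta>[of "p + q" H i] s by (auto elim: vanishes_below_mono)
    then have "vanishes_below (Suc (p + q)) (\<Sum>i\<le>s + 2. scalar (\<Theta> i) * \<Delta> i H)"
      by (intro vanishes_below_sum vanishes_below_mult_left[where G = "\<Delta> _ H"])
    moreover have "vanishes_below (Suc (p + q)) (V H)"
    proof -
      have "V H = V H0 + V (\<Sum>t\<in>exponents. scalar (w t) * G t)" unfolding H_def by (rule V_add)
      moreover have "vanishes_below (Suc (p + q)) (V H0)"
        unfolding H0_def using vanishes_below_V_first_integral[of "(s + 2) * m1"] s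
        by (auto elim!: vanishes_below_mono)
      ultimately show ?thesis using vanishes_below_V[OF G_low] by (simp only: vanishes_below_add)
    qed
    moreover have "vanishes_below (Suc (p + q)) (scalar \<delta> * u ^ Suc ?N)"
    proof (rule vanishes_below_mult_left)
      have "vanishes_below ?d (u ^ Suc ?N)"
        unfolding u_pow sum_top[symmetric] by (rule vanishes_below_monomial)
      then show "vanishes_below (Suc (p + q)) (u ^ Suc ?N)"
        by (rule vanishes_below_mono) (use m1 s in simp)
    qed
    ultimately show ?thesis unfolding R_def time by (intro vanishes_below_diff vanishes_below_add)
  qed
  moreover have "degree_class s (p + q) R"
  proof -
    have "degree_class s (p + q) H"
      unfolding H_def by (intro degree_class_add degree_class_H0 G_class)
    moreover have "degree_class s (p + q) (u ^ Suc ?N)"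
    proof (rule degree_class_cong)
      show "degree_class s ?d (u ^ Suc ?N)"
        unfolding u_pow sum_top[symmetric] by (rule degree_class_monomial)
      show "[?d = p + q] (mod s)" by (simp add: cong_def)
    qed
    ultimately show ?thesis unfolding R_def time
      by (intro degree_class_diff degree_class_add degree_class_V degree_class_sum
          degree_class_scalar_mult degree_class_\<Delta>)
  qed
  \<comment> \<open>Off \<open>exponents\<close> the coefficients vanish for degree reasons:
    \<open>R\<close> starts above degree \<open>p + q\<close> and lies in one class modulo
    \<open>s\<close>.\<close>
  ultimately have "R $ i $ j = 0" if "i + j < Suc ?d" for i j
    using R_nth[of "(i, j)"] that
    by (cases "R $ i $ j = 0"; cases "i + j < Suc (p + q)")
       (auto simp: exponents_def degree_class_def vanishes_below_def)
  then have "vanishes_below (Suc ((p + q) * Suc ?N)) R" unfolding deg vanishes_below_def by blast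
  then have "has_saddle_order p q P Q ?N"
    using p q coprime PQ_low H_u \<delta> k1 unfolding R_def u_def
    by (intro has_saddle_orderI[where H = H and c = \<delta>]) simp_all
  with P(1) Q(1) PQ_low show ?thesis by blast
qed

section \<open>Choice of \<open>r\<close> and the size of \<open>n\<close>\<close>

text \<open>Taking \<open>r = s - c\<close> with \<open>c \<le> p\<close> keeps \<open>r\<close>
  close to \<open>s\<close>, and \<open>p * k1 < r * m1\<close>, which is p s < r (p + q), follows
  from p (p + q) < s. The summand \<open>2 * (p + q)\<close> in the bound on \<open>n\<close> gives
  \<open>k1 \<ge> 2\<close> and helps to secure \<open>p + q < s\<close>.\<close>

lemma M_h_lower_bound:
  assumes "1 \<le> p" "1 \<le> q" "coprime p q" and n: "n \<ge> p * (p + q) + 2 * (p + q) + 2"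
  shows "enat ((n\<^sup>2 - 1) div gcd (n - 1) (p + q)) \<le> M_h TYPE('a::{real_normed_field,banach}) p q n"
proof -
  define s where "s = n - 1"
  define d where "d = gcd s (p + q)"
  define k1 where "k1 = s div d"
  define m1 where "m1 = (p + q) div d"
  have s: "p * (p + q) + 2 * (p + q) + 1 \<le> s" "n = Suc s" using n by (auto simp: s_def)
  have d0: "d > 0" using assms(1) by (simp add: d_def)
  have s_k1: "s = k1 * d" and m1: "p + q = m1 * d" by (simp_all add: k1_def m1_def d_def)
  have d_le: "d \<le> p + q" using assms(1) by (auto simp: d_def intro: gcd_le2_nat)
  have coprime_k1_m1: "coprime k1 m1"
    unfolding k1_def m1_def d_def using assms(1) by (intro div_gcd_coprime) simp
  obtain c where c: "c \<ge> 1" "c \<le> p" "\<And>r. r + c = s \<Longrightarrow> coprime r (s * p)"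
    using exists_coprime_shift[OF assms(1), of s] by blast
  define r where "r = s - c"
  have ps: "p \<le> p * (p + q)" using assms(1) by simp
  then have rc: "r + c = s" "r \<ge> 1" "r \<le> s" using s(1) c(2) assms(1) by (auto simp: r_def)
  have "p * k1 dvd s * p" unfolding s_k1 by simp
  then have r_coprime: "coprime r (p * k1)" using c(3)[OF rc(1)] by (metis coprime_divisors dvd_refl)
  have "p * k1 * d < r * m1 * d"
  proof -
    have "c * (p + q) \<le> p * (p + q)" using c(2) by (rule mult_right_mono) simp
    also have "\<dots> < s" using s(1) by simp
    also have "s \<le> q * s" using assms(2) by simp
    finally have "p * s + c * (p + q) < s * (p + q)" by (simp add: algebra_simps)
    also have "s * (p + q) = r * (p + q) + c * (p + q)" unfolding rc(1)[symmetric] by (simp add: algebra_simps)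
    finally have "p * s < r * (p + q)" by simp
    then show ?thesis unfolding s_k1 m1 by (simp add: mult_ac)
  qed
  then have lt: "p * k1 < r * m1" by simp
  have "2 * d \<le> k1 * d" using s(1) d_le unfolding s_k1[symmetric] by simp
  then have "2 \<le> k1" using d0 by simp
  then have two: "2 \<le> p * k1" using assms(1) by (metis mult_le_mono nat_mult_1)
  have "perturbed_saddle p q s r k1 m1 (of_nat (p + q) / of_nat s :: 'a)"
  proof
    show "(p + q) * k1 = s * m1" unfolding m1 s_k1 by (simp add: mult_ac)
    show "of_nat (p + q) / of_nat s * of_nat s = (of_nat (p + q) :: 'a)" using s(1) by simp
    show "p + q < s" using s(1) by simp
  qed (use assms coprime_k1_m1 rc r_coprime lt two in auto)
  from saddle_order_attained[OF this]
  have "enat ((s + 2) * k1) \<le> M_h TYPE('a) p q n"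
    unfolding M_h_def s(2) by (intro Sup_upper) blast
  moreover have "(n\<^sup>2 - 1) div gcd (n - 1) (p + q) = (s + 2) * k1"
  proof -
    have "n\<^sup>2 - 1 = (s + 2) * s" unfolding s(2) by (simp add: power2_eq_square)
    also have "\<dots> = (s + 2) * k1 * d" unfolding mult.assoc s_k1[symmetric] ..
    finally show ?thesis using d0 by (simp add: d_def s_def)
  qed
  ultimately show ?thesis by simp
qed

(* The division is exact, since gcd (n - 1) (p + q) divides n - 1 and hence n^2 - 1. *)
theorem theorem1:
  fixes p q :: nat
  assumes "1 \<le> p" and "p \<le> q" and "gcd p q = 1"
  shows "\<exists>N. \<forall>n\<ge>N.
    enat ((n\<^sup>2 - 1) div gcd (n - 1) (p + q)) \<le> M_h TYPE(real) p q n \<and>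
    enat ((n\<^sup>2 - 1) div gcd (n - 1) (p + q)) \<le> M_h TYPE(complex) p q n"
proof -
  have "1 \<le> q" "coprime p q" using assms by (auto simp: coprime_iff_gcd_eq_1)
  then show ?thesis
    by (intro exI[of _ "p * (p + q) + 2 * (p + q) + 2"] allI impI conjI M_h_lower_bound assms(1))
qed

end
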